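(* Let $A$ be a division Albert algebra over $K$, let $L\subset A$ be a cubic subfield and let $g\in\mathbf{Str}(A)(K)$ satisfy $g(L)=L$. Then there exist $r\in\mathbf{Str}(A)(K)$ which is $R$-equivalent to $1$, $g_1\in N_{\mathbf{H}}(\mathbf{G}^L)(K)$ and $g_2\in\mathbf{G}^L(K)$, with $g_1(L)=g_2(L)=L$, such that $g=rg_1g_2$.
   Context: $K$ is an infinite field of characteristic different from $2$ and $3$. $\mathbf{Str}(A)$ is the group of norm similitudes of the division Albert algebra $A$; $\mathbf{G}=[\mathbf{Str}(A),\mathbf{Str}(A)]$; $\mathbf{H}=\mathbf{Aut}(A)$; $\mathbf{G}^L=\{x\in\mathbf{G}\mid x(l)=l\ \forall l\in L\}$ (contained in $\mathbf{H}$); $N_{\mathbf{H}}(\mathbf{G}^L)$ is its normalizer in $\mathbf{H}$. $R$-equivalence to $1$: connected to $1$ by a chain of rational curves $\mathbb{A}^1\dashrightarrow\mathbf{Str}(A)$ defined at $0,1$; these elements form a normal subgroup. *)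

theory Defs
  imports "HOL-Analysis.Analysis" "HOL-Computational_Algebra.Polynomial"
begin

text \<open>The Albert algebra is modelled on the coordinate space K^27 (a fixed basis),
 as a cubic norm structure (N, sharp, e): N a cubic form, sharp a quadratic map, e the unit.
 K-linear maps A -> A are 27 x 27 matrices acting by *v.\<close>

type_synonym 'k alb = "'k ^ 27"
type_synonym 'k endo = "'k ^ 27 ^ 27"

definition cubic_form :: "('k::field alb \<Rightarrow> 'k) \<Rightarrow> bool" where
  "cubic_form N \<longleftrightarrow> (\<exists>c :: 27 \<Rightarrow> 27 \<Rightarrow> 27 \<Rightarrow> 'k.
     \<forall>x. N x = (\<Sum>i\<in>UNIV. \<Sum>j\<in>UNIV. \<Sum>k\<in>UNIV. c i j k * x$i * x$j * x$k))"

definition quadratic_map :: "('k::field alb \<Rightarrow> 'k alb) \<Rightarrow> bool" where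
  "quadratic_map S \<longleftrightarrow> (\<exists>d :: 27 \<Rightarrow> 27 \<Rightarrow> 27 \<Rightarrow> 'k.
     \<forall>x l. S x $ l = (\<Sum>i\<in>UNIV. \<Sum>j\<in>UNIV. d l i j * x$i * x$j))"

definition lin :: "('k::field alb \<Rightarrow> 'k) \<Rightarrow> 'k alb \<Rightarrow> 'k alb \<Rightarrow> 'k" where
  "lin f x y = (THE b. \<exists>c d. \<forall>t. f (x + t *s y) = f x + t * b + t^2 * c + t^3 * d)"

text \<open>Bilinear trace T(y,z) = - (D_y D_z log N)(1), linear trace T(x) = T(x,1).\<close>
definition trace2 :: "('k::field alb \<Rightarrow> 'k) \<Rightarrow> 'k alb \<Rightarrow> 'k alb \<Rightarrow> 'k alb \<Rightarrow> 'k" where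
  "trace2 N e y z = lin N e y * lin N e z - lin (\<lambda>x. lin N x y) e z"

definition trace1 :: "('k::field alb \<Rightarrow> 'k) \<Rightarrow> 'k alb \<Rightarrow> 'k alb \<Rightarrow> 'k" where
  "trace1 N e x = trace2 N e x e"

definition cross :: "('k::field alb \<Rightarrow> 'k alb) \<Rightarrow> 'k alb \<Rightarrow> 'k alb \<Rightarrow> 'k alb" where
  "cross S x y = S (x + y) - S x - S y"

text \<open>Cubic norm structure axioms (McCrimmon / Petersson--Racine).\<close>
definition cubic_norm_structure ::
  "('k::field alb \<Rightarrow> 'k) \<Rightarrow> ('k alb \<Rightarrow> 'k alb) \<Rightarrow> 'k alb \<Rightarrow> bool" where
  "cubic_norm_structure N S e \<longleftrightarrow>
     cubic_form N \<and> quadratic_map S \<and>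
     N e = 1 \<and> S e = e \<and>
     (\<forall>x. S (S x) = N x *s x) \<and>
     (\<forall>x y. trace2 N e (S x) y = lin N x y) \<and>
     (\<forall>x. cross S e x = trace1 N e x *s e - x)"

text \<open>Division Albert algebra: a 27-dimensional nondegenerate cubic norm structure
 whose norm is anisotropic (every nonzero element invertible).\<close>
definition division_albert ::
  "('k::field alb \<Rightarrow> 'k) \<Rightarrow> ('k alb \<Rightarrow> 'k alb) \<Rightarrow> 'k alb \<Rightarrow> bool" where
  "division_albert N S e \<longleftrightarrow>
     cubic_norm_structure N S e \<and>
     (\<forall>y. (\<forall>z. trace2 N e y z = 0) \<longrightarrow> y = 0) \<and>
     (\<forall>x. x \<noteq> 0 \<longrightarrow> N x \<noteq> 0)"

definition jprod ::
  "('k::field alb \<Rightarrow> 'k) \<Rightarrow> ('k alb \<Rightarrow> 'k alb) \<Rightarrow> 'k alb \<Rightarrow> 'k alb \<Rightarrow> 'k alb \<Rightarrow> 'k alb" where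
  "jprod N S e x y = inverse 2 *s (cross S x y + trace1 N e x *s y + trace1 N e y *s x
      - trace1 N e (cross S x y) *s e)"

definition cubic_subfield ::
  "('k::field alb \<Rightarrow> 'k) \<Rightarrow> ('k alb \<Rightarrow> 'k alb) \<Rightarrow> 'k alb \<Rightarrow> 'k alb set \<Rightarrow> bool" where
  "cubic_subfield N S e L \<longleftrightarrow>
     (\<exists>b1 b2 b3. L = {a1 *s b1 + a2 *s b2 + a3 *s b3 | a1 a2 a3. True} \<and>
        (\<forall>a1 a2 a3. a1 *s b1 + a2 *s b2 + a3 *s b3 = 0 \<longrightarrow> a1 = 0 \<and> a2 = 0 \<and> a3 = 0)) \<and>
     e \<in> L \<and>
     (\<forall>x\<in>L. \<forall>y\<in>L. jprod N S e x y \<in> L) \<and>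
     (\<forall>x\<in>L. \<forall>y\<in>L. \<forall>z\<in>L. jprod N S e (jprod N S e x y) z = jprod N S e x (jprod N S e y z)) \<and>
     (\<forall>x\<in>L. x \<noteq> 0 \<longrightarrow> (\<exists>y\<in>L. jprod N S e x y = e))"

definition Str :: "('k::field alb \<Rightarrow> 'k) \<Rightarrow> 'k endo set" where
  "Str N = {g. det g \<noteq> 0 \<and> (\<exists>\<nu>. \<forall>x. N (g *v x) = \<nu> * N x)}"

text \<open>K-points of G = [Str(A),Str(A)]: the norm isometries.\<close>
definition Gpts :: "('k::field alb \<Rightarrow> 'k) \<Rightarrow> 'k endo set" where
  "Gpts N = {g. det g \<noteq> 0 \<and> (\<forall>x. N (g *v x) = N x)}"

definition Aut :: "('k::field alb \<Rightarrow> 'k) \<Rightarrow> ('k alb \<Rightarrow> 'k alb) \<Rightarrow> 'k alb \<Rightarrow> 'k endo set" where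
  "Aut N S e = {g. det g \<noteq> 0 \<and> (\<forall>x y. g *v jprod N S e x y = jprod N S e (g *v x) (g *v y))}"

definition GL_fix :: "('k::field alb \<Rightarrow> 'k) \<Rightarrow> 'k alb set \<Rightarrow> 'k endo set" where
  "GL_fix N L = {g \<in> Gpts N. \<forall>l\<in>L. g *v l = l}"

definition normalizer_H ::
  "('k::field alb \<Rightarrow> 'k) \<Rightarrow> ('k alb \<Rightarrow> 'k alb) \<Rightarrow> 'k alb \<Rightarrow> 'k alb set \<Rightarrow> 'k endo set" where
  "normalizer_H N S e L = {h \<in> Aut N S e. (\<lambda>x. h ** x ** matrix_inv h) ` GL_fix N L = GL_fix N L}"

text \<open>Rational curves A^1 --> Str(A) \<subseteq> GL(A): matrices of rational functions P/Q.\<close>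
definition curve_at :: "(27 \<Rightarrow> 27 \<Rightarrow> 'k::field poly) \<Rightarrow> 'k poly \<Rightarrow> 'k \<Rightarrow> 'k endo" where
  "curve_at P Q t = (\<chi> i j. poly (P i j) t / poly Q t)"

definition defined_at :: "(27 \<Rightarrow> 27 \<Rightarrow> 'k::field poly) \<Rightarrow> 'k poly \<Rightarrow> 'k \<Rightarrow> bool" where
  "defined_at P Q t \<longleftrightarrow> poly Q t \<noteq> 0 \<and> det (curve_at P Q t) \<noteq> 0"

definition R_link :: "('k::field alb \<Rightarrow> 'k) \<Rightarrow> 'k endo \<Rightarrow> 'k endo \<Rightarrow> bool" where
  "R_link N x y \<longleftrightarrow> (\<exists>P Q.
     (\<forall>t. defined_at P Q t \<longrightarrow> curve_at P Q t \<in> Str N) \<and>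
     defined_at P Q 0 \<and> defined_at P Q 1 \<and>
     curve_at P Q 0 = x \<and> curve_at P Q 1 = y)"

definition R_equiv_one :: "('k::field alb \<Rightarrow> 'k) \<Rightarrow> 'k endo \<Rightarrow> bool" where
  "R_equiv_one N g \<longleftrightarrow> (R_link N)\<^sup>*\<^sup>* (mat 1) g"

end

theory Submission
  imports "HOL-Algebra.Algebraic_Closure_Type" Defs
begin

text \<open>
  Write V for the orthogonal complement of L with respect to the trace form; it is an L-vector space under
  l . x = - (l \<times> x), and the L-part of - x # is a quadratic form Q on V. It is enough to find an element r which is
  R-equivalent to 1 and agrees with g on L: then g = r h where h is a norm isometry that fixes L pointwise.

  The main supply of R-trivial elements is the following. Let v, w in V be Q-orthogonal with m = Q(w) / Q(v) outside K.
  Then there is a rational curve r_t of similarities with r_0 = 1 which acts on L as multiplication by 1 + m t^2. On V it is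
  (1 + m t^2)^{-1} times the reflection along v + t w, applied to a quadratic polynomial in t with coefficients in V; over an
  algebraic closure, where L becomes a frame of idempotents, divisibility by the factors 1 + m_i t^2 shows that the
  result is a similarity, and the polynomial exists by a dimension count since the norm is anisotropic.

  If g is L-semilinear for the identity, then g(e) is a product of a square and of quotients Q(y) / Q(x), which are
  realised by these curves and by U-operators. If g induces an automorphism of order 3 on L, take x in V with Q(x) nonzero and the
  9-dimensional subalgebra S generated by L and x. It acts on its orthogonal complement Y by a special representation, in which
  x = z + z* where z is semilinear over L. The map s -> z s z* on S is the composition of two
  U-operators and of the end point of a curve r_t for the field K[z x z*] with v, w in Y, so it extends to an R-trivial
  similarity that is semilinear on L.
\<close>

text \<open>The factor 1 + m t^2 is Q(v + t w) / Q(v), so the reflection along v + t w has poles at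
  its zeros. Since L = K[m], the three conjugates of m are distinct, the poles in the three Peirce
  spaces are disjoint, and the conditions cancelling them can be handled one space at a time.

  U-operators of elements of L and end points of curves for L act L-linearly on L, so they never
  produce a nontrivial automorphism of L. The semilinear step rests on a factorisation of operators
  on Y. Put n = N(x), d = z^3 - n/2, h = n/2 + z x z* and p = z^2 + z z* + z*^2. Then d commutes
  with z, z* and S, is skew for the trace form and has a nonzero scalar square; moreover z p = h + d
  and p z* = h - d. With c = h^{-1} this gives z s z* = h (1 + d c) p^{-1} s p^{-1} (1 - d c) h.
  Here h and p lie in S, so the outer factors are U-operators, and s -> (1 + d c) s (1 - d c) is the
  end point at t = 1 of the curve for K[c] with m = - d^2 c^2 and w = c d v.\<close>

section \<open>Cubic norm structures through their polarised adjoint identity\<close>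

text \<open>\<open>X_four\<close> is the full polarisation of x## = N(x) x. Stating all axioms
  multilinearly lets them pass to the algebraic closure by comparison on basis vectors; sharp, norm
  and U-operator are then derived notions.\<close>

locale cubic =
  fixes cr :: "'a::field ^ 'n \<Rightarrow> 'a ^ 'n \<Rightarrow> 'a ^ 'n"  (infixl "\<bowtie>" 75)
    and T :: "'a ^ 'n \<Rightarrow> 'a ^ 'n \<Rightarrow> 'a"
    and e :: "'a ^ 'n"
  assumes two: "(2::'a) \<noteq> 0" and three: "(3::'a) \<noteq> 0"
    and X_add: "(x + y) \<bowtie> z = x \<bowtie> z + y \<bowtie> z"
    and X_scale: "(c *s x) \<bowtie> y = c *s (x \<bowtie> y)"
    and X_commute: "x \<bowtie> y = y \<bowtie> x"
    and T_add: "T (x + y) z = T x z + T y z"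
    and T_scale: "T (c *s x) y = c * T x y"
    and T_commute: "T x y = T y x"
    and T_X: "T (x \<bowtie> y) z = T x (y \<bowtie> z)"
    and X_four: "(w \<bowtie> x) \<bowtie> (y \<bowtie> z) + (w \<bowtie> y) \<bowtie> (x \<bowtie> z) + (w \<bowtie> z) \<bowtie> (x \<bowtie> y)
       = T (x \<bowtie> y) z *s w + T (w \<bowtie> y) z *s x + T (w \<bowtie> x) z *s y + T (w \<bowtie> x) y *s z"
    and X_unit: "e \<bowtie> x = T x e *s e - x"
    and T_unit: "T e e = 3"
begin

lemma X_add_right: "x \<bowtie> (y + z) = x \<bowtie> y + x \<bowtie> z"
  by (metis X_add X_commute)

lemma X_scale_right: "x \<bowtie> (c *s y) = c *s (x \<bowtie> y)"
  by (metis X_scale X_commute)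

lemma T_add_right: "T x (y + z) = T x y + T x z"
  by (metis T_add T_commute)

lemma T_scale_right: "T x (c *s y) = c * T x y"
  by (metis T_scale T_commute)

lemma X_minus: "(- x) \<bowtie> y = - (x \<bowtie> y)"
  using X_scale[of "-1" x y] by simp

lemma X_minus_right: "x \<bowtie> (- y) = - (x \<bowtie> y)"
  by (metis X_minus X_commute)

lemma T_minus: "T (- x) y = - T x y"
  using T_scale[of "-1" x y] by simp

lemma T_minus_right: "T x (- y) = - T x y"
  by (metis T_minus T_commute)

lemma X_diff: "(x - y) \<bowtie> z = x \<bowtie> z - y \<bowtie> z"
  using X_add[of x "- y" z] by (simp add: X_minus)

lemma X_diff_right: "x \<bowtie> (y - z) = x \<bowtie> y - x \<bowtie> z"
  by (metis X_diff X_commute)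

lemma T_diff: "T (x - y) z = T x z - T y z"
  using T_add[of x "- y" z] by (simp add: T_minus)

lemma T_diff_right: "T x (y - z) = T x y - T x z"
  by (metis T_diff T_commute)

lemma X_zero [simp]: "0 \<bowtie> x = 0" "x \<bowtie> 0 = 0"
  using X_diff[of 0 0 x] X_diff_right[of x 0 0] by simp_all

lemma T_zero [simp]: "T 0 x = 0" "T x 0 = 0"
  using T_diff[of 0 0 x] T_diff_right[of x 0 0] by simp_all

lemmas bilin = X_add X_add_right X_scale X_scale_right X_minus X_minus_right X_diff X_diff_right
  T_add T_add_right T_scale T_scale_right T_minus T_minus_right T_diff T_diff_right

lemma X_sum: "(\<Sum>i\<in>A. f i) \<bowtie> y = (\<Sum>i\<in>A. f i \<bowtie> y)"
  by (induction A rule: infinite_finite_induct) (simp_all add: X_add)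

lemma X_sum_right: "x \<bowtie> (\<Sum>i\<in>A. f i) = (\<Sum>i\<in>A. x \<bowtie> f i)"
  by (induction A rule: infinite_finite_induct) (simp_all add: X_add_right)

lemma T_sum: "T (\<Sum>i\<in>A. f i) y = (\<Sum>i\<in>A. T (f i) y)"
  by (induction A rule: infinite_finite_induct) (simp_all add: T_add)

lemma T_sum_right: "T x (\<Sum>i\<in>A. f i) = (\<Sum>i\<in>A. T x (f i))"
  by (induction A rule: infinite_finite_induct) (simp_all add: T_add_right)

lemma T_X_left: "T x (y \<bowtie> z) = T y (x \<bowtie> z)"
  by (metis T_X X_commute)

lemma T_X_swap: "T (x \<bowtie> y) z = T (x \<bowtie> z) y"
  by (metis T_X T_commute X_commute)

definition sh :: "'a ^ 'n \<Rightarrow> 'a ^ 'n" where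
  "sh x = inverse 2 *s (x \<bowtie> x)"

definition Nm :: "'a ^ 'n \<Rightarrow> 'a" where
  "Nm x = T x (sh x) / 3"

definition U :: "'a ^ 'n \<Rightarrow> 'a ^ 'n \<Rightarrow> 'a ^ 'n" where
  "U x y = T x y *s x - sh x \<bowtie> y"

definition jp :: "'a ^ 'n \<Rightarrow> 'a ^ 'n \<Rightarrow> 'a ^ 'n" where
  "jp x y = inverse 2 *s (x \<bowtie> y + T x e *s y + T y e *s x - T (x \<bowtie> y) e *s e)"

lemma vecI: "(\<And>i. x $ i = y $ i) \<Longrightarrow> x = (y :: 'a ^ 'n)"
  by (simp add: vec_eq_iff)

lemma scale_cancel: "c \<noteq> 0 \<Longrightarrow> c *s x = c *s y \<Longrightarrow> x = (y :: 'a ^ 'n)"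
  by (simp add: vec_eq_iff)

lemma mult_cancel: "c \<noteq> 0 \<Longrightarrow> c * x = c * y \<Longrightarrow> x = (y :: 'a)"
  by simp

lemma four: "(4::'a) \<noteq> 0"
proof -
  have "(4::'a) = 2 * 2" by simp
  then show ?thesis using two by (metis mult_eq_0_iff)
qed

lemma six: "(6::'a) \<noteq> 0"
proof -
  have "(6::'a) = 2 * 3" by simp
  then show ?thesis using two three by (metis mult_eq_0_iff)
qed

lemma X_self: "x \<bowtie> x = 2 *s sh x"
  using two by (simp add: sh_def)

lemma T_sh_self: "T x (sh x) = 3 * Nm x" "T (sh x) x = 3 * Nm x"
  using three by (simp_all add: Nm_def T_commute[of "sh x"])

lemma T_X_self: "T (x \<bowtie> x) y = 2 * T (sh x) y" "T (x \<bowtie> y) x = 2 * T (sh x) y"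
  "T (y \<bowtie> x) x = 2 * T (sh x) y" "T x (x \<bowtie> y) = 2 * T (sh x) y" "T x (y \<bowtie> x) = 2 * T (sh x) y"
proof -
  show 1: "T (x \<bowtie> x) y = 2 * T (sh x) y" for x y by (simp add: X_self T_scale)
  show 2: "T (x \<bowtie> y) x = 2 * T (sh x) y" for x y using 1[of x y] by (metis T_X_swap)
  show "T (y \<bowtie> x) x = 2 * T (sh x) y" using 2 by (metis X_commute)
  show "T x (x \<bowtie> y) = 2 * T (sh x) y" using 2 by (metis T_commute)
  show "T x (y \<bowtie> x) = 2 * T (sh x) y" using 2 by (metis T_commute X_commute)
qed

lemma sh_scale: "sh (c *s x) = c^2 *s sh x"
  by (simp add: sh_def bilin power2_eq_square ac_simps)

lemma sh_minus: "sh (- x) = sh x"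
  by (simp add: sh_def bilin)

lemma sh_zero [simp]: "sh 0 = 0"
  by (simp add: sh_def)

lemma sh_add: "sh (x + y) = sh x + x \<bowtie> y + sh y"
proof -
  have "2 *s sh (x + y) = 2 *s (sh x + x \<bowtie> y + sh y)"
    by (simp add: X_self[symmetric] bilin X_commute[of y x] vector_add_ldistrib
        vec_eq_iff algebra_simps)
  then show ?thesis by (rule scale_cancel[OF two])
qed

lemma sh_unit [simp]: "sh e = e"
proof -
  have "e \<bowtie> e = 2 *s e" using X_unit[of e] T_unit by (simp add: vec_eq_iff algebra_simps)
  then show ?thesis using two by (simp add: sh_def)
qed

lemma Nm_unit [simp]: "Nm e = 1"
  using three by (simp add: Nm_def T_unit)

lemma Nm_zero [simp]: "Nm 0 = 0"
  by (simp add: Nm_def)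

lemma unit_nonzero: "e \<noteq> 0"
  using T_unit three by auto

text \<open>\<open>X_four\<close> with four equal arguments: three terms 8 x## on the left against
  four terms 6 N(x) x on the right, hence the factor 24.\<close>

lemma sh_sh: "sh (sh x) = Nm x *s x"
proof (rule scale_cancel)
  have "(24::'a) = 4 * 6" by simp
  then show "(24::'a) \<noteq> 0" using four six by (metis mult_eq_0_iff)
  have "(24 *s sh (sh x)) $ i = (24 *s (Nm x *s x)) $ i" for i
    using X_four[of x x x x]
    by (auto simp: X_self bilin T_sh_self vec_eq_iff sh_scale algebra_simps)
  then show "24 *s sh (sh x) = 24 *s (Nm x *s x)" by (rule vecI)
qed

lemma sh_X_sh: "sh x \<bowtie> (x \<bowtie> y) = Nm x *s y + T (sh x) y *s x"
proof (rule scale_cancel)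
  show "(6 :: 'a) \<noteq> 0" by (rule six)
  have "(6 *s (sh x \<bowtie> (x \<bowtie> y))) $ i = (6 *s (Nm x *s y + T (sh x) y *s x)) $ i" for i
    using X_four[of x x x y]
    by (simp add: X_self bilin T_sh_self T_X_self X_commute[of "x \<bowtie> y"] vec_eq_iff algebra_simps)
  then show "6 *s (sh x \<bowtie> (x \<bowtie> y)) = 6 *s (Nm x *s y + T (sh x) y *s x)"
    by (rule vecI)
qed

lemma X_X_same: "(x \<bowtie> y) \<bowtie> (x \<bowtie> z) + sh x \<bowtie> (y \<bowtie> z)
    = T (sh x) y *s z + T (sh x) z *s y + T (x \<bowtie> y) z *s x"
proof (rule scale_cancel[OF two])
  have "(2 *s ((x \<bowtie> y) \<bowtie> (x \<bowtie> z) + sh x \<bowtie> (y \<bowtie> z))) $ i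
    = (2 *s (T (sh x) y *s z + T (sh x) z *s y + T (x \<bowtie> y) z *s x)) $ i" for i
    using X_four[of x x y z]
    by (simp add: X_self bilin T_sh_self T_X_self X_commute[of "x \<bowtie> z"] vec_eq_iff algebra_simps)
  then show "2 *s ((x \<bowtie> y) \<bowtie> (x \<bowtie> z) + sh x \<bowtie> (y \<bowtie> z))
    = 2 *s (T (sh x) y *s z + T (sh x) z *s y + T (x \<bowtie> y) z *s x)"
    by (rule vecI)
qed

lemma sh_X: "sh (x \<bowtie> y) = T (sh x) y *s y + T x (sh y) *s x - sh x \<bowtie> sh y"
proof (rule scale_cancel[OF four])
  have "(4 *s sh (x \<bowtie> y)) $ i = (4 *s (T (sh x) y *s y + T x (sh y) *s x - sh x \<bowtie> sh y)) $ i" for i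
    using X_four[of x x y y]
    by (simp add: X_self bilin T_sh_self T_X_self T_commute[of "sh y"] X_commute[of y x]
        vec_eq_iff algebra_simps)
  then show "4 *s sh (x \<bowtie> y) = 4 *s (T (sh x) y *s y + T x (sh y) *s x - sh x \<bowtie> sh y)"
    by (rule vecI)
qed

lemma Nm_scale: "Nm (c *s x) = c^3 * Nm x"
  by (simp add: Nm_def sh_scale bilin power2_eq_square power3_eq_cube)

lemma Nm_add: "Nm (x + y) = Nm x + T (sh x) y + T x (sh y) + Nm y"
proof -
  have "3 * Nm (x + y) = 3 * (Nm x + T (sh x) y + T x (sh y) + Nm y)"
    by (simp add: T_sh_self[symmetric] sh_add bilin T_X_self T_commute[of y "sh x"]
        T_commute[of "sh y" x] algebra_simps)
  then show ?thesis by (rule mult_cancel[OF three])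
qed

lemma Nm_X: "Nm (x \<bowtie> y) = T (sh x) y * T x (sh y) - Nm x * Nm y"
proof -
  have 1: "T (sh x \<bowtie> sh y) (x \<bowtie> y) = 3 * (Nm x * Nm y) + T (sh x) y * T x (sh y)"
  proof -
    have "T (sh x \<bowtie> sh y) (x \<bowtie> y) = T (sh y) (sh x \<bowtie> (x \<bowtie> y))"
      by (metis T_X X_commute)
    also have "\<dots> = 3 * (Nm x * Nm y) + T (sh x) y * T x (sh y)"
      by (simp add: sh_X_sh bilin T_sh_self T_commute[of "sh y" x])
    finally show ?thesis .
  qed
  have "3 * Nm (x \<bowtie> y) = 3 * (T (sh x) y * T x (sh y) - Nm x * Nm y)"
    by (simp add: T_sh_self(2)[symmetric] sh_X bilin 1 T_X_self T_commute[of "sh y" x] algebra_simps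
        T_X_self(4)[of y x, unfolded X_commute[of y x]])
  then show ?thesis by (rule mult_cancel[OF three])
qed

lemma T_sh_sh: "T (sh (sh x)) y = Nm x * T x y"
  by (simp add: sh_sh bilin)

lemma Nm_sh: "Nm (sh x) = Nm x ^ 2"
proof -
  have "3 * Nm (sh x) = 3 * (Nm x)^2"
    by (simp add: T_sh_self(2)[symmetric] T_sh_sh power2_eq_square) (simp add: T_sh_self)
  then show ?thesis by (rule mult_cancel[OF three])
qed

text \<open>Expand the norm of T(x,y) x - x# \<bowtie> y; the term N(x# \<bowtie> y) comes from
  \<open>Nm_X\<close>, with x## = N(x) x and N(x#) = N(x)^2. This is what makes U-operators
  similarities.\<close>

lemma Nm_U: "Nm (U x y) = Nm x ^ 2 * Nm y"
proof -
  let ?s = "sh x \<bowtie> y"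
  have 1: "Nm (U x y) = Nm (T x y *s x) + T (sh (T x y *s x)) (- ?s)
     + T (T x y *s x) (sh (- ?s)) + Nm (- ?s)"
    using Nm_add[of "T x y *s x" "- ?s"] by (simp add: U_def)
  have m: "Nm (- ?s) = - Nm ?s" using Nm_scale[of "-1" ?s] by simp
  have 2: "T (sh x) ?s = 2 * (Nm x * T x y)"
    by (simp add: T_X_self T_sh_sh)
  have 3: "T x (sh ?s) = Nm x * (T x y)^2 + Nm x * T (sh x) (sh y)"
    by (simp add: sh_X sh_sh bilin T_sh_self T_X_self power2_eq_square algebra_simps)
  have 4: "Nm ?s = Nm x * T x y * T (sh x) (sh y) - Nm x ^ 2 * Nm y"
    by (simp add: Nm_X T_sh_sh Nm_sh)
  show ?thesis
    by (simp add: 1 m Nm_scale sh_scale sh_minus bilin 2 3 4 power2_eq_square power3_eq_cube algebra_simps)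
qed

lemma T_X_unit: "T (x \<bowtie> y) e = T x e * T y e - T x y"
proof -
  have "T (x \<bowtie> y) e = T x (e \<bowtie> y)" by (metis T_X X_commute)
  then show ?thesis by (simp add: X_unit bilin)
qed

lemma X_unit_right: "x \<bowtie> e = T x e *s e - x"
  by (metis X_unit X_commute)

text \<open>\<open>X_X_same\<close> at x, e, x. A form of Cayley-Hamilton: together with
  \<open>X_unit\<close> and \<open>sh_sh\<close> it closes the span of e, x, x# under the cross
  product.\<close>

lemma X_sh_self: "x \<bowtie> sh x = (T x e * T (sh x) e - Nm x) *s e - T x e *s sh x - T (sh x) e *s x"
proof (rule scale_cancel[OF three])
  have t: "T (x \<bowtie> e) x = 2 * T (sh x) e" by (simp add: T_X_self)
  have "(3 *s (x \<bowtie> sh x)) $ i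
    = (3 *s ((T x e * T (sh x) e - Nm x) *s e - T x e *s sh x - T (sh x) e *s x)) $ i" for i
    using X_X_same[of x e x] 
    by (simp add: t, simp add: X_self X_unit X_unit_right bilin T_sh_self X_commute[of "sh x" x]
        vec_eq_iff algebra_simps)
  then show "3 *s (x \<bowtie> sh x)
    = 3 *s ((T x e * T (sh x) e - Nm x) *s e - T x e *s sh x - T (sh x) e *s x)"
    by (rule vecI)
qed

end

section \<open>Frames of idempotents and their Peirce spaces\<close>

context cubic
begin

text \<open>Three orthogonal rank one idempotents with sum e, expressed by cross products. The
  relations are cyclic, so a statement about a serves for b and c after
  \<open>frm_rotate\<close>.\<close>

definition frm :: "'a ^ 'n \<Rightarrow> 'a ^ 'n \<Rightarrow> 'a ^ 'n \<Rightarrow> bool" where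
  "frm a b c \<longleftrightarrow> a \<bowtie> a = 0 \<and> b \<bowtie> b = 0 \<and> c \<bowtie> c = 0 \<and> a \<bowtie> b = c \<and> b \<bowtie> c = a \<and> c \<bowtie> a = b
     \<and> T a a = 1 \<and> T b b = 1 \<and> T c c = 1 \<and> T a b = 0 \<and> T b c = 0 \<and> T c a = 0 \<and> a + b + c = e"

lemma frm_rotate: "frm a b c \<Longrightarrow> frm b c a"
  by (auto simp: frm_def algebra_simps)

lemma frm_swap: "frm a b c \<Longrightarrow> frm b a c"
  using T_commute X_commute by (auto simp: frm_def algebra_simps)

lemma frm_flip: "frm a b c \<Longrightarrow> frm a c b"
  using frm_swap frm_rotate by blast

lemma frmD:
  assumes "frm a b c"
  shows "a \<bowtie> a = 0" "b \<bowtie> b = 0" "c \<bowtie> c = 0" "a \<bowtie> b = c" "b \<bowtie> c = a" "c \<bowtie> a = b"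
    "b \<bowtie> a = c" "c \<bowtie> b = a" "a \<bowtie> c = b" "T a a = 1" "T b b = 1" "T c c = 1"
    "T a b = 0" "T b c = 0" "T c a = 0" "T b a = 0" "T c b = 0" "T a c = 0"
  using assms T_commute X_commute unfolding frm_def by metis+

lemma frm_sum: "frm a b c \<Longrightarrow> e = a + b + c"
  by (simp add: frm_def)

text \<open>The off-diagonal Peirce space opposite to a: for the diagonal frame of hermitian 3 by 3
  matrices, the entries joining b and c.\<close>

definition peirce :: "'a ^ 'n \<Rightarrow> 'a ^ 'n \<Rightarrow> 'a ^ 'n \<Rightarrow> 'a ^ 'n \<Rightarrow> bool" where
  "peirce a b c x \<longleftrightarrow> T x a = 0 \<and> T x b = 0 \<and> T x c = 0 \<and> a \<bowtie> x = - x \<and> b \<bowtie> x = 0 \<and> c \<bowtie> x = 0"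

lemma peirce_swap: "peirce a b c x \<Longrightarrow> peirce a c b x"
  by (simp add: peirce_def)

lemma peirce_zero: "peirce a b c 0"
  by (simp add: peirce_def)

lemma peirce_add: "peirce a b c x \<Longrightarrow> peirce a b c y \<Longrightarrow> peirce a b c (x + y)"
  by (simp add: peirce_def bilin)

lemma peirce_scale: "peirce a b c x \<Longrightarrow> peirce a b c (k *s x)"
  by (simp add: peirce_def bilin)

lemma peirce_minus: "peirce a b c x \<Longrightarrow> peirce a b c (- x)"
  by (simp add: peirce_def bilin)

lemma peirce_diff: "peirce a b c x \<Longrightarrow> peirce a b c y \<Longrightarrow> peirce a b c (x - y)"
  by (simp add: peirce_def bilin)

lemmas peirce_intros = peirce_zero peirce_add peirce_scale peirce_minus peirce_diff

text \<open>On a Peirce space this is the quadratic form with x# = - nrm x a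
  (\<open>sh_peirce\<close>). The form Q on V has these as its components over the closure.\<close>

definition nrm :: "'a ^ 'n \<Rightarrow> 'a" where
  "nrm x = T x x / 2"

lemma nrm_scale: "nrm (k *s x) = k^2 * nrm x"
  by (simp add: nrm_def bilin power2_eq_square)

lemma T_self_nrm: "T x x = 2 * nrm x"
  using two by (simp add: nrm_def)

lemma sh_peirce_unit: assumes "frm a b c" shows "sh a = 0"
  using assms by (simp add: frmD sh_def)

lemma X_peirce_same:
  assumes "frm a b c" "peirce a b c x" "peirce a b c y"
  shows "x \<bowtie> y = - (T x y *s a)"
  using X_X_same[of a x y] assms by (simp add: sh_peirce_unit[OF assms(1)] peirce_def bilin)

lemma sh_peirce: 
  assumes "frm a b c" "peirce a b c x" shows "sh x = - (nrm x *s a)"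
proof (rule scale_cancel[OF two])
  show "2 *s sh x = 2 *s (- (nrm x *s a))"
    using X_peirce_same[OF assms assms(2)] by (simp add: X_self T_self_nrm)
qed

lemma T_peirce:
  assumes "frm a b c" "peirce a b c x" "peirce b c a y"
  shows "T x y = 0"
proof -
  have "b \<bowtie> (b \<bowtie> y) = y" using assms by (simp add: peirce_def bilin)
  then have "T x y = T (b \<bowtie> x) (b \<bowtie> y)" by (metis T_X X_commute)
  then show ?thesis using assms by (simp add: peirce_def)
qed

text \<open>Each eigenvalue of a, b, c on the product comes from \<open>X_four\<close> with two
  members of the frame as the other two arguments.\<close>

lemma peirce_X:
  assumes f: "frm a b c" and x: "peirce a b c x" and y: "peirce b c a y"
  shows "peirce c a b (x \<bowtie> y)"
proof -
  note fd = frmD[OF f]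
  have t: "T x y = 0" by (rule T_peirce[OF assms])
  have tz: "T (x \<bowtie> y) a = 0" "T (x \<bowtie> y) b = 0" "T (x \<bowtie> y) c = 0"
    using x y t by (simp_all add: T_X X_commute[of y] peirce_def bilin)
  have c: "c \<bowtie> (x \<bowtie> y) = - (x \<bowtie> y)"
    using X_four[of a b x y] x y t
    by (simp add: peirce_def fd bilin T_X T_commute[of c] T_commute[of b] T_commute[of a] X_commute[of y])
      (simp add: eq_neg_iff_add_eq_0)
  have z1: "a \<bowtie> (x \<bowtie> y) = 0"
    using X_four[of b c x y] x y t by (simp add: peirce_def fd bilin T_X T_commute[of c] T_commute[of b] T_commute[of a] X_commute[of y])
  have z2: "b \<bowtie> (x \<bowtie> y) = 0"
    using X_four[of c a x y] x y t by (simp add: peirce_def fd bilin T_X T_commute[of c] T_commute[of b] T_commute[of a] X_commute[of y])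
  show ?thesis using tz c z1 z2 by (simp add: peirce_def)
qed

text \<open>The Clifford relation of the Peirce spaces. It yields the composition law
  \<open>nrm_X\<close> and, polarised, the anticommutation rules
  \<open>X_X_peirce_lin\<close>.\<close>

lemma X_X_peirce:
  assumes f: "frm a b c" and x: "peirce a b c x" and y: "peirce b c a y"
  shows "x \<bowtie> (x \<bowtie> y) = nrm x *s y"
proof -
  have "T (x \<bowtie> a) y = 0" using x T_peirce[OF assms] by (simp add: X_commute[of x] peirce_def bilin)
  then show ?thesis
  using X_X_same[of x a y] x y
  by (simp add: sh_peirce[OF f x] X_commute[of x a] peirce_def bilin frmD[OF f] T_commute[of a y])
qed

lemma X_X_peirce_lin:
  assumes f: "frm a b c" and x: "peirce a b c x" and x': "peirce a b c x'" and y: "peirce b c a y"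
  shows "x \<bowtie> (x' \<bowtie> y) + x' \<bowtie> (x \<bowtie> y) = T x x' *s y"
proof -
  have "nrm (x + x') = nrm x + nrm x' + T x x'"
    using two by (simp add: nrm_def bilin T_commute[of x' x] add_divide_distrib)
  then show ?thesis
    using X_X_peirce[OF f peirce_add[OF x x'] y] X_X_peirce[OF f x y] X_X_peirce[OF f x' y]
    by (simp add: bilin vec_eq_iff algebra_simps)
qed

lemma X_X_peirce_lin':
  assumes f: "frm a b c" and x: "peirce a b c x" and x': "peirce a b c x'" and y: "peirce c a b y"
  shows "x \<bowtie> (x' \<bowtie> y) + x' \<bowtie> (x \<bowtie> y) = T x x' *s y"
  using X_X_peirce_lin[OF frm_flip[OF f] peirce_swap[OF x] peirce_swap[OF x'] peirce_swap[OF y]]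
  by simp

lemma nrm_X:
  assumes f: "frm a b c" and x: "peirce a b c x" and y: "peirce b c a y"
  shows "nrm (x \<bowtie> y) = nrm x * nrm y"
proof -
  have "T (x \<bowtie> y) (x \<bowtie> y) = T y (x \<bowtie> (x \<bowtie> y))" by (metis T_X X_commute)
  then have "T (x \<bowtie> y) (x \<bowtie> y) = nrm x * T y y" by (simp add: X_X_peirce[OF assms] bilin)
  then show ?thesis by (simp add: nrm_def[of "x \<bowtie> y"] nrm_def[of y])
qed

text \<open>A form of triality: the right side is - nrm u times the reflection of x \<bowtie> y
  along u. A reflection in one Peirce space is absorbed by multiplications with u in the other two,
  which is why reflections can be parts of similarities.\<close>

lemma X_X_X_peirce:
  assumes f: "frm a b c" and u: "peirce a b c u" and x: "peirce b c a x" and y: "peirce c a b y"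
  shows "(u \<bowtie> x) \<bowtie> (u \<bowtie> y) = T (u \<bowtie> x) y *s u - nrm u *s (x \<bowtie> y)"
proof -
  have xy: "peirce a b c (x \<bowtie> y)" by (rule peirce_X[OF frm_rotate[OF f] x y])
  then have 1: "sh u \<bowtie> (x \<bowtie> y) = nrm u *s (x \<bowtie> y)"
    by (simp add: sh_peirce[OF f u] bilin peirce_def)
  have 2: "T (sh u) x = 0" "T (sh u) y = 0"
    using x y by (simp_all add: sh_peirce[OF f u] bilin peirce_def T_commute[of a x] T_commute[of a y])
  show ?thesis using X_X_same[of u x y] unfolding 1 2 by (simp add: eq_diff_eq)
qed

text \<open>The maps x -> - (a \<bowtie> x), and likewise for b and c, are the Peirce projections on
  the orthogonal complement of the frame.\<close>

lemma act_unit: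
  assumes f: "frm a b c" and "T x a = 0" "T x b = 0" "T x c = 0"
  shows "peirce a b c (- (a \<bowtie> x))" and "x = - (a \<bowtie> x) - (b \<bowtie> x) - (c \<bowtie> x)"
proof -
  note fd = frmD[OF f] have e: "e = a + b + c" by (rule frm_sum[OF f])
  have xe: "T x e = 0" using assms by (simp add: e bilin)
  have ex: "e \<bowtie> x = - x" using X_unit[of x] xe by simp
  have "a \<bowtie> x + b \<bowtie> x + c \<bowtie> x = - x" using ex by (simp add: e bilin)
  then have "x = - (a \<bowtie> x + b \<bowtie> x + c \<bowtie> x)" by simp
  then show "x = - (a \<bowtie> x) - (b \<bowtie> x) - (c \<bowtie> x)" by (simp only: minus_add_distrib diff_conv_add_uminus)
  \<comment> \<open>Write A and B for multiplication by a and b. Then A A = - A and A B + B A = 0.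
    Applying A to the second relation, and the second relation to A x, gives A B = B A; hence 2 A B
    = 0.\<close>
  have key: "a \<bowtie> (a \<bowtie> x) = - (a \<bowtie> x) \<and> a \<bowtie> (b \<bowtie> x) = 0 \<and> b \<bowtie> (a \<bowtie> x) = 0"
    if f: "frm a b c" and x: "T x a = 0" "T x b = 0" "T x c = 0" for a b c x
  proof -
    note fd = frmD[OF f] have e: "e = a + b + c" by (rule frm_sum[OF f])
    have ae: "a \<bowtie> e = e - a" "b \<bowtie> e = e - b" 
      by (simp_all add: e bilin fd)
    have te: "T z e = 0" if "T z a = 0" "T z b = 0" "T z c = 0" for z
      using that by (simp add: e bilin)
    have ez: "e \<bowtie> z = - z" if "T z a = 0" "T z b = 0" "T z c = 0" for z
      using X_unit[of z] te[OF that] by simp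
    have ort: "T (a \<bowtie> z) a = 0" "T (a \<bowtie> z) b = 0" "T (a \<bowtie> z) c = 0"
        "T (b \<bowtie> z) a = 0" "T (b \<bowtie> z) b = 0" "T (b \<bowtie> z) c = 0"
      if "T z a = 0" "T z b = 0" "T z c = 0" for z
      using that by (simp_all add: X_commute[of _ z] T_X fd)
    have aa: "a \<bowtie> (a \<bowtie> z) = - (a \<bowtie> z)" if z: "T z a = 0" "T z b = 0" "T z c = 0" for z
      using X_X_same[of a e z] z te[OF z]
      by (simp add: sh_peirce_unit[OF f] ae bilin ez ort T_commute[of a z] T_commute[of e z] te algebra_simps)
    have ab: "a \<bowtie> (b \<bowtie> z) + b \<bowtie> (a \<bowtie> z) = 0" if z: "T z a = 0" "T z b = 0" "T z c = 0" for z
    proof -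
      have 1: "(a \<bowtie> b) \<bowtie> (e \<bowtie> z) = - (c \<bowtie> z)" using ez[OF z] by (simp add: fd bilin)
      have 2: "(a \<bowtie> e) \<bowtie> (b \<bowtie> z) = - (b \<bowtie> z) - a \<bowtie> (b \<bowtie> z)"
        by (simp add: ae bilin ez ort[OF z])
      have 3: "(a \<bowtie> z) \<bowtie> (b \<bowtie> e) = - (a \<bowtie> z) - b \<bowtie> (a \<bowtie> z)"
        by (simp add: ae bilin X_commute[of "a \<bowtie> z"] ez ort[OF z])
      have 4: "T (b \<bowtie> e) z = 0" "T (a \<bowtie> e) z = 0" "T (a \<bowtie> b) z = 0" "T (a \<bowtie> b) e = 1"
        using z te[OF z] by (simp_all add: ae bilin T_commute[of _ z] fd) (simp add: e bilin fd)
      have sum: "a \<bowtie> z + b \<bowtie> z + c \<bowtie> z = - z" using ez[OF z] by (simp add: e bilin)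
      have eq: "- (c \<bowtie> z) + (- (b \<bowtie> z) - a \<bowtie> (b \<bowtie> z)) + (- (a \<bowtie> z) - b \<bowtie> (a \<bowtie> z)) = z"
        using X_four[of a b e z] unfolding 1 2 3 4 by simp
      have "- (c \<bowtie> z) + (- (b \<bowtie> z) - a \<bowtie> (b \<bowtie> z)) + (- (a \<bowtie> z) - b \<bowtie> (a \<bowtie> z))
          = - (a \<bowtie> z + b \<bowtie> z + c \<bowtie> z) - (a \<bowtie> (b \<bowtie> z) + b \<bowtie> (a \<bowtie> z))" by simp
      then have "z = z - (a \<bowtie> (b \<bowtie> z) + b \<bowtie> (a \<bowtie> z))" unfolding eq sum by simp
      then show ?thesis by (metis add_diff_cancel_left' diff_add_cancel eq_iff_diff_eq_0 diff_zero)
    qed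
    have 1: "a \<bowtie> (b \<bowtie> x) + b \<bowtie> (a \<bowtie> x) = 0" by (rule ab[OF x])
    have 2: "a \<bowtie> (a \<bowtie> (b \<bowtie> x)) = - (a \<bowtie> (b \<bowtie> x))" by (rule aa[OF ort(4-6)[OF x]])
    have 3: "a \<bowtie> (b \<bowtie> (a \<bowtie> x)) + b \<bowtie> (a \<bowtie> (a \<bowtie> x)) = 0" by (rule ab[OF ort(1-3)[OF x]])
    have 4: "a \<bowtie> (b \<bowtie> (a \<bowtie> x)) = b \<bowtie> (a \<bowtie> x)" using 3 by (simp add: aa[OF x] bilin)
    have "a \<bowtie> (a \<bowtie> (b \<bowtie> x)) + a \<bowtie> (b \<bowtie> (a \<bowtie> x)) = 0"
      using 1 by (metis X_add_right X_zero(2))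
    then have 5: "b \<bowtie> (a \<bowtie> x) = a \<bowtie> (b \<bowtie> x)" unfolding 2 4 by simp
    have "2 *s (a \<bowtie> (b \<bowtie> x)) = 0" using 1 unfolding 5 by (simp add: vec_eq_iff)
    then have "a \<bowtie> (b \<bowtie> x) = 0" using two by simp
    then show ?thesis using 5 aa[OF x] by simp
  qed
  have k1: "b \<bowtie> (a \<bowtie> x) = 0" using key[OF f] assms by blast
  have k2: "c \<bowtie> (a \<bowtie> x) = 0" using key[of a c b x] frm_flip[OF f] assms by blast
  show "peirce a b c (- (a \<bowtie> x))"
    using key[OF f assms(2-4)] assms k1 k2 fd
    by (simp add: peirce_def bilin X_commute[of a x] T_X)
qed

text \<open>The determinant formula for a hermitian 3 by 3 matrix. A map respecting the Peirce
  decomposition is therefore a similarity as soon as the three quadratic forms and the one trilinear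
  form scale correctly.\<close>

lemma Nm_frame:
  assumes f: "frm a b c" and x: "peirce a b c x" and y: "peirce b c a y" and z: "peirce c a b z"
  shows "Nm (k *s a + l *s b + m *s c + (x + y + z))
    = k * l * m - k * nrm x - l * nrm y - m * nrm z + T x (y \<bowtie> z)"
proof -
  have fb: "frm b c a" and fc: "frm c a b" using frm_rotate f by blast+
  let ?l = "k *s a + l *s b + m *s c"
  note fd = frmD[OF f]
  have shl: "sh ?l = (l*m) *s a + (m*k) *s b + (k*l) *s c"
    by (simp add: sh_add bilin sh_scale sh_peirce_unit[OF f] sh_peirce_unit[OF fb] sh_peirce_unit[OF fc] fd ac_simps)
  have nl: "Nm ?l = k * l * m"
  proof -
    have "3 * Nm ?l = 3 * (k * l * m)"
      unfolding T_sh_self(1)[symmetric] shl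
      by (simp add: bilin fd algebra_simps)
    then show ?thesis by (rule mult_cancel[OF three])
  qed
  have shv: "sh (x + y + z) = - (nrm x *s a) - nrm y *s b - nrm z *s c + (x \<bowtie> y + x \<bowtie> z + y \<bowtie> z)"
    by (simp add: sh_add bilin sh_peirce[OF f x] sh_peirce[OF fb y] sh_peirce[OF fc z])
  have t0: "T ?l (x \<bowtie> y) = 0" "T ?l (x \<bowtie> z) = 0" "T ?l (y \<bowtie> z) = 0"
    using peirce_X[OF f x y] peirce_X[OF fc z x] peirce_X[OF fb y z]
    by (simp_all add: bilin T_commute[of a] T_commute[of b] T_commute[of c] X_commute[of x z] peirce_def)
  have lv: "T ?l (sh (x + y + z)) = - k * nrm x - l * nrm y - m * nrm z"
    unfolding shv
    by (simp only: T_add_right t0) (simp add: bilin fd algebra_simps)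
  have vl: "T (sh ?l) (x + y + z) = 0" unfolding shl using x y z
    by (simp add: bilin peirce_def T_commute[of a] T_commute[of b] T_commute[of c])
  have nv: "Nm (x + y + z) = T x (y \<bowtie> z)"
  proof -
    have p: "peirce c a b (x \<bowtie> y)" "peirce b c a (z \<bowtie> x)" "peirce a b c (y \<bowtie> z)"
      using peirce_X[OF f x y] peirce_X[OF fc z x] peirce_X[OF fb y z] by auto
    have t: "T x (x \<bowtie> y) = 0" "T x (z \<bowtie> x) = 0" "T y (x \<bowtie> y) = 0" "T y (y \<bowtie> z) = 0"
       "T z (z \<bowtie> x) = 0" "T z (y \<bowtie> z) = 0"
      using T_peirce[OF f x p(2)] T_peirce[OF fc p(1) x] T_peirce[OF fb y p(1)] T_peirce[OF f p(3) y]
       T_peirce[OF fb p(2) z] T_peirce[OF fc z p(3)] T_commute by metis+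
    have s: "T y (z \<bowtie> x) = T x (y \<bowtie> z)" "T z (x \<bowtie> y) = T x (y \<bowtie> z)"
      by (metis T_X_left X_commute)+
    have "3 * Nm (x + y + z) = 3 * T x (y \<bowtie> z)"
      unfolding T_sh_self(1)[symmetric] shv using x y z t
      by (simp add: bilin peirce_def X_commute[of x z] s)
    then show ?thesis by (rule mult_cancel[OF three])
  qed
  show ?thesis unfolding Nm_add[of ?l] nl vl lv nv by simp
qed

end

section \<open>Polynomial functions with degree bounds\<close>

text \<open>The bound on the degree is part of the notion because the decisive arguments compare it
  with the degree of a known divisor.\<close>

definition polyf :: "nat \<Rightarrow> ('a::field \<Rightarrow> 'a) \<Rightarrow> bool" where
  "polyf d F \<longleftrightarrow> (\<exists>p. degree p \<le> d \<and> (\<forall>t. F t = poly p t))"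

definition polyv :: "nat \<Rightarrow> ('a::field \<Rightarrow> 'a ^ 'n) \<Rightarrow> bool" where
  "polyv d F \<longleftrightarrow> (\<forall>i. polyf d (\<lambda>t. F t $ i))"

lemma polyf_const: "polyf d (\<lambda>t. c)"
  unfolding polyf_def by (rule exI[of _ "[:c:]"]) simp

lemma polyf_add: "polyf d F \<Longrightarrow> polyf d G \<Longrightarrow> polyf d (\<lambda>t. F t + G t)"
  unfolding polyf_def using degree_add_le poly_add by metis

lemma polyf_mult: "polyf d F \<Longrightarrow> polyf d' G \<Longrightarrow> polyf (d + d') (\<lambda>t. F t * G t)"
  unfolding polyf_def by (metis poly_mult degree_mult_le add_mono order_trans)

lemma polyf_minus: "polyf d F \<Longrightarrow> polyf d (\<lambda>t. - F t)"
  unfolding polyf_def by (metis poly_minus degree_minus)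

lemma polyf_mono: "polyf d F \<Longrightarrow> d \<le> d' \<Longrightarrow> polyf d' F"
  unfolding polyf_def by (meson order_trans)

lemma polyf_cmult: "polyf d F \<Longrightarrow> polyf d (\<lambda>t. c * F t)"
  using polyf_mult[OF polyf_const[of 0 c]] by simp

lemma polyf_mult_const: "polyf d F \<Longrightarrow> polyf d (\<lambda>t. F t * c)"
  using polyf_cmult[of d F c] by (simp add: mult.commute)

lemma polyf_sum: "(\<And>i. i \<in> A \<Longrightarrow> polyf d (F i)) \<Longrightarrow> polyf d (\<lambda>t. \<Sum>i\<in>A. F i t)"
  by (induction A rule: infinite_finite_induct) (auto intro: polyf_const polyf_add)

lemma polyf_power: "polyf d (\<lambda>t. t ^ d)"
  unfolding polyf_def by (rule exI[of _ "monom 1 d"]) (simp add: poly_monom degree_monom_le)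

lemma polyf_exists_Suc: "polyf d F \<Longrightarrow> \<exists>p. \<forall>t. F t = poly p t"
  by (auto simp: polyf_def)

lemma polyv_const: "polyv d (\<lambda>t. c)"
  by (simp add: polyv_def polyf_const)

lemma polyv_add: "polyv d F \<Longrightarrow> polyv d G \<Longrightarrow> polyv d (\<lambda>t. F t + G t)"
  by (simp add: polyv_def polyf_add)

lemma polyv_minus: "polyv d F \<Longrightarrow> polyv d (\<lambda>t. - F t)"
  by (simp add: polyv_def polyf_minus)

lemma polyv_diff: "polyv d F \<Longrightarrow> polyv d G \<Longrightarrow> polyv d (\<lambda>t. F t - G t)"
  using polyv_add[OF _ polyv_minus] by fastforce

lemma polyv_scale: "polyf d f \<Longrightarrow> polyv d' F \<Longrightarrow> polyv (d + d') (\<lambda>t. f t *s F t)"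
  by (simp add: polyv_def polyf_mult)

lemma polyv_mono: "polyv d F \<Longrightarrow> d \<le> d' \<Longrightarrow> polyv d' F"
  unfolding polyv_def using polyf_mono by blast

lemma polyv_power: "polyv d (\<lambda>t. t ^ d *s c)"
  using polyv_scale[OF polyf_power polyv_const[of 0 c], of d] by simp

lemma vec_axis_sum: "(x :: 'a::field ^ 'n) = (\<Sum>i\<in>UNIV. x $ i *s axis i 1)"
  by (simp add: vec_eq_iff axis_def if_distrib cong: if_cong)

context cubic
begin

lemma X_axis: "x \<bowtie> y = (\<Sum>i\<in>UNIV. \<Sum>j\<in>UNIV. (x $ i * y $ j) *s (axis i 1 \<bowtie> axis j 1))"
proof -
  have "x \<bowtie> y = (\<Sum>i\<in>UNIV. x $ i *s axis i 1) \<bowtie> (\<Sum>j\<in>UNIV. y $ j *s axis j 1)"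
    by (metis vec_axis_sum)
  also have "\<dots> = (\<Sum>i\<in>UNIV. (x $ i *s axis i 1) \<bowtie> (\<Sum>j\<in>UNIV. y $ j *s axis j 1))"
    by (rule X_sum)
  also have "\<dots> = (\<Sum>i\<in>UNIV. \<Sum>j\<in>UNIV. (x $ i *s axis i 1) \<bowtie> (y $ j *s axis j 1))"
    by (simp only: X_sum_right)
  also have "\<dots> = (\<Sum>i\<in>UNIV. \<Sum>j\<in>UNIV. (x $ i * y $ j) *s (axis i 1 \<bowtie> axis j 1))"
    by (simp add: bilin mult.commute)
  finally show ?thesis .
qed

lemma T_axis: "T x y = (\<Sum>i\<in>UNIV. \<Sum>j\<in>UNIV. (x $ i * y $ j) * T (axis i 1) (axis j 1))"
proof -
  have "T x y = T (\<Sum>i\<in>UNIV. x $ i *s axis i 1) (\<Sum>j\<in>UNIV. y $ j *s axis j 1)"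
    by (metis vec_axis_sum)
  also have "\<dots> = (\<Sum>i\<in>UNIV. T (x $ i *s axis i 1) (\<Sum>j\<in>UNIV. y $ j *s axis j 1))"
    by (rule T_sum)
  also have "\<dots> = (\<Sum>i\<in>UNIV. \<Sum>j\<in>UNIV. T (x $ i *s axis i 1) (y $ j *s axis j 1))"
    by (simp only: T_sum_right)
  also have "\<dots> = (\<Sum>i\<in>UNIV. \<Sum>j\<in>UNIV. (x $ i * y $ j) * T (axis i 1) (axis j 1))"
    by (simp add: bilin ac_simps)
  finally show ?thesis .
qed

lemma polyf_T: "polyv d F \<Longrightarrow> polyv d' G \<Longrightarrow> polyf (d + d') (\<lambda>t. T (F t) (G t))"
  unfolding T_axis[of "F _"]
  by (intro polyf_sum polyf_mult_const polyf_mult) (auto simp: polyv_def)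

lemma polyv_X: "polyv d F \<Longrightarrow> polyv d' G \<Longrightarrow> polyv (d + d') (\<lambda>t. F t \<bowtie> G t)"
  unfolding X_axis[of "F _"] polyv_def sum_component vector_smult_component
  by (intro allI polyf_sum polyf_mult_const polyf_mult) auto

lemma polyf_nrm: "polyv d F \<Longrightarrow> polyf (d + d) (\<lambda>t. nrm (F t))"
  using polyf_cmult[OF polyf_T, of d F d F "inverse 2"] by (simp add: nrm_def field_simps)

end

section \<open>The coprime factors 1 + m t^2\<close>

definition qd :: "'a::field \<Rightarrow> 'a poly" where
  "qd m = [:1, 0, m:]"

lemma poly_qd: "poly (qd m) t = 1 + m * t^2"
  by (simp add: qd_def power2_eq_square algebra_simps)

lemma qd_nonzero: "qd m \<noteq> 0"
  by (simp add: qd_def)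

lemma degree_qd: "m \<noteq> 0 \<Longrightarrow> degree (qd m) = 2"
  by (simp add: qd_def)

lemma qd_bezout: "smult m (qd k) - smult k (qd m) = [:m - k:]"
  by (simp add: qd_def)

text \<open>For m \<noteq> k the combination m (1 + k t^2) - k (1 + m t^2) is the nonzero constant m
  - k, so the two factors are coprime.\<close>

lemma qd_dvd_mult:
  assumes "m \<noteq> (k::'a::field)" "qd m dvd qd k * p" shows "qd m dvd p"
proof -
  have "qd m dvd smult m (qd k * p) - smult k (qd m * p)"
    using assms(2) by (intro dvd_diff dvd_smult) auto
  also have "smult m (qd k * p) - smult k (qd m * p) = (smult m (qd k) - smult k (qd m)) * p"
    by (simp add: algebra_simps)
  also have "\<dots> = smult (m - k) p" by (simp only: qd_bezout) simp
  finally show ?thesis using assms(1) by (simp add: dvd_smult_iff)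
qed

lemma qd_dvd_mult2:
  assumes "m \<noteq> (k::'a::field)" "qd m dvd p" "qd k dvd p" shows "qd m * qd k dvd p"
proof -
  from assms(3) obtain r where r: "p = qd k * r" by (auto simp: dvd_def)
  have "qd m dvd r" using assms(1,2) qd_dvd_mult unfolding r by blast
  then show ?thesis unfolding r by (metis mult.commute mult_dvd_mono dvd_refl)
qed

lemma qd_sq_dvd_mult:
  assumes "m \<noteq> (k::'a::field)" "qd m * qd m dvd qd k * p" shows "qd m * qd m dvd p"
proof -
  have "qd m dvd qd k * p" using assms(2) by (meson dvd_trans dvd_triv_left)
  then obtain r where r: "p = qd m * r" using qd_dvd_mult[OF assms(1)] by (auto simp: dvd_def)
  have "qd m * qd m dvd qd m * (qd k * r)" using assms(2) unfolding r by (simp add: ac_simps)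
  then have "qd m dvd qd k * r" using qd_nonzero[of m] by (simp add: dvd_mult_cancel_left)
  then have "qd m dvd r" using qd_dvd_mult[OF assms(1)] by blast
  then show ?thesis unfolding r by (simp add: mult_dvd_mono)
qed

lemma const_multiple:
  assumes "q dvd p" "degree p \<le> degree q" "q \<noteq> (0::'a::field poly)"
  shows "\<exists>c. p = smult c q"
proof -
  from assms(1) obtain r where r: "p = q * r" by (auto simp: dvd_def)
  show ?thesis
  proof (cases "r = 0")
    case True then show ?thesis using r by (intro exI[of _ 0]) simp
  next
    case False
    then have "degree r = 0" using r assms by (simp add: degree_mult_eq)
    then obtain c where "r = [:c:]" by (metis degree_eq_zeroE)
    then show ?thesis using r by (intro exI[of _ c]) simp
  qed
qed

lemma poly_eqI_infinite:
  assumes "infinite (UNIV :: 'a::field set)" "\<And>t. poly p t = poly q (t::'a)" shows "p = q"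
proof (rule ccontr)
  assume "p \<noteq> q"
  then have "finite {t. poly (p - q) t = 0}" by (intro poly_roots_finite) simp
  then show False using assms by simp
qed

section \<open>Reflections along v + t w and the cancellation of their poles\<close>

context cubic
begin

text \<open>For a \<open>plane\<close> this is 1 + \<mu> t^2 times the reflection of y t along v + t
  w; as nrm (v + t w) = \<alpha> (1 + \<mu> t^2), the factor clears the denominator.\<close>

definition refl_curve :: "'a \<Rightarrow> 'a \<Rightarrow> 'a ^ 'n \<Rightarrow> 'a ^ 'n \<Rightarrow> ('a \<Rightarrow> 'a ^ 'n) \<Rightarrow> 'a \<Rightarrow> 'a ^ 'n" where
  "refl_curve \<alpha> \<mu> v w y t =
     (1 + \<mu> * t^2) *s y t - (T (v + t *s w) (y t) / \<alpha>) *s (v + t *s w)"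

definition plane :: "'a \<Rightarrow> 'a \<Rightarrow> 'a ^ 'n \<Rightarrow> 'a ^ 'n \<Rightarrow> bool" where
  "plane \<alpha> \<mu> v w \<longleftrightarrow> T v w = 0 \<and> nrm v = \<alpha> \<and> nrm w = \<alpha> * \<mu> \<and> \<alpha> \<noteq> 0"

text \<open>At a zero of 1 + \<mu> t^2 the vector v + t w is isotropic, and the condition puts Y
  there into the kernel of multiplication by it. The polynomial quotient Z is what the divisibility
  arguments compute with.\<close>

definition divides_along :: "'a ^ 'n \<Rightarrow> 'a ^ 'n \<Rightarrow> 'a ^ 'n \<Rightarrow> 'a \<Rightarrow> 'a ^ 'n \<Rightarrow> 'a ^ 'n \<Rightarrow> ('a \<Rightarrow> 'a ^ 'n) \<Rightarrow> bool" where
  "divides_along a b c \<mu> v w Y \<longleftrightarrow> (\<exists>Z d. polyv d Z \<and> (\<forall>t. peirce a b c (Z t))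
      \<and> (\<forall>t. (v + t *s w) \<bowtie> Y t = (1 + \<mu> * t^2) *s Z t))"

lemma nrm_line: "plane \<alpha> \<mu> v w \<Longrightarrow> nrm (v + t *s w) = \<alpha> * (1 + \<mu> * t^2)"
  using two by (simp add: plane_def nrm_def bilin T_commute[of w v] power2_eq_square field_simps)

lemma T_line: "plane \<alpha> \<mu> v w \<Longrightarrow> T (v + t *s w) (v + t *s w) = 2 * (\<alpha> * (1 + \<mu> * t^2))"
  using nrm_line T_self_nrm by metis

lemma nrm_refl_curve:
  assumes "plane \<alpha> \<mu> v w"
  shows "nrm (refl_curve \<alpha> \<mu> v w y t) = (1 + \<mu> * t^2)^2 * nrm (y t)"
proof -
  let ?g = "1 + \<mu> * t^2" and ?u = "v + t *s w"
  define k where "k = T ?u (y t) / \<alpha>"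
  have k: "k * \<alpha> = T ?u (y t)" using assms by (simp add: plane_def k_def)
  have "2 * nrm (refl_curve \<alpha> \<mu> v w y t)
      = ?g * ?g * T (y t) (y t) - 2 * (?g * k * T ?u (y t)) + k * k * T ?u ?u"
    unfolding T_self_nrm[symmetric] refl_curve_def k_def[symmetric]
    by (simp only: T_diff T_diff_right T_scale T_scale_right T_commute[of "y t" ?u]) (simp add: algebra_simps)
  also have "\<dots> = 2 * (?g^2 * nrm (y t))"
    unfolding T_line[OF assms] T_self_nrm[of "y t"] k[symmetric]
    by (simp add: algebra_simps power2_eq_square)
  finally show ?thesis by (rule mult_cancel[OF two])
qed

lemma T_refl_curve_line:
  assumes "plane \<alpha> \<mu> v w"
  shows "T (refl_curve \<alpha> \<mu> v w y t) (v + t *s w) = - ((1 + \<mu> * t^2) * T (v + t *s w) (y t))"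
proof -
  let ?g = "1 + \<mu> * t^2" and ?u = "v + t *s w"
  define k where "k = T ?u (y t) / \<alpha>"
  have k: "k * \<alpha> = T ?u (y t)" using assms by (simp add: plane_def k_def)
  have "T (refl_curve \<alpha> \<mu> v w y t) ?u = ?g * T ?u (y t) - k * T ?u ?u"
    unfolding refl_curve_def k_def by (simp only: T_diff T_scale T_commute[of "y t" ?u])
  then show ?thesis unfolding T_line[OF assms] k[symmetric] by (simp add: algebra_simps)
qed

lemma scaled_by_line:
  assumes f: "frm a b c" and pl: "plane \<alpha> \<mu> v w"
    and v: "peirce a b c v" "peirce a b c w" and Y: "peirce b c a Y"
    and Z: "(v + t *s w) \<bowtie> Y = (1 + \<mu> * t^2) *s Z"
  shows "(\<alpha> * (1 + \<mu> * t^2)) *s Y = (1 + \<mu> * t^2) *s ((v + t *s w) \<bowtie> Z)"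
proof -
  have u: "peirce a b c (v + t *s w)" using v by (intro peirce_intros)
  show ?thesis using X_X_peirce[OF f u Y] unfolding Z nrm_line[OF pl] by (simp only: X_scale_right)
qed

lemma polyv_line: "polyv (Suc 0) (\<lambda>t. v + t *s w)"
  using polyv_add[OF polyv_const polyv_power[of 1 w], of v] by simp

text \<open>Comparing norms in \<open>scaled_by_line\<close>: the composition law contributes three
  factors 1 + \<mu> t^2 on one side and the scalar contributes two on the other, so one survives in
  nrm Y.\<close>

lemma qd_dvd_nrm:
  assumes inf: "infinite (UNIV :: 'a set)" and f: "frm a b c" and pl: "plane \<alpha> \<mu> v w"
    and v: "peirce a b c v" "peirce a b c w" and Y: "\<And>t. peirce b c a (Y t)"
    and D: "divides_along c a b \<mu> v w Y" and p: "\<And>t. nrm (Y t) = poly p t"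
  shows "qd \<mu> dvd p"
proof -
  obtain Z d where Zp: "polyv d Z" and Zc: "\<And>t. peirce c a b (Z t)"
    and Z: "\<And>t. (v + t *s w) \<bowtie> Y t = (1 + \<mu> * t^2) *s Z t"
    using D by (auto simp: divides_along_def)
  obtain z where z: "\<And>t. nrm (Z t) = poly z t" using polyf_nrm[OF Zp] polyf_exists_Suc by blast
  have a0: "\<alpha> \<noteq> 0" using pl by (simp add: plane_def)
  have "poly (smult \<alpha> (qd \<mu> ^ 2 * p)) t = poly (qd \<mu> ^ 3 * z) t" for t
  proof -
    let ?g = "1 + \<mu> * t^2" and ?u = "v + t *s w"
    have u: "peirce a c b ?u" using v by (intro peirce_swap[of a b c] peirce_intros)
    have nz: "nrm (?u \<bowtie> Z t) = (\<alpha> * ?g) * nrm (Z t)"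
      using nrm_X[OF frm_flip[OF f] u peirce_swap[OF Zc]] nrm_line[OF pl] by simp
    have "nrm ((\<alpha> * ?g) *s Y t) = nrm (?g *s (?u \<bowtie> Z t))"
      using scaled_by_line[OF f pl v Y Z] by simp
    then have "(\<alpha> * ?g)^2 * nrm (Y t) = ?g^2 * ((\<alpha> * ?g) * nrm (Z t))"
      unfolding nrm_scale nz .
    then have "\<alpha> * (\<alpha> * (?g^2 * nrm (Y t))) = \<alpha> * (?g^3 * nrm (Z t))"
      by (simp add: power_mult_distrib power2_eq_square power3_eq_cube ac_simps)
    then have "\<alpha> * (?g^2 * nrm (Y t)) = ?g^3 * nrm (Z t)" by (rule mult_cancel[OF a0])
    then show ?thesis by (simp add: poly_qd z p)
  qed
  \<comment> \<open>From here on the factor is cancelled between polynomials and not pointwise,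
    because 1 + \<mu> t^2 may vanish at particular t.\<close>
  then have "smult \<alpha> (qd \<mu> ^ 2 * p) = qd \<mu> ^ 3 * z" by (rule poly_eqI_infinite[OF inf])
  then have "qd \<mu> ^ 2 * smult \<alpha> p = qd \<mu> ^ 2 * (qd \<mu> * z)"
    by (simp add: power2_eq_square power3_eq_cube ac_simps)
  then have "smult \<alpha> p = qd \<mu> * z" using qd_nonzero[of \<mu>] mult_left_cancel[of "qd \<mu> ^ 2"] by fastforce
  then have "qd \<mu> dvd smult \<alpha> p" by simp
  then show ?thesis using a0 by (simp add: dvd_smult_iff)
qed

text \<open>A degree count: nrm (y t) has degree at most 4 and is divisible by the two coprime
  quadratic factors of the other Peirce spaces, the factor of its own reflection being prime to
  them. So it is a constant multiple of their product, and t = 0 gives the constant.\<close>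

lemma nrm_on_curve:
  assumes inf: "infinite (UNIV :: 'a set)" and f: "frm a b c"
    and pl: "plane \<alpha> \<mu> v w" "plane \<alpha>' \<mu>' v' w'" "plane \<alpha>'' \<mu>'' v'' w''"
    and v: "peirce a b c v" "peirce a b c w" and v': "peirce b c a v'" "peirce b c a w'"
    and v'': "peirce c a b v''" "peirce c a b w''"
    and \<mu>: "\<mu> \<noteq> \<mu>'" "\<mu> \<noteq> \<mu>''" "\<mu>' \<noteq> \<mu>''" "\<mu>' \<noteq> 0" "\<mu>'' \<noteq> 0"
    and y: "polyv 2 y" "\<And>t. peirce a b c (y t)"
    and D': "divides_along c a b \<mu>' v' w' (refl_curve \<alpha> \<mu> v w y)"
    and D'': "divides_along b c a \<mu>'' v'' w'' (refl_curve \<alpha> \<mu> v w y)"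
  shows "nrm (y t) = nrm (y 0) * ((1 + \<mu>' * t^2) * (1 + \<mu>'' * t^2))"
proof -
  let ?Y = "refl_curve \<alpha> \<mu> v w y"
  have Yc: "peirce a b c (?Y t)" for t
    unfolding refl_curve_def using v y(2) by (intro peirce_intros)
  obtain p where pd: "degree p \<le> 4" and p: "\<And>t. nrm (y t) = poly p t"
    using polyf_nrm[OF y(1)] by (auto simp: polyf_def)
  have pY: "nrm (?Y t) = poly (qd \<mu> * (qd \<mu> * p)) t" for t
    unfolding nrm_refl_curve[OF pl(1)] by (simp add: p poly_qd power2_eq_square)
  have "qd \<mu>' dvd qd \<mu> * (qd \<mu> * p)"
    using qd_dvd_nrm[OF inf frm_swap[OF f] pl(2) v'[THEN peirce_swap] _ _ pY] D' Yc
    by (auto simp: divides_along_def intro: peirce_swap)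
  then have 1: "qd \<mu>' dvd p" using qd_dvd_mult \<mu>(1) by metis
  have "qd \<mu>'' dvd qd \<mu> * (qd \<mu> * p)"
    using qd_dvd_nrm[OF inf frm_rotate[OF frm_rotate[OF f]] pl(3) v'' _ D'' pY] Yc by blast
  then have 2: "qd \<mu>'' dvd p" using qd_dvd_mult \<mu>(2) by metis
  have "qd \<mu>' * qd \<mu>'' dvd p" by (rule qd_dvd_mult2[OF \<mu>(3) 1 2])
  moreover have "degree (qd \<mu>' * qd \<mu>'') = 4"
    using \<mu> by (simp add: degree_mult_eq qd_nonzero degree_qd)
  ultimately obtain k where k: "p = smult k (qd \<mu>' * qd \<mu>'')"
    using const_multiple[of "qd \<mu>' * qd \<mu>''" p] pd qd_nonzero by auto
  have "nrm (y t) = k * ((1 + \<mu>' * t^2) * (1 + \<mu>'' * t^2))" for t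
    by (simp add: p k poly_qd)
  from this[of t] this[of 0] show ?thesis by simp
qed

text \<open>By \<open>scaled_by_line\<close>, Y2 and Y3 are multiples of (v + t w) \<bowtie> Z2 and
  (v + t w) \<bowtie> Z3, and by \<open>X_X_X_peirce\<close> their product contains the reflection
  along v + t w. It cancels the reflection in the first argument and leaves - (1 + \<mu> t^2)^2 T(y,
  Z3 \<bowtie> Z2) up to the constant \<alpha>.\<close>

lemma qd_sq_dvd_trilinear:
  assumes inf: "infinite (UNIV :: 'a set)" and f: "frm a b c" and pl: "plane \<alpha> \<mu> v w"
    and v: "peirce a b c v" "peirce a b c w" and y: "polyv d y"
    and Y2: "\<And>t. peirce b c a (Y2 t)" and Y3: "\<And>t. peirce c a b (Y3 t)"
    and D2: "divides_along c a b \<mu> v w Y2" and D3: "divides_along b c a \<mu> v w Y3"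
    and p: "\<And>t. T (refl_curve \<alpha> \<mu> v w y t) (Y2 t \<bowtie> Y3 t) = poly p t"
  shows "qd \<mu> * qd \<mu> dvd p"
proof -
  obtain Z2 d2 where Z2p: "polyv d2 Z2" and Z2c: "\<And>t. peirce c a b (Z2 t)"
    and Z2: "\<And>t. (v + t *s w) \<bowtie> Y2 t = (1 + \<mu> * t^2) *s Z2 t"
    using D2 by (auto simp: divides_along_def)
  obtain Z3 d3 where Z3p: "polyv d3 Z3" and Z3c: "\<And>t. peirce b c a (Z3 t)"
    and Z3: "\<And>t. (v + t *s w) \<bowtie> Y3 t = (1 + \<mu> * t^2) *s Z3 t"
    using D3 by (auto simp: divides_along_def)
  obtain z where z: "\<And>t. T (y t) (Z3 t \<bowtie> Z2 t) = poly z t"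
    using polyf_T[OF y polyv_X[OF Z3p Z2p]] polyf_exists_Suc by blast
  have a0: "\<alpha> \<noteq> 0" using pl by (simp add: plane_def)
  have "poly (smult \<alpha> (qd \<mu> ^ 2 * p)) t = poly (- (qd \<mu> ^ 4 * z)) t" for t
  proof -
    let ?g = "1 + \<mu> * t^2" and ?u = "v + t *s w" and ?Y = "refl_curve \<alpha> \<mu> v w y t"
    have u: "peirce a b c ?u" using v by (intro peirce_intros)
    have 1: "(\<alpha> * ?g) *s Y2 t = ?g *s (?u \<bowtie> Z2 t)" by (rule scaled_by_line[OF f pl v Y2 Z2])
    have 2: "(\<alpha> * ?g) *s Y3 t = ?g *s (?u \<bowtie> Z3 t)"
      by (rule scaled_by_line[OF frm_flip[OF f] pl v[THEN peirce_swap] peirce_swap[OF Y3] Z3])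
    have 3: "(?u \<bowtie> Z2 t) \<bowtie> (?u \<bowtie> Z3 t) = T ?u (Z3 t \<bowtie> Z2 t) *s ?u - (\<alpha> * ?g) *s (Z3 t \<bowtie> Z2 t)"
      using X_X_X_peirce[OF f u Z3c Z2c] unfolding nrm_line[OF pl] T_X
      by (simp add: X_commute[of "?u \<bowtie> Z2 t"])
    have Yz: "T ?Y (Z3 t \<bowtie> Z2 t) = ?g * T (y t) (Z3 t \<bowtie> Z2 t) - (T ?u (y t) / \<alpha>) * T ?u (Z3 t \<bowtie> Z2 t)"
      unfolding refl_curve_def by (simp only: T_diff T_scale)
    have "(\<alpha> * ?g)^2 * T ?Y (Y2 t \<bowtie> Y3 t) = T ?Y (((\<alpha> * ?g) *s Y2 t) \<bowtie> ((\<alpha> * ?g) *s Y3 t))"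
      by (simp only: X_scale X_scale_right T_scale_right) (simp add: power2_eq_square mult.assoc)
    also have "\<dots> = ?g^2 * T ?Y ((?u \<bowtie> Z2 t) \<bowtie> (?u \<bowtie> Z3 t))"
      unfolding 1 2 by (simp only: X_scale X_scale_right T_scale_right) (simp add: power2_eq_square mult.assoc)
    also have "\<dots> = ?g^2 * (T ?u (Z3 t \<bowtie> Z2 t) * T ?Y ?u - (\<alpha> * ?g) * T ?Y (Z3 t \<bowtie> Z2 t))"
      unfolding 3 by (simp only: T_diff_right T_scale_right)
    also have "\<dots> = \<alpha> * (- (?g^4 * T (y t) (Z3 t \<bowtie> Z2 t)))"
      unfolding T_refl_curve_line[OF pl] Yz using a0 by (simp add: field_simps power2_eq_square eval_nat_numeral)
    finally have "\<alpha> * (\<alpha> * (?g^2 * T ?Y (Y2 t \<bowtie> Y3 t))) = \<alpha> * (- (?g^4 * T (y t) (Z3 t \<bowtie> Z2 t)))"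
      by (simp add: power_mult_distrib power2_eq_square ac_simps)
    then have "\<alpha> * (?g^2 * T ?Y (Y2 t \<bowtie> Y3 t)) = - (?g^4 * T (y t) (Z3 t \<bowtie> Z2 t))"
      by (rule mult_cancel[OF a0])
    then show ?thesis by (simp add: poly_qd z p)
  qed
  then have "smult \<alpha> (qd \<mu> ^ 2 * p) = - (qd \<mu> ^ 4 * z)" by (rule poly_eqI_infinite[OF inf])
  then have "qd \<mu> ^ 2 * smult \<alpha> p = qd \<mu> ^ 2 * (- (qd \<mu> * qd \<mu> * z))"
    by (simp add: power2_eq_square eval_nat_numeral ac_simps)
  then have "smult \<alpha> p = - (qd \<mu> * qd \<mu> * z)"
    using qd_nonzero[of \<mu>] mult_left_cancel[of "qd \<mu> ^ 2"] by fastforce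
  then have "qd \<mu> * qd \<mu> dvd smult \<alpha> p" by (metis dvd_minus_iff dvd_triv_left)
  then show ?thesis using a0 by (simp add: dvd_smult_iff)
qed

lemma polyv_refl_curve: "polyv 2 y \<Longrightarrow> polyv 4 (refl_curve \<alpha> \<mu> v w y)"
proof -
  assume y: "polyv 2 y"
  have 1: "polyf 2 (\<lambda>t. 1 + \<mu> * t^2)" by (intro polyf_add polyf_const polyf_cmult polyf_power)
  have 2: "polyv 4 (\<lambda>t. (1 + \<mu> * t^2) *s y t)" using polyv_scale[OF 1 y] by simp
  have 3: "polyf 3 (\<lambda>t. inverse \<alpha> * T (v + t *s w) (y t))"
    using polyf_cmult[OF polyf_T[OF polyv_line y]] by (simp add: eval_nat_numeral)
  have 4: "polyv 4 (\<lambda>t. (inverse \<alpha> * T (v + t *s w) (y t)) *s (v + t *s w))"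
    using polyv_scale[OF 3 polyv_line] by (simp add: eval_nat_numeral)
  show ?thesis using polyv_diff[OF 2 4] unfolding refl_curve_def[abs_def]
    by (simp add: divide_inverse mult.commute)
qed

text \<open>The reflection along v + t w has a simple pole at the zeros of 1 + m t^2 (m = Q(w)/Q(v)); the six
  divisibility conditions say that the curve Y lies in the lattice which compensates these poles.\<close>

theorem frame_similarity:
  assumes inf: "infinite (UNIV :: 'a set)" and f: "frm a b c"
    and pl: "plane \<alpha> \<mu> v w" "plane \<alpha>' \<mu>' v' w'" "plane \<alpha>'' \<mu>'' v'' w''"
    and v: "peirce a b c v" "peirce a b c w" and v': "peirce b c a v'" "peirce b c a w'"
    and v'': "peirce c a b v''" "peirce c a b w''"
    and \<mu>: "\<mu> \<noteq> \<mu>'" "\<mu> \<noteq> \<mu>''" "\<mu>' \<noteq> \<mu>''" "\<mu> \<noteq> 0" "\<mu>' \<noteq> 0" "\<mu>'' \<noteq> 0"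
    and y: "polyv 2 y" "\<And>t. peirce a b c (y t)" and y': "polyv 2 y'" "\<And>t. peirce b c a (y' t)"
    and y'': "polyv 2 y''" "\<And>t. peirce c a b (y'' t)"
    and Y: "Y = refl_curve \<alpha> \<mu> v w y" "Y' = refl_curve \<alpha>' \<mu>' v' w' y'"
      "Y'' = refl_curve \<alpha>'' \<mu>'' v'' w'' y''"
    and D: "divides_along c a b \<mu> v w Y'" "divides_along b c a \<mu> v w Y''"
      "divides_along c a b \<mu>' v' w' Y" "divides_along a b c \<mu>' v' w' Y''"
      "divides_along b c a \<mu>'' v'' w'' Y" "divides_along a b c \<mu>'' v'' w'' Y'"
    and nz: "1 + \<mu> * t^2 \<noteq> 0" "1 + \<mu>' * t^2 \<noteq> 0" "1 + \<mu>'' * t^2 \<noteq> 0"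
  shows "Nm (((1 + \<mu> * t^2) * k) *s a + ((1 + \<mu>' * t^2) * l) *s b + ((1 + \<mu>'' * t^2) * m) *s c
      + (inverse (1 + \<mu> * t^2) *s Y t + inverse (1 + \<mu>' * t^2) *s Y' t + inverse (1 + \<mu>'' * t^2) *s Y'' t))
    = (1 + \<mu> * t^2) * (1 + \<mu>' * t^2) * (1 + \<mu>'' * t^2)
      * Nm (k *s a + l *s b + m *s c + (Y 0 + Y' 0 + Y'' 0))"
proof -
  have fb: "frm b c a" and fc: "frm c a b" using frm_rotate f by blast+
  have Yc: "peirce a b c (Y t)" for t unfolding Y refl_curve_def using v y(2) by (intro peirce_intros)
  have Yc': "peirce b c a (Y' t)" for t unfolding Y refl_curve_def using v' y'(2) by (intro peirce_intros)
  have Yc'': "peirce c a b (Y'' t)" for t unfolding Y refl_curve_def using v'' y''(2) by (intro peirce_intros)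
  define g g' g'' where "g = 1 + \<mu> * t^2" "g' = 1 + \<mu>' * t^2" "g'' = 1 + \<mu>'' * t^2"
  have n: "nrm (Y t) = g^2 * (g' * g'') * nrm (Y 0)"
    unfolding Y nrm_refl_curve[OF pl(1)] g_g'_g''_def
    using nrm_on_curve[OF inf f pl v v' v'' \<mu>(1,2,3,5,6) y D(3,5)[unfolded Y], of t] by simp
  have n': "nrm (Y' t) = g'^2 * (g'' * g) * nrm (Y' 0)"
    unfolding Y nrm_refl_curve[OF pl(2)] g_g'_g''_def
    using nrm_on_curve[OF inf fb pl(2,3,1) v' v'' v \<mu>(3) \<mu>(1)[symmetric] \<mu>(2)[symmetric] \<mu>(6,4) y' D(6,1)[unfolded Y], of t] by simp
  have n'': "nrm (Y'' t) = g''^2 * (g * g') * nrm (Y'' 0)"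
    unfolding Y nrm_refl_curve[OF pl(3)] g_g'_g''_def
    using nrm_on_curve[OF inf fc pl(3,1,2) v'' v v' \<mu>(2)[symmetric] \<mu>(3)[symmetric] \<mu>(1) \<mu>(4,5) y'' D(2,4)[unfolded Y], of t] by simp
  have Yp: "polyv 4 Y" "polyv 4 Y'" "polyv 4 Y''" unfolding Y by (intro polyv_refl_curve y(1) y'(1) y''(1))+
  \<comment> \<open>Each of the three curves has degree at most 4, and the three squared quadratic
    factors have total degree 12 as well; so the trilinear form is a constant multiple of their
    product.\<close>
  obtain p where pd: "degree p \<le> 12" and p: "\<And>t. T (Y t) (Y' t \<bowtie> Y'' t) = poly p t"
    using polyf_T[OF Yp(1) polyv_X[OF Yp(2,3)]] by (auto simp: polyf_def)
  have p': "T (Y' t) (Y'' t \<bowtie> Y t) = poly p t" for t using p[of t] by (metis T_X_left X_commute)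
  have p'': "T (Y'' t) (Y t \<bowtie> Y' t) = poly p t" for t using p[of t] by (metis T_X_left X_commute)
  have d1: "qd \<mu> * qd \<mu> dvd p"
    by (rule qd_sq_dvd_trilinear[OF inf f pl(1) v y(1) Yc' Yc'' D(1,2) p[unfolded Y(1)]])
  have d2: "qd \<mu>' * qd \<mu>' dvd p"
    by (rule qd_sq_dvd_trilinear[OF inf fb pl(2) v' y'(1) Yc'' Yc D(4,3) p'[unfolded Y(2)]])
  have d3: "qd \<mu>'' * qd \<mu>'' dvd p"
    by (rule qd_sq_dvd_trilinear[OF inf fc pl(3) v'' y''(1) Yc Yc' D(5,6) p''[unfolded Y(3)]])
  obtain r where r: "p = (qd \<mu> * qd \<mu>) * r" using d1 by (auto simp: dvd_def)
  have "qd \<mu>' * qd \<mu>' dvd qd \<mu> * (qd \<mu> * r)" using d2 unfolding r by (simp add: mult.assoc)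
  then have "qd \<mu>' * qd \<mu>' dvd r" using qd_sq_dvd_mult \<mu>(1) by metis
  then obtain s where s: "r = (qd \<mu>' * qd \<mu>') * s" by (auto simp: dvd_def)
  have "qd \<mu>'' * qd \<mu>'' dvd qd \<mu> * (qd \<mu> * (qd \<mu>' * (qd \<mu>' * s)))"
    using d3 unfolding r s by (simp add: mult.assoc)
  then have "qd \<mu>'' * qd \<mu>'' dvd s" using qd_sq_dvd_mult \<mu>(2,3) by metis
  then obtain q where q: "s = (qd \<mu>'' * qd \<mu>'') * q" by (auto simp: dvd_def)
  let ?f = "qd \<mu> * qd \<mu> * (qd \<mu>' * qd \<mu>') * (qd \<mu>'' * qd \<mu>'')"
  have "?f dvd p" unfolding r s q by (simp add: mult.assoc)
  moreover have "degree ?f = 12" using \<mu> by (simp add: degree_mult_eq qd_nonzero degree_qd)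
  ultimately obtain h where h: "p = smult h ?f"
    using const_multiple[of ?f p] pd qd_nonzero by auto
  have H: "T (Y t) (Y' t \<bowtie> Y'' t) = (g * g' * g'')^2 * T (Y 0) (Y' 0 \<bowtie> Y'' 0)"
    unfolding p h g_g'_g''_def by (simp add: poly_qd power2_eq_square ac_simps)
  have nz': "g \<noteq> 0" "g' \<noteq> 0" "g'' \<noteq> 0" using nz by (simp_all add: g_g'_g''_def)
  have s: "peirce a b c (inverse g *s Y t)" "peirce b c a (inverse g' *s Y' t)" "peirce c a b (inverse g'' *s Y'' t)"
    using Yc Yc' Yc'' by (simp_all add: peirce_scale)
  have nn: "nrm (inverse g *s Y t) = g' * g'' * nrm (Y 0)" "nrm (inverse g' *s Y' t) = g'' * g * nrm (Y' 0)"
    "nrm (inverse g'' *s Y'' t) = g * g' * nrm (Y'' 0)"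
    unfolding nrm_scale n n' n'' using nz' by (simp_all add: field_simps power2_eq_square)
  have tt: "T (inverse g *s Y t) ((inverse g' *s Y' t) \<bowtie> (inverse g'' *s Y'' t))
      = g * g' * g'' * T (Y 0) (Y' 0 \<bowtie> Y'' 0)"
    unfolding X_scale X_scale_right T_scale T_scale_right H using nz' by (simp add: field_simps power2_eq_square)
  show ?thesis
    unfolding g_g'_g''_def[symmetric] Nm_frame[OF f s] Nm_frame[OF f Yc Yc' Yc''] nn tt
    by (simp add: algebra_simps)
qed

end

section \<open>Divisibility read off coefficients, and idempotents from distinct roots\<close>

context cubic
begin

text \<open>Divisibility of the quintic (v + t w) \<bowtie> Y by 1 + \<mu> t^2 means that its even
  and odd parts vanish at t^2 = - 1 / \<mu>. The assumption F is the odd part only; the even part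
  follows from the Clifford relations for v and w. Having half as many equations makes the later
  linear system square.\<close>

lemma divides_alongI:
  assumes f: "frm a b c" and pl: "plane \<alpha> \<mu> v w" and \<mu>: "\<mu> \<noteq> 0"
    and v: "peirce b c a v" "peirce b c a w"
    and Y: "peirce c a b Y0" "peirce c a b Y1" "peirce c a b Y2" "peirce c a b Y3" "peirce c a b Y4"
    and F: "\<mu>^2 *s (v \<bowtie> Y1 + w \<bowtie> Y0) - \<mu> *s (v \<bowtie> Y3 + w \<bowtie> Y2) + w \<bowtie> Y4 = 0"
  shows "divides_along a b c \<mu> v w (\<lambda>t. Y0 + t *s Y1 + t^2 *s Y2 + t^3 *s Y3 + t^4 *s Y4)"
proof -
  define A where "A = \<mu>^2 *s Y0 - \<mu> *s Y2 + Y4"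
  define B where "B = \<mu>^2 *s Y1 - \<mu> *s Y3"
  have fb: "frm b c a" using frm_rotate[OF f] .
  have a0: "\<alpha> \<noteq> 0" using pl by (simp add: plane_def)
  have Ac: "peirce c a b A" "peirce c a b B" unfolding A_def B_def using Y by (simp_all add: peirce_intros)
  have 1: "v \<bowtie> B + w \<bowtie> A = 0"
    using F unfolding A_def B_def by (simp add: bilin vec_eq_iff algebra_simps)
  have 2: "w \<bowtie> (v \<bowtie> B) + w \<bowtie> (w \<bowtie> A) = 0" using 1 by (metis X_add_right X_zero(2))
  have 3: "w \<bowtie> (w \<bowtie> A) = (\<alpha> * \<mu>) *s A" using X_X_peirce[OF fb v(2) Ac(1)] pl by (simp add: plane_def)
  have "v \<bowtie> (w \<bowtie> B) + w \<bowtie> (v \<bowtie> B) = 0"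
    using X_X_peirce_lin[OF fb v Ac(2)] pl by (simp add: plane_def)
  then have 4: "v \<bowtie> (w \<bowtie> B) = (\<alpha> * \<mu>) *s A" using 2 3
    by (metis add.commute add_left_cancel)
  have wB: "peirce a b c (w \<bowtie> B)" by (rule peirce_X[OF fb v(2) Ac(2)])
  have "v \<bowtie> (v \<bowtie> (w \<bowtie> B)) = \<alpha> *s (w \<bowtie> B)"
    using X_X_peirce[OF frm_flip[OF fb] v(1)[THEN peirce_swap] wB[THEN peirce_swap]] pl by (simp add: plane_def)
  then have "\<alpha> *s (w \<bowtie> B) = \<alpha> *s (\<mu> *s (v \<bowtie> A))" unfolding 4 by (simp add: bilin)
  then have 5: "w \<bowtie> B = \<mu> *s (v \<bowtie> A)" by (rule scale_cancel[OF a0])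
  have even: "\<mu>^2 *s (v \<bowtie> Y0) - \<mu> *s (v \<bowtie> Y2 + w \<bowtie> Y1) + (v \<bowtie> Y4 + w \<bowtie> Y3) = 0"
  proof (rule scale_cancel[OF \<mu>])
    show "\<mu> *s (\<mu>^2 *s (v \<bowtie> Y0) - \<mu> *s (v \<bowtie> Y2 + w \<bowtie> Y1) + (v \<bowtie> Y4 + w \<bowtie> Y3)) = \<mu> *s 0"
      using 5 unfolding A_def B_def by (simp add: bilin vec_eq_iff algebra_simps power2_eq_square)
  qed
  \<comment> \<open>The quotient, by long division from the lowest degree upwards; \<open>e4\<close>
    and \<open>e5\<close> say that nothing remains.\<close>
  define Z0 where "Z0 = v \<bowtie> Y0"
  define Z1 where "Z1 = v \<bowtie> Y1 + w \<bowtie> Y0"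
  define Z2 where "Z2 = v \<bowtie> Y2 + w \<bowtie> Y1 - \<mu> *s Z0"
  define Z3 where "Z3 = v \<bowtie> Y3 + w \<bowtie> Y2 - \<mu> *s Z1"
  let ?Z = "\<lambda>t. Z0 + t *s Z1 + t^2 *s Z2 + t^3 *s Z3"
  have e4: "v \<bowtie> Y4 + w \<bowtie> Y3 = \<mu> *s Z2"
    using even unfolding Z2_def Z0_def by (simp add: vec_eq_iff algebra_simps power2_eq_square)
  have e5: "w \<bowtie> Y4 = \<mu> *s Z3"
    using F unfolding Z3_def Z1_def by (simp add: vec_eq_iff algebra_simps power2_eq_square)
  have pr: "peirce a b c (x \<bowtie> y)" if "peirce b c a x" "peirce c a b y" for x y
    using peirce_X[OF fb that] .
  have Zc: "peirce a b c (?Z t)" for t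
    unfolding Z3_def Z2_def Z1_def Z0_def using v Y by (intro peirce_intros pr)
  have Zp: "polyv 3 ?Z"
  proof -
    have "polyv 3 (\<lambda>t. t ^ k *s c)" if "k \<le> 3" for k and c :: "'a^'n"
      using polyv_mono[OF polyv_power that] .
    from this[of 0 Z0] this[of 1 Z1] this[of 2 Z2] this[of 3 Z3] show ?thesis by (simp add: polyv_add)
  qed
  have "(v + t *s w) \<bowtie> (Y0 + t *s Y1 + t^2 *s Y2 + t^3 *s Y3 + t^4 *s Y4) = (1 + \<mu> * t^2) *s ?Z t" for t
  proof -
    have "(v + t *s w) \<bowtie> (Y0 + t *s Y1 + t^2 *s Y2 + t^3 *s Y3 + t^4 *s Y4)
      = v \<bowtie> Y0 + t *s (v \<bowtie> Y1 + w \<bowtie> Y0) + t^2 *s (v \<bowtie> Y2 + w \<bowtie> Y1) + t^3 *s (v \<bowtie> Y3 + w \<bowtie> Y2)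
        + t^4 *s (v \<bowtie> Y4 + w \<bowtie> Y3) + t^5 *s (w \<bowtie> Y4)"
      by (simp add: bilin vec_eq_iff algebra_simps eval_nat_numeral)
    also have "\<dots> = Z0 + t *s Z1 + t^2 *s (Z2 + \<mu> *s Z0) + t^3 *s (Z3 + \<mu> *s Z1) + t^4 *s (\<mu> *s Z2) + t^5 *s (\<mu> *s Z3)"
      unfolding e4 e5 by (simp add: Z3_def Z2_def Z1_def Z0_def)
    also have "\<dots> = (1 + \<mu> * t^2) *s ?Z t"
      by (simp add: vec_eq_iff algebra_simps eval_nat_numeral)
    finally show ?thesis .
  qed
  then show ?thesis unfolding divides_along_def using Zc Zp by blast
qed

lemma T_elt: "T x x = T x e ^ 2 - 2 * T (sh x) e" "T (sh x) (sh x) = T (sh x) e ^ 2 - 2 * (Nm x * T x e)"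
  using T_X_unit[of x x] T_X_unit[of "sh x" "sh x"]
  by (simp_all add: X_self bilin sh_sh power2_eq_square algebra_simps)

text \<open>Lagrange interpolation: a is (m - q)(m - r) / ((p - q)(p - r)), written with m# in place
  of m^2.\<close>

lemma frame_of_element:
  fixes p q r :: 'a
  assumes s: "T m e = p + q + r" "T (sh m) e = p * q + q * r + r * p" "Nm m = p * q * r"
    and d: "p \<noteq> q" "q \<noteq> r" "r \<noteq> p"
  obtains a b c where "frm a b c" "m = p *s a + q *s b + r *s c" "sh m = (q*r) *s a + (r*p) *s b + (p*q) *s c"
    "a = inverse ((q - p) * (r - p)) *s (sh m + p *s m - (p * (q + r)) *s e)"
    "b = inverse ((r - q) * (p - q)) *s (sh m + q *s m - (q * (r + p)) *s e)"
    "c = inverse ((p - r) * (q - r)) *s (sh m + r *s m - (r * (p + q)) *s e)"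
proof -
  define A where "A p q r = sh m + p *s m - (p * (q + r)) *s e" for p q r
  define D where "D p q r = (q - p) * (r - p)" for p q r :: 'a
  note tab = T_unit X_unit X_unit_right X_self[of m] X_sh_self[of m] X_commute[of "sh m" m] X_self[of "sh m"] sh_sh[of m]
  have AA: "A p q r \<bowtie> A p q r = 0"
    if s: "T m e = p + q + r" "T (sh m) e = p * q + q * r + r * p" "Nm m = p * q * r" for p q r
    unfolding A_def by (simp add: bilin tab s vec_eq_iff algebra_simps)
  have AB: "A p q r \<bowtie> A q r p = (- ((p - q)^2)) *s A r p q"
    if s: "T m e = p + q + r" "T (sh m) e = p * q + q * r + r * p" "Nm m = p * q * r" for p q r
    unfolding A_def by (simp add: bilin tab s vec_eq_iff algebra_simps power2_eq_square)
  note ttab = T_commute[of e m] T_commute[of e "sh m"] T_sh_self T_elt[of m] T_unit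
  have TA: "T (A p q r) (A p q r) = (D p q r)^2"
    if s: "T m e = p + q + r" "T (sh m) e = p * q + q * r + r * p" "Nm m = p * q * r" for p q r
    unfolding A_def D_def by (simp add: bilin ttab s algebra_simps power2_eq_square)
  have TB: "T (A p q r) (A q r p) = 0"
    if s: "T m e = p + q + r" "T (sh m) e = p * q + q * r + r * p" "Nm m = p * q * r" for p q r
    unfolding A_def by (simp add: bilin ttab s algebra_simps power2_eq_square)
  define a b c where "a = inverse (D p q r) *s A p q r" "b = inverse (D q r p) *s A q r p" "c = inverse (D r p q) *s A r p q"
  have s2: "T m e = q + r + p" "T (sh m) e = q * r + r * p + p * q" "Nm m = q * r * p"
    "T m e = r + p + q" "T (sh m) e = r * p + p * q + q * r" "Nm m = r * p * q"
    using s by (simp_all add: ac_simps)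
  have D0: "D p q r \<noteq> 0" "D q r p \<noteq> 0" "D r p q \<noteq> 0" using d by (simp_all add: D_def)
  have dd: "inverse (D q r p) * (inverse (D p q r) * (- ((p - q)^2))) = inverse (D r p q)"
    if "p \<noteq> q" "q \<noteq> r" "r \<noteq> p" for p q r
    using that by (simp add: D_def divide_simps power2_eq_square) (simp add: algebra_simps)
  have ab: "a \<bowtie> b = c" unfolding a_b_c_def
    by (simp only: X_scale X_scale_right AB[OF s] vector_smult_assoc mult.assoc dd[OF d])
  have bc: "b \<bowtie> c = a" unfolding a_b_c_def
    by (simp only: X_scale X_scale_right AB[OF s2(1-3)] vector_smult_assoc mult.assoc dd[OF d(2,3,1)])
  have ca: "c \<bowtie> a = b" unfolding a_b_c_def
    by (simp only: X_scale X_scale_right AB[OF s2(4-6)] vector_smult_assoc mult.assoc dd[OF d(3,1,2)])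
  have sums: "a + b + c = e" "m = p *s a + q *s b + r *s c" "sh m = (q*r) *s a + (r*p) *s b + (p*q) *s c"
  proof -
    \<comment> \<open>The Vandermonde product, a common denominator of the three
      idempotents.\<close>
    define W where "W = (q - r) * (r - p) * (p - q)"
    have W: "W \<noteq> 0" using d by (simp add: W_def)
    have iD: "inverse (D p q r) = - (q - r) * inverse W" "inverse (D q r p) = - (r - p) * inverse W"
      "inverse (D r p q) = - (p - q) * inverse W"
      using d by (simp_all add: W_def D_def divide_simps) (simp_all add: algebra_simps)
    have abc: "a = inverse W *s (- (q - r) *s A p q r)" "b = inverse W *s (- (r - p) *s A q r p)"
       "c = inverse W *s (- (p - q) *s A r p q)"
      unfolding a_b_c_def iD by (simp_all only: vector_smult_assoc mult.commute)
    have comb: "k *s a + l *s b + n *s c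
       = inverse W *s ((- (k * (q - r))) *s A p q r + (- (l * (r - p))) *s A q r p + (- (n * (p - q))) *s A r p q)" for k l n
      unfolding abc by (simp add: vec_eq_iff algebra_simps)
    have 1: "(- (1 * (q - r))) *s A p q r + (- (1 * (r - p))) *s A q r p + (- (1 * (p - q))) *s A r p q = W *s e"
      by (simp add: A_def W_def vec_eq_iff algebra_simps)
    have 2: "(- (p * (q - r))) *s A p q r + (- (q * (r - p))) *s A q r p + (- (r * (p - q))) *s A r p q = W *s m"
      by (simp add: A_def W_def vec_eq_iff algebra_simps)
    have 3: "(- ((q*r) * (q - r))) *s A p q r + (- ((r*p) * (r - p))) *s A q r p + (- ((p*q) * (p - q))) *s A r p q = W *s sh m"
      by (simp add: A_def W_def vec_eq_iff algebra_simps)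
    show "a + b + c = e" using comb[of 1 1 1] unfolding 1 using W by simp
    show "m = p *s a + q *s b + r *s c" unfolding comb 2 using W by simp
    show "sh m = (q*r) *s a + (r*p) *s b + (p*q) *s c" unfolding comb 3 using W by simp
  qed
  have "frm a b c"
    unfolding frm_def using ab bc ca sums(1) D0
    by (simp add: a_b_c_def bilin AA[OF s] AA[OF s2(1-3)] AA[OF s2(4-6)] TA[OF s] TA[OF s2(1-3)] TA[OF s2(4-6)]
        TB[OF s] TB[OF s2(1-3)] TB[OF s2(4-6)] power2_eq_square divide_simps)
  then show thesis using that sums unfolding a_b_c_def A_def D_def by blast
qed

end

lemma alg_closed_cubic:
  fixes t1 t2 t3 :: "'b::alg_closed_field"
  obtains p q r where "t1 = p + q + r" "t2 = p * q + q * r + r * p" "t3 = p * q * r"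
proof -
  obtain p where p: "poly [:- t3, t2, - t1, 1:] p = 0"
    using alg_closed_imp_poly_has_root[of "[:- t3, t2, - t1, 1:]"] by auto
  obtain q where q: "poly [:t2 - p * (t1 - p), - (t1 - p), 1:] q = 0"
    using alg_closed_imp_poly_has_root[of "[:t2 - p * (t1 - p), - (t1 - p), 1:]"] by auto
  define r where "r = t1 - p - q"
  have t1: "t1 = p + q + r" by (simp add: r_def)
  have t2: "t2 = p * q + q * r + r * p" using q by (simp add: r_def algebra_simps)
  have "t3 = p * q * r" using p unfolding t1 t2 by (simp add: algebra_simps)
  then show thesis using that t1 t2 by blast
qed

section \<open>Cubic subfields of a structure with anisotropic norm\<close>

context cubic
begin

lemma Nm_diff: "Nm (x - y) = Nm x - T (sh x) y + T x (sh y) - Nm y"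
  using Nm_add[of x "- y"] Nm_scale[of "-1" y] by (simp add: sh_minus bilin)

lemma charpoly: "Nm (c *s e - m) = c^3 - c^2 * T m e + c * T (sh m) e - Nm m"
  by (simp add: Nm_diff Nm_scale sh_scale bilin T_commute[of e m] T_commute[of e "sh m"])

text \<open>The Gram map, sending y to the sum of T(y,b) b over a basis of W, kills only vectors
  orthogonal to W. By nondegeneracy it is injective on W, hence onto W, and a preimage in W of the
  value at x is the projection.\<close>

lemma orth_decomp:
  assumes W: "vec.subspace W" and nd: "\<And>w. w \<in> W \<Longrightarrow> w \<noteq> 0 \<Longrightarrow> \<exists>w'\<in>W. T w w' \<noteq> 0"
  shows "\<exists>w\<in>W. \<forall>w'\<in>W. T (x - w) w' = 0"
proof -
  obtain B where B: "B \<subseteq> W" "vec.independent B" "W \<subseteq> vec.span B" and "card B = vec.dim W"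
    by (rule vec.basis_exists[of W])
  have fin: "finite B" using B(2) by (rule vec.finiteI_independent)
  define F where "F y = (\<Sum>b\<in>B. T y b *s b)" for y
  have lin: "Vector_Spaces.linear (*s) (*s) F"
    by unfold_locales (simp_all add: F_def bilin vec.scale_left_distrib sum.distrib vec.scale_sum_right)
  have Fd: "F (x - y) = F x - F y" for x y
    by (simp add: F_def bilin vec.scale_left_diff_distrib sum_subtractf)
  have ker: "T y w = 0" if "F y = 0" "w \<in> W" for y w
  proof -
    have b: "T y b = 0" if "b \<in> B" for b
      using vec.independentD[OF B(2) fin subset_refl, of "T y" b] \<open>F y = 0\<close> that by (simp add: F_def)
    have "vec.span B \<subseteq> {w. T y w = 0}"
      by (rule vec.span_minimal) (use b in \<open>auto simp: vec.subspace_def bilin\<close>)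
    then show ?thesis using B(3) that(2) by blast
  qed
  have FW: "F y \<in> W" for y
    unfolding F_def using B(1) by (intro vec.subspace_sum[OF W] vec.subspace_scale[OF W]) auto
  have inj: "inj_on F W"
  proof (rule inj_onI)
    fix x y assume xy: "x \<in> W" "y \<in> W" "F x = F y"
    have d: "x - y \<in> W" using W xy by (simp add: vec.subspace_diff)
    have "F (x - y) = 0" using xy by (simp add: Fd)
    then have "\<not> (\<exists>w'\<in>W. T (x - y) w' \<noteq> 0)" using ker by blast
    then show "x = y" using nd[OF d] by auto
  qed
  have span: "vec.span W = W" using W by (simp add: vec.span_eq_iff)
  have "vec.dim (F ` W) = vec.dim W" using vec.dim_image_eq[OF lin] inj by (simp add: span)
  moreover have sF: "vec.subspace (F ` W)" using lin W vec.linear_subspace_image by blast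
  moreover have "F ` W \<subseteq> W" using FW by blast
  ultimately have "F ` W = W" using vec.subspace_dim_equal[OF sF W] by simp
  then obtain w where w: "w \<in> W" "F x = F w" using FW[of x] by blast
  have "F (x - w) = 0" using w by (simp add: Fd)
  then show ?thesis using ker w(1) by blast
qed

end

locale cubic_div = cubic cr T e
  for cr :: "'a::field ^ 'n \<Rightarrow> 'a ^ 'n \<Rightarrow> 'a ^ 'n"  (infixl "\<bowtie>" 75)
    and T :: "'a ^ 'n \<Rightarrow> 'a ^ 'n \<Rightarrow> 'a" and e :: "'a ^ 'n" +
  assumes inf: "infinite (UNIV :: 'a set)" and aniso: "Nm x = 0 \<Longrightarrow> x = 0"
begin

definition scal :: "('a ^ 'n) set" where "scal = range (\<lambda>c. c *s e)"

lemma scalI: "c *s e \<in> scal" by (auto simp: scal_def)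

lemma charpoly_no_root: "m \<notin> scal \<Longrightarrow> c^3 - c^2 * T m e + c * T (sh m) e - Nm m \<noteq> 0"
  using aniso[of "c *s e - m"] charpoly[of c m] scalI[of c] by auto

lemma scal_independent:
  assumes m: "m \<notin> scal" and z: "\<alpha> *s e + \<beta> *s m = 0" shows "\<alpha> = 0 \<and> \<beta> = 0"
proof -
  have "\<beta> = 0"
  proof (rule ccontr)
    assume b: "\<beta> \<noteq> 0"
    have "\<beta> *s m = \<beta> *s ((- (inverse \<beta> * \<alpha>)) *s e)"
      using z b by (simp add: eq_neg_iff_add_eq_0 add.commute mult.assoc[symmetric])
    then have "m = (- (inverse \<beta> * \<alpha>)) *s e" by (rule scale_cancel[OF b])
    then show False using m scalI by metis
  qed
  then show ?thesis using z unit_nonzero by simp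
qed

text \<open>If m# = x e + y m, then m## = N(m) m makes y or - y a root of the generic polynomial of
  m, against anisotropy.\<close>

lemma field_independent:
  assumes m: "m \<notin> scal" and z: "\<alpha> *s e + \<beta> *s m + \<gamma> *s sh m = 0"
  shows "\<alpha> = 0 \<and> \<beta> = 0 \<and> \<gamma> = 0"
proof -
  have "\<gamma> = 0"
  proof (rule ccontr)
    assume g: "\<gamma> \<noteq> 0"
    define x y where "x = - (inverse \<gamma> * \<alpha>)" "y = - (inverse \<gamma> * \<beta>)"
    have "\<gamma> *s sh m = (\<alpha> *s e + \<beta> *s m + \<gamma> *s sh m) - \<alpha> *s e - \<beta> *s m" by simp
    also have "\<dots> = \<gamma> *s (x *s e + y *s m)"
      unfolding z using g by (simp add: x_y_def vec_eq_iff distrib_left mult.assoc[symmetric])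
    finally have "\<gamma> *s sh m = \<gamma> *s (x *s e + y *s m)" .
    then have s: "sh m = x *s e + y *s m" by (rule scale_cancel[OF g])
    have S: "T (sh m) e = 3 * x + y * T m e" unfolding s by (simp add: bilin T_unit)
    have "sh (sh m) = (x^2 + x * y * T m e + y^2 * x) *s e + (y^3 - x * y) *s m"
    proof -
      have "sh (sh m) = sh (x *s e + y *s m)" by (simp only: s)
      also have "\<dots> = x^2 *s e + (x * y) *s (T m e *s e - m) + y^2 *s sh m"
        by (simp add: sh_add sh_scale bilin X_unit vec_eq_iff algebra_simps)
      also have "\<dots> = (x^2 + x * y * T m e + y^2 * x) *s e + (y^3 - x * y) *s m"
        unfolding s by (simp add: vec_eq_iff algebra_simps power2_eq_square power3_eq_cube)
      finally show ?thesis .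
    qed
    then have "(x^2 + x * y * T m e + y^2 * x) *s e + (y^3 - x * y - Nm m) *s m = 0"
      unfolding sh_sh by (simp add: vec_eq_iff algebra_simps)
    then have c: "x^2 + x * y * T m e + y^2 * x = 0" "Nm m = y^3 - x * y"
      using scal_independent[OF m] by (fastforce simp: algebra_simps)+
    have "x * (x + y * T m e + y^2) = 0" using c(1) by (simp add: algebra_simps power2_eq_square)
    then consider "x = 0" | "x + y * T m e + y^2 = 0" by auto
    then show False
    proof cases
      case 1
      then show False using charpoly_no_root[OF m, of y] unfolding S c(2)
        by (simp add: algebra_simps power2_eq_square power3_eq_cube)
    next
      case 2
      have "x = (x + y * T m e + y^2) - y * T m e - y^2" by simp
      then have x: "x = - y * T m e - y^2" unfolding 2 by simp
      show False using charpoly_no_root[OF m, of "- y"] unfolding S c(2) x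
        by (simp add: algebra_simps power2_eq_square power3_eq_cube)
    qed
  qed
  then show ?thesis using z scal_independent[OF m, of \<alpha> \<beta>] by simp
qed

text \<open>The field L of the overview, presented by a generator m outside \<open>scal\<close>.
  Below, \<open>vert m\<close> is V and \<open>prL m\<close> is the projection to L along V.\<close>

definition gen :: "'a ^ 'n \<Rightarrow> ('a ^ 'n) set" where
  "gen m = {\<alpha> *s e + \<beta> *s m + \<gamma> *s sh m | \<alpha> \<beta> \<gamma>. True}"

lemma genI: "\<alpha> *s e + \<beta> *s m + \<gamma> *s sh m \<in> gen m"
  by (auto simp: gen_def)

lemma subspace_gen: "vec.subspace (gen m)"
  unfolding vec.subspace_def
proof (intro conjI ballI allI)
  show "0 \<in> gen m" using genI[of 0 0 m 0] by simp
  fix x y and c :: 'a assume "x \<in> gen m"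
  then obtain a b d where x: "x = a *s e + b *s m + d *s sh m" by (auto simp: gen_def)
  show "c *s x \<in> gen m" using genI[of "c*a" "c*b" m "c*d"] by (simp add: x vec.scale_right_distrib)
  assume "y \<in> gen m"
  then obtain a' b' d' where y: "y = a' *s e + b' *s m + d' *s sh m" by (auto simp: gen_def)
  show "x + y \<in> gen m" using genI[of "a+a'" "b+b'" m "d+d'"]
    by (simp add: x y vec.scale_left_distrib algebra_simps)
qed

lemma gen_unit: "e \<in> gen m" and gen_self: "m \<in> gen m" and gen_sh_self: "sh m \<in> gen m"
  using genI[of 1 0 m 0] genI[of 0 1 m 0] genI[of 0 0 m 1] by simp_all

lemmas gen_add = vec.subspace_add[OF subspace_gen]
lemmas gen_scale = vec.subspace_scale[OF subspace_gen]
lemmas gen_diff = vec.subspace_diff[OF subspace_gen]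
lemmas gen_minus = vec.subspace_neg[OF subspace_gen]
lemmas gen_zero = vec.subspace_0[OF subspace_gen]
lemmas gen_intros = gen_add gen_scale gen_diff gen_minus gen_zero gen_unit gen_self gen_sh_self

lemma gen_X: assumes "x \<in> gen m" "y \<in> gen m" shows "x \<bowtie> y \<in> gen m"
proof -
  from assms obtain a b c a' b' c' where "x = a *s e + b *s m + c *s sh m" "y = a' *s e + b' *s m + c' *s sh m"
    by (auto simp: gen_def)
  then show ?thesis
    by (simp only: X_add X_add_right X_scale X_scale_right X_unit X_unit_right X_self[of m] X_self[of "sh m"]
        X_sh_self X_commute[of "sh m" m] sh_sh) (intro gen_intros)
qed

lemma gen_sh: "x \<in> gen m \<Longrightarrow> sh x \<in> gen m"
  unfolding sh_def by (intro gen_intros gen_X)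

lemma gen_jp: "x \<in> gen m \<Longrightarrow> y \<in> gen m \<Longrightarrow> jp x y \<in> gen m"
  unfolding jp_def by (intro gen_intros gen_X)

definition vert :: "'a ^ 'n \<Rightarrow> ('a ^ 'n) set" where
  "vert m = {x. T x e = 0 \<and> T x m = 0 \<and> T x (sh m) = 0}"

lemma vert_gen: "x \<in> vert m \<Longrightarrow> l \<in> gen m \<Longrightarrow> T x l = 0"
  by (auto simp: vert_def gen_def bilin)

lemma vertI: "(\<And>l. l \<in> gen m \<Longrightarrow> T x l = 0) \<Longrightarrow> x \<in> vert m"
  using gen_unit gen_self gen_sh_self by (auto simp: vert_def)

lemma subspace_vert: "vec.subspace (vert m)"
  by (auto simp: vec.subspace_def vert_def bilin)

lemmas vert_add = vec.subspace_add[OF subspace_vert]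
lemmas vert_scale = vec.subspace_scale[OF subspace_vert]
lemmas vert_diff = vec.subspace_diff[OF subspace_vert]
lemmas vert_minus = vec.subspace_neg[OF subspace_vert]
lemmas vert_zero = vec.subspace_0[OF subspace_vert]
lemmas vert_intros = vert_add vert_scale vert_diff vert_minus vert_zero

lemma vert_X: "l \<in> gen m \<Longrightarrow> x \<in> vert m \<Longrightarrow> l \<bowtie> x \<in> vert m"
  by (rule vertI) (metis T_X X_commute gen_X vert_gen)

text \<open>T(x, x#) = 3 N(x): on every subspace closed under sharp the vector x# witnesses that the
  trace form is nondegenerate.\<close>

lemma T_sh_nonzero: "x \<noteq> 0 \<Longrightarrow> T x (sh x) \<noteq> 0"
  using aniso three by (auto simp: T_sh_self)

lemma gen_decomp: "\<exists>l\<in>gen m. x - l \<in> vert m"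
  using orth_decomp[OF subspace_gen, of m x] T_sh_nonzero gen_sh by (metis vertI)

lemma gen_vert: "x \<in> gen m \<Longrightarrow> x \<in> vert m \<Longrightarrow> x = 0"
  using T_sh_nonzero gen_sh vert_gen by metis

definition prL :: "'a ^ 'n \<Rightarrow> 'a ^ 'n \<Rightarrow> 'a ^ 'n" where
  "prL m x = (SOME l. l \<in> gen m \<and> x - l \<in> vert m)"

lemma prL: "prL m x \<in> gen m" "x - prL m x \<in> vert m"
  using someI_ex[of "\<lambda>l. l \<in> gen m \<and> x - l \<in> vert m"] gen_decomp[of m x] unfolding prL_def by blast+

lemma prL_eqI: assumes "l \<in> gen m" "x - l \<in> vert m" shows "prL m x = l"
proof -
  have "l - prL m x \<in> gen m" using assms prL by (intro gen_intros)
  moreover have "l - prL m x = (x - prL m x) - (x - l)" by simp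
  then have "l - prL m x \<in> vert m" using assms prL by (metis vert_diff)
  ultimately show ?thesis using gen_vert by force
qed

lemma prL_add: "prL m (x + y) = prL m x + prL m y"
proof (rule prL_eqI)
  show "prL m x + prL m y \<in> gen m" using prL by (intro gen_intros)
  have "x + y - (prL m x + prL m y) = (x - prL m x) + (y - prL m y)" by simp
  then show "x + y - (prL m x + prL m y) \<in> vert m" using prL by (metis vert_add)
qed

lemma prL_scale: "prL m (c *s x) = c *s prL m x"
proof (rule prL_eqI)
  show "c *s prL m x \<in> gen m" using prL by (intro gen_intros)
  have "c *s x - c *s prL m x = c *s (x - prL m x)" by (simp add: vec.scale_right_diff_distrib)
  then show "c *s x - c *s prL m x \<in> vert m" using prL by (metis vert_scale)
qed

lemma prL_gen: "l \<in> gen m \<Longrightarrow> prL m l = l"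
  by (rule prL_eqI) (simp_all add: vert_zero)

lemma prL_vert: "x \<in> vert m \<Longrightarrow> prL m x = 0"
  by (rule prL_eqI) (simp_all add: gen_zero)

lemma prL_minus: "prL m (- x) = - prL m x"
  using prL_scale[of m "-1" x] by simp

lemma prL_diff: "prL m (x - y) = prL m x - prL m y"
  using prL_add[of m x "- y"] by (simp add: prL_minus)

end

section \<open>Coordinates on L and V over an algebraically closed field\<close>

locale split_cubic = cubic_div cr T e + E: cubic crE TE eE
  for cr :: "'a::field ^ 'n \<Rightarrow> 'a ^ 'n \<Rightarrow> 'a ^ 'n"  (infixl "\<bowtie>" 75)
    and T :: "'a ^ 'n \<Rightarrow> 'a ^ 'n \<Rightarrow> 'a" and e :: "'a ^ 'n"
    and crE :: "'b::alg_closed_field ^ 'n \<Rightarrow> 'b ^ 'n \<Rightarrow> 'b ^ 'n"  (infixl "\<otimes>\<^sub>E" 75)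
    and TE :: "'b ^ 'n \<Rightarrow> 'b ^ 'n \<Rightarrow> 'b" and eE :: "'b ^ 'n" +
  fixes io :: "'a \<Rightarrow> 'b"
  assumes io_add: "io (x + y) = io x + io y" and io_mult: "io (x * y) = io x * io y"
    and io_one: "io 1 = 1"
    and em_X': "(\<chi> i. io (u $ i)) \<otimes>\<^sub>E (\<chi> i. io (v $ i)) = (\<chi> i. io ((u \<bowtie> v) $ i))"
    and em_T': "TE (\<chi> i. io (u $ i)) (\<chi> i. io (v $ i)) = io (T u v)"
    and em_unit': "(\<chi> i. io (e $ i)) = eE"
begin

lemma io_zero [simp]: "io 0 = 0"
  by (metis io_add add_cancel_left_left add_0)

lemma io_minus: "io (- x) = - io x"
  using io_add[of x "- x"] by (simp add: eq_neg_iff_add_eq_0 add.commute)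

lemma io_diff: "io (x - y) = io x - io y"
  using io_add[of x "- y"] by (simp add: io_minus)

lemma io_eq_0 [simp]: "io x = 0 \<longleftrightarrow> x = 0"
proof
  assume z: "io x = 0"
  show "x = 0"
  proof (rule ccontr)
    assume "x \<noteq> 0"
    then have "io x * io (inverse x) = 1" by (simp add: io_mult[symmetric] io_one)
    then show False using z by simp
  qed
qed simp

lemma io_eq: "io x = io y \<longleftrightarrow> x = y"
  using io_eq_0[of "x - y"] by (simp add: io_diff)

lemma io_inverse: "io (inverse x) = inverse (io x)"
proof (cases "x = 0")
  case False
  then have "io x * io (inverse x) = 1" by (simp add: io_mult[symmetric] io_one)
  then show ?thesis by (simp add: inverse_unique)
qed simp

lemma io_divide: "io (x / y) = io x / io y"
  by (simp add: divide_inverse io_mult io_inverse)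

lemma io_power: "io (x ^ n) = io x ^ n"
  by (induction n) (simp_all add: io_one io_mult)

lemma io_numeral: "io (numeral n) = numeral n"
proof -
  have "io (of_nat k) = of_nat k" for k by (induction k) (simp_all add: io_add io_one)
  then show ?thesis by (metis of_nat_numeral)
qed

lemma infE: "infinite (UNIV :: 'b set)"
proof
  assume "finite (UNIV :: 'b set)"
  then have "finite (io ` (UNIV :: 'a set))" by (rule finite_subset[OF subset_UNIV])
  moreover have "inj_on io UNIV" by (rule inj_onI) (simp add: io_eq)
  ultimately have "finite (UNIV :: 'a set)" by (rule finite_imageD)
  then show False using inf by simp
qed

definition em :: "'a ^ 'n \<Rightarrow> 'b ^ 'n" where "em x = (\<chi> i. io (x $ i))"

lemma em_X: "em (x \<bowtie> y) = em x \<otimes>\<^sub>E em y" by (simp add: em_def em_X')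
lemma em_T: "TE (em x) (em y) = io (T x y)" by (simp add: em_def em_T')
lemma em_unit: "em e = eE" by (simp add: em_def em_unit')
lemma em_add: "em (x + y) = em x + em y" by (simp add: em_def vec_eq_iff io_add)
lemma em_scale: "em (c *s x) = io c *s em x" by (simp add: em_def vec_eq_iff io_mult)
lemma em_minus: "em (- x) = - em x" by (simp add: em_def vec_eq_iff io_minus)
lemma em_diff: "em (x - y) = em x - em y" by (simp add: em_def vec_eq_iff io_diff)
lemma em_zero [simp]: "em 0 = 0" by (simp add: em_def vec_eq_iff)
lemma em_eq: "em x = em y \<longleftrightarrow> x = y" by (simp add: em_def vec_eq_iff io_eq)
lemma em_eq_0: "em x = 0 \<longleftrightarrow> x = 0" using em_eq[of x 0] by simp

lemma em_sh: "em (sh x) = E.sh (em x)"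
  by (simp add: sh_def E.sh_def em_scale em_X io_divide io_one io_numeral)

lemma em_Nm: "E.Nm (em x) = io (Nm x)"
proof -
  have "3 * E.Nm (em x) = 3 * io (Nm x)"
    using T_sh_self(1)[of x] by (simp add: E.T_sh_self(1)[symmetric] em_sh[symmetric] em_T io_mult io_numeral)
  then show ?thesis by (rule E.mult_cancel[OF E.three])
qed

definition coe :: "'b ^ 'n \<Rightarrow> 'a ^ 'n \<Rightarrow> 'b" where "coe a l = TE (em l) a"

definition cmp :: "'b ^ 'n \<Rightarrow> 'a ^ 'n \<Rightarrow> 'b ^ 'n" where "cmp a x = - (a \<otimes>\<^sub>E em x)"

lemma coe_lin: "coe a (x + y) = coe a x + coe a y" "coe a (k *s x) = io k * coe a x"
  "coe a (- x) = - coe a x" "coe a (x - y) = coe a x - coe a y"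
  by (simp_all add: coe_def em_add em_scale em_minus em_diff E.bilin)

lemma cmp_lin: "cmp a (x + y) = cmp a x + cmp a y" "cmp a (k *s x) = io k *s cmp a x"
  "cmp a (- x) = - cmp a x" "cmp a (x - y) = cmp a x - cmp a y" "cmp a 0 = 0"
  by (simp_all add: cmp_def em_add em_scale em_minus em_diff E.bilin)

lemma frame_exists:
  assumes m: "m \<notin> scal"
  obtains a b c p q r where "E.frm a b c" "em m = p *s a + q *s b + r *s c" "p \<noteq> q" "q \<noteq> r" "r \<noteq> p"
    "\<exists>k k' k''. a = k *s em e + k' *s em m + k'' *s em (sh m)"
    "\<exists>k k' k''. b = k *s em e + k' *s em m + k'' *s em (sh m)"
    "\<exists>k k' k''. c = k *s em e + k' *s em m + k'' *s em (sh m)"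
proof -
  obtain p q r where s: "io (T m e) = p + q + r" "io (T (sh m) e) = p * q + q * r + r * p" "io (Nm m) = p * q * r"
    using alg_closed_cubic by metis
  have noroot: "x \<noteq> io c" if "x^3 - x^2 * io (T m e) + x * io (T (sh m) e) - io (Nm m) = 0" for x c
  proof
    assume "x = io c"
    then have "io (c^3 - c^2 * T m e + c * T (sh m) e - Nm m) = 0"
      using that by (simp add: io_add io_diff io_mult io_power)
    then show False using charpoly_no_root[OF m] by simp
  qed
  \<comment> \<open>Separability by hand. Let t, s, n be the coefficients T(m), T(m#), N(m). A
    triple root equals t / 3, and a double root that is not triple equals (s t - 9 n) / (2 (t^2 - 3
    s)). Both lie in K, but the polynomial has no root there.\<close>
  have dist: "x \<noteq> y" if s: "io (T m e) = x + y + z" "io (T (sh m) e) = x * y + y * z + z * x" "io (Nm m) = x * y * z" for x y z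
  proof
    assume xy: "x = y"
    have root: "x^3 - x^2 * io (T m e) + x * io (T (sh m) e) - io (Nm m) = 0"
      unfolding s by (simp add: algebra_simps power2_eq_square power3_eq_cube)
    let ?d = "T m e ^ 2 - 3 * T (sh m) e"
    have d: "io ?d = (x - z)^2"
      by (simp add: io_diff io_mult io_power io_numeral s xy algebra_simps power2_eq_square)
    show False
    proof (cases "x = z")
      case True
      then have "x * 3 = io (T m e)" using s xy by simp
      then have "x = io (T m e / 3)"
        using E.three by (simp add: io_divide io_numeral eq_divide_eq)
      then show False using noroot[OF root] by blast
    next
      case False
      then have nz: "io ?d \<noteq> 0" unfolding d by simp
      have "io (T (sh m) e * T m e - 9 * Nm m) = 2 * x * (x - z)^2"
        by (simp add: io_diff io_mult io_numeral s xy algebra_simps power2_eq_square)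
      then have "x * io (2 * ?d) = io (T (sh m) e * T m e - 9 * Nm m)"
        by (simp only: io_mult[of 2] d io_numeral) (simp only: mult.left_commute mult.assoc)
      moreover have "io (2 * ?d) \<noteq> 0" unfolding io_mult[of 2] io_numeral using nz E.two by simp
      ultimately have "x = io ((T (sh m) e * T m e - 9 * Nm m) / (2 * ?d))"
        unfolding io_divide by (simp only: eq_divide_eq if_True simp_thms if_False)
      then show False using noroot[OF root] by blast
    qed
  qed
  have sE: "TE (em m) eE = p + q + r" "TE (E.sh (em m)) eE = p * q + q * r + r * p" "E.Nm (em m) = p * q * r"
    using s by (simp_all add: em_unit[symmetric] em_sh[symmetric] em_T em_Nm)
  have d: "p \<noteq> q" "q \<noteq> r" "r \<noteq> p"
    using dist[of p q r] dist[of q r p] dist[of r p q] s by (simp_all add: ac_simps)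
  obtain a b c where f: "E.frm a b c" "em m = p *s a + q *s b + r *s c"
    and abc: "a = inverse ((q - p) * (r - p)) *s (E.sh (em m) + p *s em m - (p * (q + r)) *s eE)"
    "b = inverse ((r - q) * (p - q)) *s (E.sh (em m) + q *s em m - (q * (r + p)) *s eE)"
    "c = inverse ((p - r) * (q - r)) *s (E.sh (em m) + r *s em m - (r * (p + q)) *s eE)"
    using E.frame_of_element[OF sE d] by metis
  have sp: "\<exists>k k' k''. x *s (E.sh (em m) + y *s em m - z *s eE) = k *s em e + k' *s em m + k'' *s em (sh m)" for x y z
    by (rule exI[of _ "- (x * z)"], rule exI[of _ "x * y"], rule exI[of _ x])
       (simp add: em_unit em_sh vec_eq_iff algebra_simps)
  show thesis by (rule that[OF f d]) (use abc sp in blast)+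
qed

end

text \<open>The setting is invariant under the cyclic shift of (a, p), (b, q), (c, r). With
  \<open>rotate\<close> a fact about the a-component gives those about the b- and
  c-components.\<close>

locale split_field = split_cubic +
  fixes m a b c p q r
  assumes m: "m \<notin> scal" and f: "E.frm a b c" and em_m: "em m = p *s a + q *s b + r *s c"
    and pq: "p \<noteq> q" and qr: "q \<noteq> r" and rp: "r \<noteq> p"
    and spa: "\<exists>k k' k''. a = k *s em e + k' *s em m + k'' *s em (sh m)"
    and spb: "\<exists>k k' k''. b = k *s em e + k' *s em m + k'' *s em (sh m)"
    and spc: "\<exists>k k' k''. c = k *s em e + k' *s em m + k'' *s em (sh m)"
begin

lemma rotate: "split_field cr T e crE TE eE io m b c a q r p"
  by unfold_locales (use m f em_m pq qr rp spa spb spc E.frm_rotate in \<open>simp_all add: algebra_simps\<close>)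

lemma fb: "E.frm b c a" and fc: "E.frm c a b"
  using E.frm_rotate f by blast+

lemma coe_unit: "coe a e = 1"
  unfolding coe_def em_unit E.frm_sum[OF f] by (simp add: E.bilin E.frmD[OF f])

lemma coe_m: "coe a m = p"
  unfolding coe_def em_m by (simp add: E.bilin E.frmD[OF f])

lemma em_sh_m: "em (sh m) = (q * r) *s a + (r * p) *s b + (p * q) *s c"
  unfolding em_sh em_m
  by (simp add: E.sh_add E.bilin E.sh_scale E.sh_peirce_unit[OF f] E.sh_peirce_unit[OF fb] E.sh_peirce_unit[OF fc]
      E.frmD[OF f] ac_simps)

lemma em_gen: "l \<in> gen m \<Longrightarrow> em l = coe a l *s a + coe b l *s b + coe c l *s c"
proof -
  assume "l \<in> gen m"
  then obtain x y z where l: "l = x *s e + y *s m + z *s sh m" by (auto simp: gen_def)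
  have "em l = io x *s (a + b + c) + io y *s (p *s a + q *s b + r *s c)
      + io z *s ((q * r) *s a + (r * p) *s b + (p * q) *s c)"
    unfolding l em_add em_scale em_unit E.frm_sum[OF f, symmetric] em_m[symmetric] em_sh_m[symmetric] ..
  then have uvw: "em l = (io x + io y * p + io z * (q * r)) *s a + (io x + io y * q + io z * (r * p)) *s b
      + (io x + io y * r + io z * (p * q)) *s c"
    by (simp add: vec_eq_iff algebra_simps)
  show ?thesis unfolding coe_def unfolding uvw by (simp add: E.bilin E.frmD[OF f])
qed

lemma coe_inj: "l \<in> gen m \<Longrightarrow> coe a l = 0 \<Longrightarrow> l = 0"
proof -
  assume l: "l \<in> gen m" "coe a l = 0"
  have "em l = 0 *s a + coe b l *s b + coe c l *s c + (0 + 0 + 0)" using em_gen[OF l(1)] l(2) by simp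
  then have "E.Nm (em l) = 0"
    using E.Nm_frame[OF f E.peirce_zero E.peirce_zero E.peirce_zero, of 0 "coe b l" "coe c l"] by (simp add: E.nrm_def)
  then show "l = 0" using aniso by (simp add: em_Nm)
qed

lemma coe_eqI: "l \<in> gen m \<Longrightarrow> k \<in> gen m \<Longrightarrow> coe a l = coe a k \<Longrightarrow> l = k"
  using coe_inj[of "l - k"] gen_diff[of l m k] by (simp add: coe_lin)

lemma io_Nm: "l \<in> gen m \<Longrightarrow> io (Nm l) = coe a l * coe b l * coe c l"
  using E.Nm_frame[OF f E.peirce_zero E.peirce_zero E.peirce_zero, of "coe a l" "coe b l" "coe c l"] em_gen[of l]
  by (simp add: em_Nm[symmetric] E.nrm_def)

lemma em_X_gen:
  "l \<in> gen m \<Longrightarrow> k \<in> gen m \<Longrightarrow> em (l \<bowtie> k) = (coe b l * coe c k + coe c l * coe b k) *s a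
     + (coe c l * coe a k + coe a l * coe c k) *s b + (coe a l * coe b k + coe b l * coe a k) *s c"
  unfolding em_X by (simp only: em_gen E.X_add E.X_add_right E.X_scale E.X_scale_right E.frmD[OF f])
    (simp add: vec_eq_iff algebra_simps)

lemma coe_X: "l \<in> gen m \<Longrightarrow> k \<in> gen m \<Longrightarrow> coe a (l \<bowtie> k) = coe b l * coe c k + coe c l * coe b k"
  unfolding coe_def by (simp only: em_X_gen) (simp add: E.bilin E.frmD[OF f] coe_def)

lemma coe_sh: "l \<in> gen m \<Longrightarrow> coe a (sh l) = coe b l * coe c l"
  unfolding sh_def using E.two by (simp add: coe_lin coe_X io_divide io_one io_numeral)

lemma em_T_unit: "l \<in> gen m \<Longrightarrow> io (T l e) = coe a l + coe b l + coe c l"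
proof -
  assume l: "l \<in> gen m"
  have "io (T l e) = TE (em l) (a + b + c)" by (simp only: em_T[symmetric] em_unit E.frm_sum[OF f])
  then show ?thesis by (simp add: E.bilin coe_def)
qed

lemma coe_jp: "l \<in> gen m \<Longrightarrow> k \<in> gen m \<Longrightarrow> coe a (jp l k) = coe a l * coe a k"
proof -
  assume l: "l \<in> gen m" and k: "k \<in> gen m"
  have x: "io (T (l \<bowtie> k) e) = (coe b l * coe c k + coe c l * coe b k) + (coe c l * coe a k + coe a l * coe c k)
      + (coe a l * coe b k + coe b l * coe a k)"
    using em_T_unit[OF gen_X[OF l k]] unfolding coe_X[OF l k] 
      split_field.coe_X[OF rotate l k] split_field.coe_X[OF split_field.rotate[OF rotate] l k] .
  have "2 * coe a (jp l k) = 2 * (coe a l * coe a k)"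
    unfolding jp_def coe_lin io_inverse io_numeral coe_X[OF l k] coe_unit em_T_unit[OF l] em_T_unit[OF k] x
    using E.two by (simp add: algebra_simps)
  then show ?thesis by (rule E.mult_cancel[OF E.two])
qed

lemma TE_vert: "x \<in> vert m \<Longrightarrow> TE (em x) a = 0" 
proof -
  assume x: "x \<in> vert m"
  obtain k k' k'' where "a = k *s em e + k' *s em m + k'' *s em (sh m)" using spa by blast
  then show ?thesis using x by (simp add: E.bilin em_T vert_def)
qed

lemma peirce_cmp: "x \<in> vert m \<Longrightarrow> E.peirce a b c (cmp a x)"
  unfolding cmp_def
  using E.act_unit(1)[OF f, of "em x"] TE_vert split_field.TE_vert[OF rotate]
    split_field.TE_vert[OF split_field.rotate[OF rotate]] by blast

lemma em_vert: "x \<in> vert m \<Longrightarrow> em x = cmp a x + cmp b x + cmp c x"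
  unfolding cmp_def
  using E.act_unit(2)[OF f, of "em x"] TE_vert split_field.TE_vert[OF rotate]
    split_field.TE_vert[OF split_field.rotate[OF rotate]] by simp

lemma peirce_cmp_all: "x \<in> vert m \<Longrightarrow> E.peirce a b c (cmp a x)" "x \<in> vert m \<Longrightarrow> E.peirce b c a (cmp b x)"
   "x \<in> vert m \<Longrightarrow> E.peirce c a b (cmp c x)"
  using peirce_cmp split_field.peirce_cmp[OF rotate] split_field.peirce_cmp[OF split_field.rotate[OF rotate]] by blast+

lemma cmp_eqI: "x \<in> vert m \<Longrightarrow> y \<in> vert m \<Longrightarrow> cmp a x = cmp a y \<Longrightarrow> cmp b x = cmp b y \<Longrightarrow> cmp c x = cmp c y \<Longrightarrow> x = y"
  using em_vert em_eq by metis

lemma peirce_sum: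
  assumes "E.peirce a b c x" "E.peirce b c a y" "E.peirce c a b z" 
  shows "- (a \<otimes>\<^sub>E (x + y + z)) = x"
  using assms by (simp add: E.peirce_def E.bilin)

text \<open>Each idempotent acts as - 1 on its own Peirce component and as 0 on the other two, so l
  acts on the a-component by its a-coordinate.\<close>

lemma cmp_act:
  assumes l: "l \<in> gen m" and x: "x \<in> vert m" shows "cmp a (- (l \<bowtie> x)) = coe a l *s cmp a x"
proof -
  note pc = peirce_cmp_all[OF x]
  have "em (- (l \<bowtie> x)) = coe a l *s cmp a x + coe b l *s cmp b x + coe c l *s cmp c x"
    unfolding em_minus em_X em_gen[OF l] em_vert[OF x] using pc
    by (simp add: E.bilin E.peirce_def)
  then show ?thesis unfolding cmp_def[of a "- (l \<bowtie> x)"] using peirce_sum pc E.peirce_scale by metis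
qed

lemma em_X_vert:
  assumes x: "x \<in> vert m" and y: "y \<in> vert m"
  shows "em (x \<bowtie> y) = - (TE (cmp a x) (cmp a y) *s a) - TE (cmp b x) (cmp b y) *s b - TE (cmp c x) (cmp c y) *s c
     + (cmp b x \<otimes>\<^sub>E cmp c y + cmp c x \<otimes>\<^sub>E cmp b y)
     + (cmp c x \<otimes>\<^sub>E cmp a y + cmp a x \<otimes>\<^sub>E cmp c y)
     + (cmp a x \<otimes>\<^sub>E cmp b y + cmp b x \<otimes>\<^sub>E cmp a y)"
  unfolding em_X em_vert[OF x] em_vert[OF y]
  by (simp add: E.X_add E.X_add_right E.X_peirce_same[OF f peirce_cmp_all(1)[OF x] peirce_cmp_all(1)[OF y]]
      E.X_peirce_same[OF fb peirce_cmp_all(2)[OF x] peirce_cmp_all(2)[OF y]]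
      E.X_peirce_same[OF fc peirce_cmp_all(3)[OF x] peirce_cmp_all(3)[OF y]])

lemma peirce_cross:
  assumes x: "x \<in> vert m" and y: "y \<in> vert m"
  shows "E.peirce a b c (cmp b x \<otimes>\<^sub>E cmp c y + cmp c x \<otimes>\<^sub>E cmp b y)"
  using E.peirce_X[OF fb peirce_cmp_all(2)[OF x] peirce_cmp_all(3)[OF y]]
   E.peirce_X[OF fb peirce_cmp_all(2)[OF y] peirce_cmp_all(3)[OF x]]
  by (simp add: E.X_commute[of "cmp c x"] E.peirce_add)

text \<open>In \<open>em_X_vert\<close> the mixed products lie in Peirce spaces, which are
  orthogonal to the frame; only the multiples of a are seen by the a-coordinate. So the L-part of x
  \<bowtie> y is minus the polar form of Q.\<close>

lemma coe_prL_X: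
  assumes x: "x \<in> vert m" and y: "y \<in> vert m"
  shows "coe a (prL m (x \<bowtie> y)) = - TE (cmp a x) (cmp a y)"
proof -
  have "coe a (x \<bowtie> y - prL m (x \<bowtie> y)) = 0" unfolding coe_def using TE_vert prL by blast
  then have "coe a (prL m (x \<bowtie> y)) = TE (em (x \<bowtie> y)) a" by (simp add: coe_lin coe_def[symmetric])
  also have "\<dots> = - TE (cmp a x) (cmp a y)"
    unfolding em_X_vert[OF x y]
    using peirce_cross[OF x y] split_field.peirce_cross[OF rotate x y]
      split_field.peirce_cross[OF split_field.rotate[OF rotate] x y]
    by (simp only: E.T_add E.T_diff E.peirce_def) (simp add: E.bilin E.frmD[OF f])
  finally show ?thesis .
qed

lemma cmp_vX:
  assumes x: "x \<in> vert m" and y: "y \<in> vert m"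
  shows "cmp a (x \<bowtie> y - prL m (x \<bowtie> y)) = cmp b x \<otimes>\<^sub>E cmp c y + cmp c x \<otimes>\<^sub>E cmp b y"
proof -
  have "em (prL m (x \<bowtie> y)) = - (TE (cmp a x) (cmp a y) *s a) - TE (cmp b x) (cmp b y) *s b - TE (cmp c x) (cmp c y) *s c"
    using em_gen[OF prL(1)[of m "x \<bowtie> y"]] unfolding coe_prL_X[OF x y] split_field.coe_prL_X[OF rotate x y]
      split_field.coe_prL_X[OF split_field.rotate[OF rotate] x y] by simp
  then have "em (x \<bowtie> y - prL m (x \<bowtie> y)) = (cmp b x \<otimes>\<^sub>E cmp c y + cmp c x \<otimes>\<^sub>E cmp b y)
     + (cmp c x \<otimes>\<^sub>E cmp a y + cmp a x \<otimes>\<^sub>E cmp c y)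
     + (cmp a x \<otimes>\<^sub>E cmp b y + cmp b x \<otimes>\<^sub>E cmp a y)"
    unfolding em_diff em_X_vert[OF x y] by simp
  then show ?thesis unfolding cmp_def[of a "x \<bowtie> y - prL m (x \<bowtie> y)"]
    using peirce_sum[OF peirce_cross[OF x y] split_field.peirce_cross[OF rotate x y]
      split_field.peirce_cross[OF split_field.rotate[OF rotate] x y]] by simp
qed

end

context cubic_div
begin

definition act :: "'a ^ 'n \<Rightarrow> 'a ^ 'n \<Rightarrow> 'a ^ 'n" where "act l x = - (l \<bowtie> x)"

definition invL :: "'a ^ 'n \<Rightarrow> 'a ^ 'n" where "invL l = inverse (Nm l) *s sh l"

lemma act_lin: "act l (x + y) = act l x + act l y" "act l (x - y) = act l x - act l y"
  "act l (k *s x) = k *s act l x" "act l (- x) = - act l x" "act l 0 = 0"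
  "act (l + l') x = act l x + act l' x" "act (l - l') x = act l x - act l' x"
  "act (k *s l) x = k *s act l x" "act (- l) x = - act l x" "act 0 x = 0"
  by (simp_all add: act_def bilin vec.scale_minus_right)

lemma act_vert: "l \<in> gen m \<Longrightarrow> x \<in> vert m \<Longrightarrow> act l x \<in> vert m"
  unfolding act_def by (intro vert_minus vert_X)

lemma invL_gen: "l \<in> gen m \<Longrightarrow> invL l \<in> gen m"
  unfolding invL_def by (intro gen_scale gen_sh)

definition vX :: "'a ^ 'n \<Rightarrow> 'a ^ 'n \<Rightarrow> 'a ^ 'n \<Rightarrow> 'a ^ 'n" where
  "vX m x y = x \<bowtie> y - prL m (x \<bowtie> y)"

lemma vX_vert: "vX m x y \<in> vert m"
  unfolding vX_def by (rule prL(2))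

lemma vX_lin: "vX m x (y + z) = vX m x y + vX m x z" "vX m x (k *s y) = k *s vX m x y"
  by (simp_all add: vX_def bilin prL_add prL_scale vec.scale_right_diff_distrib)

lemma jp_lin: "jp l (x + y) = jp l x + jp l y" "jp l (k *s x) = k *s jp l x"
  by (simp_all add: jp_def bilin vec_eq_iff algebra_simps)

lemma jp_commute: "jp x y = jp y x"
  by (simp add: jp_def X_commute[of y x] algebra_simps)

lemma jp_unit: "jp e x = x"
proof (rule scale_cancel[OF two])
  show "2 *s jp e x = 2 *s x"
    using two by (simp add: jp_def X_unit bilin T_unit vec_eq_iff algebra_simps)
qed

end

context split_field
begin

text \<open>No coordinate of a nonzero element of L vanishes, since the product of the coordinates
  is its norm. Thus \<open>invL\<close> is the inverse in L.\<close>

lemma coe_invL: assumes l: "l \<in> gen m" "l \<noteq> 0" shows "coe a (invL l) = inverse (coe a l)"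
proof -
  have n: "coe a l \<noteq> 0" "coe b l \<noteq> 0" "coe c l \<noteq> 0"
    using coe_inj split_field.coe_inj[OF rotate] split_field.coe_inj[OF split_field.rotate[OF rotate]] l by blast+
  show ?thesis unfolding invL_def coe_lin io_inverse io_Nm[OF l(1)] coe_sh[OF l(1)]
    using n by (simp add: field_simps)
qed

lemma cmp_act': "l \<in> gen m \<Longrightarrow> x \<in> vert m \<Longrightarrow> cmp a (act l x) = coe a l *s cmp a x"
  unfolding act_def by (rule cmp_act)

lemma cmp_vX': "x \<in> vert m \<Longrightarrow> y \<in> vert m \<Longrightarrow> cmp a (vX m x y) = cmp b x \<otimes>\<^sub>E cmp c y + cmp c x \<otimes>\<^sub>E cmp b y"
  unfolding vX_def by (rule cmp_vX)

end

section \<open>The curve attached to Q-orthogonal vectors v and w\<close>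

text \<open>The L-part of x \<bowtie> x is - 2 Q(x), so \<open>ratio\<close> says m = Q(w) / Q(v)
  without dividing.\<close>

locale curve_data = split_field +
  fixes v w
  assumes v: "v \<in> vert m" and w: "w \<in> vert m" and orth: "prL m (v \<bowtie> w) = 0"
    and ratio: "jp m (prL m (v \<bowtie> v)) = prL m (w \<bowtie> w)" and qv: "prL m (v \<bowtie> v) \<noteq> 0"
begin

lemma rotate_data: "curve_data cr T e crE TE eE io m b c a q r p v w"
  using rotate v w orth ratio qv by (simp add: curve_data_def curve_data_axioms_def)

lemma nrm_v: "E.nrm (cmp a v) = coe a ((- inverse 2) *s prL m (v \<bowtie> v))"
  unfolding coe_lin coe_prL_X[OF v v] E.nrm_def by (simp add: io_minus io_divide io_one io_numeral)

lemma plane_a: "E.plane (E.nrm (cmp a v)) p (cmp a v) (cmp a w)"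
proof -
  have 1: "TE (cmp a v) (cmp a w) = 0" using coe_prL_X[OF v w] by (simp add: orth coe_def)
  have "TE (cmp a w) (cmp a w) = p * TE (cmp a v) (cmp a v)"
    using coe_prL_X[OF w w] coe_prL_X[OF v v] ratio coe_jp[OF gen_self prL(1)] coe_m by (metis mult_minus_right neg_equal_iff_equal)
  then have 2: "E.nrm (cmp a w) = E.nrm (cmp a v) * p" by (simp add: E.nrm_def)
  have 3: "E.nrm (cmp a v) \<noteq> 0"
  proof
    assume "E.nrm (cmp a v) = 0"
    then have "(- inverse 2) *s prL m (v \<bowtie> v) = 0"
      using coe_inj[OF gen_scale[OF prL(1)]] nrm_v by metis
    then show False using qv two by simp
  qed
  show ?thesis unfolding E.plane_def using 1 2 3 by simp
qed

lemma p_nonzero: "p \<noteq> 0"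
proof
  assume "p = 0"
  then have "m = 0" using coe_inj[OF gen_self] coe_m by simp
  then show False using m scalI[of 0] by simp
qed

definition qinv where "qinv = invL ((- inverse 2) *s prL m (v \<bowtie> v))"

lemma qinv_gen: "qinv \<in> gen m"
  unfolding qinv_def by (intro invL_gen gen_scale prL(1))

lemma coe_qinv: "coe a qinv = inverse (E.nrm (cmp a v))"
  unfolding qinv_def nrm_v by (rule coe_invL[OF gen_scale[OF prL(1)]]) (use qv two in simp)

text \<open>The vector b(x, y) z / Q(v), with b the polar form of Q and division in L: the
  correction term of a reflection, made linear in each argument.\<close>

definition R3 where
  "R3 x y z = act qinv (act (- prL m (x \<bowtie> y)) z)"

lemma R3_vert: "z \<in> vert m \<Longrightarrow> R3 x y z \<in> vert m"
  unfolding R3_def by (intro act_vert qinv_gen gen_minus prL(1))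

lemma R3_lin: "R3 x (y + y') z = R3 x y z + R3 x y' z" "R3 x (k *s y) z = k *s R3 x y z"
  by (simp_all add: R3_def bilin prL_add prL_scale act_lin)

lemma cmp_R3: assumes "x \<in> vert m" "y \<in> vert m" "z \<in> vert m"
  shows "cmp a (R3 x y z) = (TE (cmp a x) (cmp a y) / E.nrm (cmp a v)) *s cmp a z"
proof -
  have g: "- prL m (x \<bowtie> y) \<in> gen m" by (intro gen_minus prL(1))
  show ?thesis unfolding R3_def cmp_act'[OF qinv_gen act_vert[OF g assms(3)]] cmp_act'[OF g assms(3)] coe_qinv
    by (simp add: coe_lin coe_prL_X[OF assms(1,2)] divide_inverse mult.commute)
qed

text \<open>\<open>Y0\<close> to \<open>Y4\<close> are the coefficients of t^0 to t^4 in the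
  reflection curve applied to y0 + t y1 + t^2 y2. They are written over K with the L-action, so that
  they hold for all three components at once (\<open>cmp_Y_curve\<close>).\<close>

definition "Y0 (y0) = y0 - R3 v y0 v"
definition "Y1 (y0) (y1) = y1 - R3 v y1 v - R3 w y0 v - R3 v y0 w"
definition "Y2 (y0) (y1) (y2)
   = y2 + act m y0 - R3 v y2 v - R3 w y1 v - R3 v y1 w - R3 w y0 w"
definition "Y3 (y1) (y2) = act m y1 - R3 w y2 v - R3 v y2 w - R3 w y1 w"
definition "Y4 (y2) = act m y2 - R3 w y2 w"

definition YY where
  "YY y0 y1 y2 t = Y0 y0 + t *s Y1 y0 y1 + t^2 *s Y2 y0 y1 y2 + t^3 *s Y3 y1 y2 + t^4 *s Y4 y2"

lemmas Y_defs = Y0_def Y1_def Y2_def Y3_def Y4_def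

lemma Y_vert:
  assumes "y0 \<in> vert m" "y1 \<in> vert m" "y2 \<in> vert m"
  shows "Y0 y0 \<in> vert m" "Y1 y0 y1 \<in> vert m" "Y2 y0 y1 y2 \<in> vert m" "Y3 y1 y2 \<in> vert m" "Y4 y2 \<in> vert m"
  unfolding Y_defs using assms v w by (simp_all add: vert_intros R3_vert act_vert gen_self)

lemma YY_vert: "y0 \<in> vert m \<Longrightarrow> y1 \<in> vert m \<Longrightarrow> y2 \<in> vert m \<Longrightarrow> YY y0 y1 y2 t \<in> vert m"
  unfolding YY_def by (intro vert_intros Y_vert)

lemma cmp_Y_curve:
  assumes y: "y0 \<in> vert m" "y1 \<in> vert m" "y2 \<in> vert m"
  shows "E.refl_curve (E.nrm (cmp a v)) p (cmp a v) (cmp a w) (\<lambda>t. cmp a y0 + t *s cmp a y1 + t^2 *s cmp a y2)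
    = (\<lambda>t. cmp a (Y0 y0) + t *s cmp a (Y1 y0 y1) + t^2 *s cmp a (Y2 y0 y1 y2) + t^3 *s cmp a (Y3 y1 y2) + t^4 *s cmp a (Y4 y2))"
proof
  fix t
  define k where "k = inverse (E.nrm (cmp a v))"
  have am: "cmp a (act m x) = p *s cmp a x" if "x \<in> vert m" for x
    using cmp_act'[OF gen_self that] by (simp add: coe_m)
  have R: "cmp a (R3 x x' z) = (TE (cmp a x) (cmp a x') * k) *s cmp a z"
    if "x \<in> vert m" "x' \<in> vert m" "z \<in> vert m" for x x' z
    using cmp_R3[OF that] by (simp add: k_def divide_inverse)
  show "E.refl_curve (E.nrm (cmp a v)) p (cmp a v) (cmp a w) (\<lambda>t. cmp a y0 + t *s cmp a y1 + t^2 *s cmp a y2) t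
    = cmp a (Y0 y0) + t *s cmp a (Y1 y0 y1) + t^2 *s cmp a (Y2 y0 y1 y2) + t^3 *s cmp a (Y3 y1 y2) + t^4 *s cmp a (Y4 y2)"
    unfolding E.refl_curve_def Y_defs divide_inverse k_def[symmetric] using y v w
    by (simp add: cmp_lin am R E.bilin) (simp add: vec_eq_iff algebra_simps eval_nat_numeral)
qed

text \<open>The odd part condition of \<open>divides_alongI\<close> with m^k inserted in the first
  factor. Its a-component is q^k F + r^k G, where F and G are the conditions for the pairs (b, c)
  and (c, b). As q \<noteq> r, the two cases k = 0 and k = 1 together express both conditions by
  equations over K.\<close>

definition EQ where
  "EQ k y0 y1 y2 = vX m ((act m ^^ (k+2)) v) (Y1 y0 y1) + vX m ((act m ^^ (k+2)) w) (Y0 y0)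
     - vX m ((act m ^^ (k+1)) v) (Y3 y1 y2) - vX m ((act m ^^ (k+1)) w) (Y2 y0 y1 y2) + vX m ((act m ^^ k) w) (Y4 y2)"

definition sol where
  "sol y0 y1 y2 \<longleftrightarrow> y0 \<in> vert m \<and> y1 \<in> vert m \<and> y2 \<in> vert m \<and> EQ 0 y0 y1 y2 = 0 \<and> EQ 1 y0 y1 y2 = 0"

lemma powm_vert: "x \<in> vert m \<Longrightarrow> (act m ^^ k) x \<in> vert m"
  by (induction k) (simp_all add: act_vert gen_self)

lemma cmp_powm: "x \<in> vert m \<Longrightarrow> cmp a ((act m ^^ k) x) = p ^ k *s cmp a x"
  by (induction k) (simp_all add: cmp_act' gen_self powm_vert coe_m)

lemma sol_divides:
  assumes s: "sol y0 y1 y2"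
  defines "C d \<equiv> (\<lambda>t. cmp d (Y0 y0) + t *s cmp d (Y1 y0 y1) + t^2 *s cmp d (Y2 y0 y1 y2)
      + t^3 *s cmp d (Y3 y1 y2) + t^4 *s cmp d (Y4 y2))"
  shows "E.divides_along a b c q (cmp b v) (cmp b w) (C c)" "E.divides_along a b c r (cmp c v) (cmp c w) (C b)"
proof -
  interpret B: curve_data cr T e crE TE eE io m b c a q r p v w by (rule rotate_data)
  interpret C: curve_data cr T e crE TE eE io m c a b r p q v w by (rule B.rotate_data)
  have y: "y0 \<in> vert m" "y1 \<in> vert m" "y2 \<in> vert m" using s by (simp_all add: sol_def)
  note Y = Y_vert[OF y]
  define F where "F x vv ww d = x^2 *s (vv \<otimes>\<^sub>E cmp d (Y1 y0 y1) + ww \<otimes>\<^sub>E cmp d (Y0 y0))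
     - x *s (vv \<otimes>\<^sub>E cmp d (Y3 y1 y2) + ww \<otimes>\<^sub>E cmp d (Y2 y0 y1 y2)) + ww \<otimes>\<^sub>E cmp d (Y4 y2)" for x vv ww d
  let ?F = "F q (cmp b v) (cmp b w) c" and ?G = "F r (cmp c v) (cmp c w) b"
  have eq: "cmp a (EQ k y0 y1 y2) = q^k *s ?F + r^k *s ?G" for k
    unfolding EQ_def F_def cmp_lin
    by (simp add: cmp_vX'[OF powm_vert[OF v]] cmp_vX'[OF powm_vert[OF w]] cmp_vX'[OF act_vert[OF gen_self powm_vert[OF v]]]
        cmp_vX'[OF act_vert[OF gen_self powm_vert[OF w]]] Y B.cmp_powm[OF v] B.cmp_powm[OF w] C.cmp_powm[OF v] C.cmp_powm[OF w]
        cmp_vX'[OF act_vert[OF gen_self act_vert[OF gen_self powm_vert[OF v]]]] 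
        cmp_vX'[OF act_vert[OF gen_self act_vert[OF gen_self powm_vert[OF w]]]]
        B.cmp_act'[OF gen_self act_vert[OF gen_self powm_vert[OF v]]] B.cmp_act'[OF gen_self act_vert[OF gen_self powm_vert[OF w]]]
        B.cmp_act'[OF gen_self powm_vert[OF v]] B.cmp_act'[OF gen_self powm_vert[OF w]]
        C.cmp_act'[OF gen_self act_vert[OF gen_self powm_vert[OF v]]] C.cmp_act'[OF gen_self act_vert[OF gen_self powm_vert[OF w]]]
        C.cmp_act'[OF gen_self powm_vert[OF v]] C.cmp_act'[OF gen_self powm_vert[OF w]] B.coe_m C.coe_m E.bilin)
       (simp add: vec_eq_iff algebra_simps power2_eq_square)
  have e0: "?F + ?G = 0" using eq[of 0] s by (simp add: sol_def cmp_lin)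
  have e1: "q *s ?F + r *s ?G = 0" using eq[of 1] s by (simp add: sol_def cmp_lin)
  have G: "?G = - ?F" using e0 by (simp add: add_eq_0_iff)
  have "(q - r) *s ?F = 0" using e1 unfolding G by (simp add: vec.scale_left_diff_distrib)
  then have F0: "?F = 0" using qr by simp
  then have G0: "?G = 0" using G by simp
  note pv = peirce_cmp_all
  show "E.divides_along a b c q (cmp b v) (cmp b w) (C c)"
    unfolding C_def using F0 unfolding F_def
    by (intro E.divides_alongI[OF f B.plane_a B.p_nonzero pv(2)[OF v] pv(2)[OF w]] pv(3) Y)
  have "E.divides_along a c b r (cmp c v) (cmp c w) (C b)"
    unfolding C_def using G0 unfolding F_def
    by (intro E.divides_alongI[OF E.frm_flip[OF f] C.plane_a C.p_nonzero] E.peirce_swap[OF pv(3)[OF v]]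
        E.peirce_swap[OF pv(3)[OF w]] E.peirce_swap[OF pv(2)] Y)
  then show "E.divides_along a b c r (cmp c v) (cmp c w) (C b)"
    unfolding E.divides_along_def using E.peirce_swap by blast
qed

definition gt where "gt t = e + t^2 *s m"

lemma gt_gen: "gt t \<in> gen m"
  unfolding gt_def by (intro gen_intros)

lemma gt_nonzero: "gt t \<noteq> 0"
  using scal_independent[OF m, of 1 "t^2"] by (auto simp: gt_def)

lemma coe_gt: "coe a (gt t) = 1 + p * (io t)^2"
  by (simp add: gt_def coe_lin coe_unit coe_m io_power mult.commute)

lemma coe_gt_nonzero: "1 + p * (io t)^2 \<noteq> 0"
  using coe_inj[OF gt_gen] gt_nonzero coe_gt by metis

text \<open>\<open>frame_similarity\<close> at the image of t, pulled back along the injective map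
  \<open>io\<close>. The six divisibility conditions are \<open>sol_divides\<close> and its
  rotations.\<close>

lemma norm_sim:
  assumes s: "sol y0 y1 y2" and l: "l \<in> gen m"
  shows "Nm (jp (gt t) l + act (invL (gt t)) (YY y0 y1 y2 t)) = Nm (gt t) * Nm (l + Y0 y0)"
proof -
  interpret B: curve_data cr T e crE TE eE io m b c a q r p v w by (rule rotate_data)
  interpret C: curve_data cr T e crE TE eE io m c a b r p q v w by (rule B.rotate_data)
  have y: "y0 \<in> vert m" "y1 \<in> vert m" "y2 \<in> vert m" using s by (simp_all add: sol_def)
  note YV = YY_vert[OF y]
  let ?C = "\<lambda>d t. cmp d (Y0 y0) + t *s cmp d (Y1 y0 y1) + t^2 *s cmp d (Y2 y0 y1 y2)
      + t^3 *s cmp d (Y3 y1 y2) + t^4 *s cmp d (Y4 y2)"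
  let ?y = "\<lambda>d t. cmp d y0 + t *s cmp d y1 + t^2 *s cmp d y2"
  have yp: "polyv 2 (?y d)" for d
  proof -
    have "polyv 2 (\<lambda>t. t ^ k *s c)" if "k \<le> 2" for k c
      using polyv_mono[OF polyv_power that] .
    from this[of 0 "cmp d y0"] this[of 1 "cmp d y1"] this[of 2 "cmp d y2"] show ?thesis by (simp add: polyv_add)
  qed
  note pv = peirce_cmp_all
  have yc: "E.peirce a b c (?y a t)" "E.peirce b c a (?y b t)" "E.peirce c a b (?y c t)" for t
    by (intro E.peirce_intros pv y)+
  have cY: "cmp d (YY y0 y1 y2 t) = ?C d (io t)" for d
    by (simp add: YY_def cmp_lin io_power)
  have cY0: "?C d 0 = cmp d (Y0 y0)" for d by simp
  have key: "E.Nm (((1 + p * (io t)^2) * coe a l) *s a + ((1 + q * (io t)^2) * coe b l) *s b + ((1 + r * (io t)^2) * coe c l) *s c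
      + (inverse (1 + p * (io t)^2) *s ?C a (io t) + inverse (1 + q * (io t)^2) *s ?C b (io t) + inverse (1 + r * (io t)^2) *s ?C c (io t)))
    = (1 + p * (io t)^2) * (1 + q * (io t)^2) * (1 + r * (io t)^2)
      * E.Nm (coe a l *s a + coe b l *s b + coe c l *s c + (?C a 0 + ?C b 0 + ?C c 0))"
    by (rule E.frame_similarity[where y = "?y a" and y' = "?y b" and y'' = "?y c" and Y = "?C a" and Y' = "?C b" and Y'' = "?C c"
        and t = "io t" and k = "coe a l" and l = "coe b l" and m = "coe c l" and a = a and b = b and c = c
        and v = "cmp a v" and w = "cmp a w" and v' = "cmp b v" and w' = "cmp b w" and v'' = "cmp c v" and w'' = "cmp c w"
        and \<alpha> = "E.nrm (cmp a v)" and \<alpha>' = "E.nrm (cmp b v)" and \<alpha>'' = "E.nrm (cmp c v)" and \<mu> = p and \<mu>' = q and \<mu>'' = r,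
        OF infE f plane_a B.plane_a C.plane_a pv(1)[OF v] pv(1)[OF w] pv(2)[OF v] pv(2)[OF w]
        pv(3)[OF v] pv(3)[OF w] pq rp[symmetric] qr p_nonzero B.p_nonzero C.p_nonzero yp yc(1) yp yc(2) yp yc(3)
        cmp_Y_curve[OF y, symmetric] B.cmp_Y_curve[OF y, symmetric] C.cmp_Y_curve[OF y, symmetric]
        C.sol_divides(1)[OF s] B.sol_divides(2)[OF s] C.sol_divides(2)[OF s]
        sol_divides(1)[OF s] B.sol_divides(1)[OF s] sol_divides(2)[OF s]
        coe_gt_nonzero B.coe_gt_nonzero C.coe_gt_nonzero])
  have g: "jp (gt t) l \<in> gen m" by (rule gen_jp[OF gt_gen l])
  have iv: "act (invL (gt t)) (YY y0 y1 y2 t) \<in> vert m" by (intro act_vert invL_gen gt_gen YV)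
  have e1: "em (jp (gt t) l + act (invL (gt t)) (YY y0 y1 y2 t))
    = ((1 + p * (io t)^2) * coe a l) *s a + ((1 + q * (io t)^2) * coe b l) *s b + ((1 + r * (io t)^2) * coe c l) *s c
      + (inverse (1 + p * (io t)^2) *s ?C a (io t) + inverse (1 + q * (io t)^2) *s ?C b (io t) + inverse (1 + r * (io t)^2) *s ?C c (io t))"
    unfolding em_add em_gen[OF g] em_vert[OF iv] coe_jp[OF gt_gen l] B.coe_jp[OF gt_gen l] C.coe_jp[OF gt_gen l]
      cmp_act'[OF invL_gen[OF gt_gen] YV] B.cmp_act'[OF invL_gen[OF gt_gen] YV] C.cmp_act'[OF invL_gen[OF gt_gen] YV]
      coe_invL[OF gt_gen gt_nonzero] B.coe_invL[OF gt_gen gt_nonzero] C.coe_invL[OF gt_gen gt_nonzero]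
      coe_gt B.coe_gt C.coe_gt cY ..
  have e2: "em (l + Y0 y0) = coe a l *s a + coe b l *s b + coe c l *s c + (?C a 0 + ?C b 0 + ?C c 0)"
    unfolding em_add em_gen[OF l] em_vert[OF Y_vert(1)[OF y]] by simp
  have e3: "io (Nm (gt t)) = (1 + p * (io t)^2) * (1 + q * (io t)^2) * (1 + r * (io t)^2)"
    unfolding io_Nm[OF gt_gen] coe_gt B.coe_gt C.coe_gt ..
  have "io (Nm (jp (gt t) l + act (invL (gt t)) (YY y0 y1 y2 t))) = io (Nm (gt t) * Nm (l + Y0 y0))"
    using key unfolding e1[symmetric] e2[symmetric] io_mult e3 em_Nm .
  then show ?thesis by (simp add: io_eq)
qed

text \<open>Pairing the reflected curve with v + t w recovers the term that the reflection
  subtracts, so the reflected vector vanishes only if the original one does.\<close>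

lemma curve_zero:
  assumes y: "y0 \<in> vert m" "y1 \<in> vert m" "y2 \<in> vert m" and z: "YY y0 y1 y2 t = 0"
  shows "cmp a (y0 + t *s y1 + t^2 *s y2) = 0"
proof -
  let ?y = "\<lambda>t. cmp a y0 + t *s cmp a y1 + t^2 *s cmp a y2"
  let ?u = "cmp a v + io t *s cmp a w"
  let ?r = "E.refl_curve (E.nrm (cmp a v)) p (cmp a v) (cmp a w) ?y (io t)"
  have "?r = cmp a (YY y0 y1 y2 t)" unfolding cmp_Y_curve[OF y] by (simp add: YY_def cmp_lin io_power)
  then have r: "?r = 0" using z by (simp add: cmp_lin)
  have "TE ?r ?u = - ((1 + p * (io t)^2) * TE ?u (?y (io t)))" by (rule E.T_refl_curve_line[OF plane_a])
  then have "TE ?u (?y (io t)) = 0" using coe_gt_nonzero[of t] unfolding r by simp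
  then have "(1 + p * (io t)^2) *s ?y (io t) = 0" using r unfolding E.refl_curve_def by simp
  then have "?y (io t) = 0" using coe_gt_nonzero[of t] by (metis vector_mul_eq_0)
  then show ?thesis by (simp add: cmp_lin io_power)
qed

text \<open>For y0 = 0 the values of the curve have norm zero by \<open>norm_sim\<close>, so by
  anisotropy they vanish for every t; t = 1 and t = - 1 then separate y1 and y2.\<close>

lemma sol_unique_zero:
  assumes s: "sol 0 y1 y2" shows "y1 = 0 \<and> y2 = 0"
proof -
  interpret B: curve_data cr T e crE TE eE io m b c a q r p v w by (rule rotate_data)
  interpret C: curve_data cr T e crE TE eE io m c a b r p q v w by (rule B.rotate_data)
  have y: "0 \<in> vert m" "y1 \<in> vert m" "y2 \<in> vert m" using s by (simp_all add: sol_def)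
  have "R3 v 0 v = 0" using R3_lin(2)[of v 0 0 v] by simp
  then have Y0: "Y0 0 = 0" by (simp add: Y0_def)
  have z: "t *s y1 + t^2 *s y2 = 0" for t
  proof -
    have "Nm (jp (gt t) 0 + act (invL (gt t)) (YY 0 y1 y2 t)) = 0"
      unfolding norm_sim[OF s gen_zero] Y0 by simp
    moreover have "jp (gt t) 0 = 0" using jp_lin(2)[of "gt t" 0 0] by simp
    ultimately have z0: "act (invL (gt t)) (YY 0 y1 y2 t) = 0" using aniso by simp
    have "cmp a (YY 0 y1 y2 t) = 0"
      using cmp_act'[OF invL_gen[OF gt_gen] YY_vert[OF y], of t t] coe_gt_nonzero[of t] unfolding z0
      by (simp add: coe_invL[OF gt_gen gt_nonzero] coe_gt cmp_lin)
    moreover have "cmp b (YY 0 y1 y2 t) = 0"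
      using B.cmp_act'[OF invL_gen[OF gt_gen] YY_vert[OF y], of t t] B.coe_gt_nonzero[of t] unfolding z0
      by (simp add: B.coe_invL[OF gt_gen gt_nonzero] B.coe_gt cmp_lin)
    moreover have "cmp c (YY 0 y1 y2 t) = 0"
      using C.cmp_act'[OF invL_gen[OF gt_gen] YY_vert[OF y], of t t] C.coe_gt_nonzero[of t] unfolding z0
      by (simp add: C.coe_invL[OF gt_gen gt_nonzero] C.coe_gt cmp_lin)
    ultimately have YZ: "YY 0 y1 y2 t = 0"
      using cmp_eqI[OF YY_vert[OF y] vert_zero] by (simp add: cmp_lin)
    have "0 + t *s y1 + t^2 *s y2 = 0"
      by (rule cmp_eqI) (use y curve_zero[OF y YZ] B.curve_zero[OF y YZ]
          C.curve_zero[OF y YZ] in \<open>auto simp: cmp_lin intro!: vert_intros\<close>)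
    then show ?thesis by simp
  qed
  have 1: "y1 + y2 = 0" using z[of 1] by simp
  have 2: "- y1 + y2 = 0" using z[of "-1"] by simp
  have "y2 = y1" using 2 by simp
  then have "2 *s y1 = 0" using 1 by (simp add: vec_eq_iff)
  then show ?thesis using two \<open>y2 = y1\<close> by simp
qed

end

section \<open>Existence of the curve by a dimension count, and its linear maps\<close>

text \<open>An injective endomorphism of a finite-dimensional space is onto; the pair of vectors is
  packed into one vector indexed by \<open>'n + 'n\<close>.\<close>

lemma linear_pair_surj:
  fixes F G :: "'a::field ^ 'n \<Rightarrow> 'a ^ 'n \<Rightarrow> 'a ^ 'n"
  assumes Fa: "\<And>x x' y y'. F (x + x') (y + y') = F x y + F x' y'" and Fs: "\<And>c x y. F (c *s x) (c *s y) = c *s F x y"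
    and Ga: "\<And>x x' y y'. G (x + x') (y + y') = G x y + G x' y'" and Gs: "\<And>c x y. G (c *s x) (c *s y) = c *s G x y"
    and inj: "\<And>x y. F x y = 0 \<Longrightarrow> G x y = 0 \<Longrightarrow> x = 0 \<and> y = 0"
  shows "\<exists>x y. F x y = u \<and> G x y = w"
proof -
  define l r :: "'a ^ ('n + 'n) \<Rightarrow> 'a ^ 'n" where "l z = (\<chi> i. z $ Inl i)" and "r z = (\<chi> i. z $ Inr i)" for z
  define j :: "'a ^ 'n \<Rightarrow> 'a ^ 'n \<Rightarrow> 'a ^ ('n + 'n)" where
    "j x y = (\<chi> i. case i of Inl k \<Rightarrow> x $ k | Inr k \<Rightarrow> y $ k)" for x y
  have lj: "l (j x y) = x" "r (j x y) = y" for x y by (simp_all add: l_def r_def j_def vec_eq_iff)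
  have jl: "j (l z) (r z) = z" for z by (simp add: l_def r_def j_def vec_eq_iff split: sum.split)
  have lin: "l (z + z') = l z + l z'" "r (z + z') = r z + r z'" "l (c *s z) = c *s l z" "r (c *s z) = c *s r z" for z z' c
    by (simp_all add: l_def r_def vec_eq_iff)
  have jlin: "j (x + x') (y + y') = j x y + j x' y'" "j (c *s x) (c *s y) = c *s j x y" for x x' y y' c
    by (simp_all add: j_def vec_eq_iff split: sum.split)
  define H where "H z = j (F (l z) (r z)) (G (l z) (r z))" for z
  have Hl: "Vector_Spaces.linear (*s) (*s) H"
    by unfold_locales (simp_all add: H_def lin Fa Fs Ga Gs jlin)
  have z0: "z = 0" if "H z = 0" for z
  proof -
    have "F (l z) (r z) = 0" "G (l z) (r z) = 0"
      using lj[of "F (l z) (r z)" "G (l z) (r z)"] that by (simp_all add: H_def l_def r_def vec_eq_iff)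
    then have "l z = 0" "r z = 0" using inj by blast+
    moreover have "j 0 0 = 0" by (simp add: j_def vec_eq_iff split: sum.split)
    ultimately show ?thesis using jl[of z] by simp
  qed
  have "inj H"
  proof (rule injI)
    fix y z assume "H y = H z"
    moreover have "H (y + (-1) *s z) = H y + (-1) *s H z"
      unfolding H_def by (simp only: lin Fa Fs Ga Gs jlin)
    ultimately have "H (y + (-1) *s z) = 0" by simp
    then show "y = z" using z0 by force
  qed
  then have "surj H" by (rule vec.linear_inj_imp_surj[OF Hl])
  then obtain z where "H z = j u w" by (metis surjD)
  then have "F (l z) (r z) = u" "G (l z) (r z) = w" using lj unfolding H_def by metis+
  then show ?thesis by blast
qed

context cubic
begin

lemma polyv_sh: "polyv d F \<Longrightarrow> polyv (d + d) (\<lambda>t. sh (F t))"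
  using polyv_scale[OF polyf_const[of 0] polyv_X] unfolding sh_def by fastforce

lemma polyf_Nm: assumes F: "polyv d F" shows "polyf (d + (d + d)) (\<lambda>t. Nm (F t))"
  unfolding Nm_def divide_inverse by (rule polyf_mult_const[OF polyf_T[OF F polyv_sh[OF F]]])

end

context curve_data
begin

lemma Y_add:
  "Y0 (x0 + y0) = Y0 x0 + Y0 y0" "Y1 (x0 + y0) (x1 + y1) = Y1 x0 x1 + Y1 y0 y1"
  "Y2 (x0 + y0) (x1 + y1) (x2 + y2) = Y2 x0 x1 x2 + Y2 y0 y1 y2"
  "Y3 (x1 + y1) (x2 + y2) = Y3 x1 x2 + Y3 y1 y2" "Y4 (x2 + y2) = Y4 x2 + Y4 y2"
  by (simp_all add: Y_defs R3_lin act_lin)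

lemma Y_scale:
  "Y0 (k *s y0) = k *s Y0 y0" "Y1 (k *s y0) (k *s y1) = k *s Y1 y0 y1"
  "Y2 (k *s y0) (k *s y1) (k *s y2) = k *s Y2 y0 y1 y2"
  "Y3 (k *s y1) (k *s y2) = k *s Y3 y1 y2" "Y4 (k *s y2) = k *s Y4 y2"
  by (simp_all add: Y_defs R3_lin act_lin vec.scale_right_distrib vec.scale_right_diff_distrib)

lemma YY_add: "YY (x0 + y0) (x1 + y1) (x2 + y2) t = YY x0 x1 x2 t + YY y0 y1 y2 t"
  by (simp add: YY_def Y_add vec.scale_right_distrib)

lemma YY_scale: "YY (k *s y0) (k *s y1) (k *s y2) t = k *s YY y0 y1 y2 t"
  by (simp add: YY_def Y_scale vec.scale_right_distrib mult.commute)

lemma EQ_add: "EQ k (x0 + y0) (x1 + y1) (x2 + y2) = EQ k x0 x1 x2 + EQ k y0 y1 y2"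
  by (simp add: EQ_def Y_add vX_lin)

lemma EQ_scale: "EQ k (s *s y0) (s *s y1) (s *s y2) = s *s EQ k y0 y1 y2"
  by (simp add: EQ_def Y_scale vX_lin vec.scale_right_distrib vec.scale_right_diff_distrib)

lemma EQ_vert: "EQ k y0 y1 y2 \<in> vert m"
  unfolding EQ_def by (intro vert_intros vX_vert)

lemma sol_add: "sol x0 x1 x2 \<Longrightarrow> sol y0 y1 y2 \<Longrightarrow> sol (x0 + y0) (x1 + y1) (x2 + y2)"
  unfolding sol_def by (simp add: EQ_add vert_add)

lemma sol_scale: "sol y0 y1 y2 \<Longrightarrow> sol (k *s y0) (k *s y1) (k *s y2)"
  unfolding sol_def by (simp add: EQ_scale vert_scale)

lemma sol_unique: assumes "sol y0 y1 y2" "sol y0 z1 z2" shows "z1 = y1 \<and> z2 = y2"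
proof -
  have "sol (y0 + (-1) *s y0) (z1 + (-1) *s y1) (z2 + (-1) *s y2)"
    by (rule sol_add[OF assms(2) sol_scale[OF assms(1)]])
  then have "sol 0 (z1 - y1) (z2 - y2)" by simp
  then show ?thesis using sol_unique_zero by force
qed

text \<open>The unknowns range over V, which is no coordinate space. Replacing them by their V-parts
  and adding their L-parts to the equations gives a square system on all pairs; as \<open>EQ\<close>
  takes values in V, a sum vanishes only if both summands do.\<close>

lemma sol_exists: assumes y0: "y0 \<in> vert m" shows "\<exists>y1 y2. sol y0 y1 y2"
proof -
  define P where "P x = x - prL m x" for x
  have Pl: "P (x + y) = P x + P y" "P (k *s x) = k *s P x" for x y k
    by (simp_all add: P_def prL_add prL_scale vec.scale_right_diff_distrib)
  have Pv: "P x \<in> vert m" for x unfolding P_def by (rule prL(2))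
  let ?F = "\<lambda>x y. EQ 0 0 (P x) (P y) + prL m x" and ?G = "\<lambda>x y. EQ 1 0 (P x) (P y) + prL m y"
  have E: "EQ k 0 (x + x') (y + y') = EQ k 0 x y + EQ k 0 x' y'" "EQ k 0 (s *s x) (s *s y) = s *s EQ k 0 x y" for k x x' y y' s
    using EQ_add[of k 0 0] EQ_scale[of k s 0] by simp_all
  have split: "u = 0 \<and> l = 0" if "u \<in> vert m" "l \<in> gen m" "u + l = 0" for u l
  proof -
    have "u = - l" using that(3) by (simp add: eq_neg_iff_add_eq_0)
    then have "u \<in> gen m" using that(2) gen_minus by simp
    then have "u = 0" using gen_vert that(1) by blast
    then show ?thesis using that(3) by simp
  qed
  have "\<exists>x y. ?F x y = - EQ 0 y0 0 0 \<and> ?G x y = - EQ 1 y0 0 0"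
  proof (rule linear_pair_surj)
    fix x y assume z: "?F x y = 0" "?G x y = 0"
    have a: "EQ 0 0 (P x) (P y) = 0 \<and> prL m x = 0" by (rule split[OF EQ_vert prL(1) z(1)])
    have b: "EQ 1 0 (P x) (P y) = 0 \<and> prL m y = 0" by (rule split[OF EQ_vert prL(1) z(2)])
    have "sol 0 (P x) (P y)" using a b Pv by (simp add: sol_def vert_zero)
    then have "P x = 0 \<and> P y = 0" by (rule sol_unique_zero)
    then show "x = 0 \<and> y = 0" using a b by (simp add: P_def)
  qed (simp_all add: Pl E prL_add prL_scale vec.scale_right_distrib)
  then obtain x y where xy: "?F x y = - EQ 0 y0 0 0" "?G x y = - EQ 1 y0 0 0" by blast
  have a: "EQ 0 0 (P x) (P y) + EQ 0 y0 0 0 = 0"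
  proof -
    have "(EQ 0 0 (P x) (P y) + EQ 0 y0 0 0) + prL m x = (EQ 0 0 (P x) (P y) + prL m x) + EQ 0 y0 0 0" by simp
    also have "\<dots> = 0" unfolding xy(1) by simp
    finally show ?thesis using split[OF vert_add[OF EQ_vert EQ_vert] prL(1)] by blast
  qed
  have b: "EQ 1 0 (P x) (P y) + EQ 1 y0 0 0 = 0"
  proof -
    have "(EQ 1 0 (P x) (P y) + EQ 1 y0 0 0) + prL m y = (EQ 1 0 (P x) (P y) + prL m y) + EQ 1 y0 0 0" by simp
    also have "\<dots> = 0" unfolding xy(2) by simp
    finally show ?thesis using split[OF vert_add[OF EQ_vert EQ_vert] prL(1)] by blast
  qed
  have "sol y0 (P x) (P y)"
    using a b EQ_add[of 0 0 y0 "P x" 0 "P y" 0] EQ_add[of 1 0 y0 "P x" 0 "P y" 0] Pv y0 by (simp add: sol_def)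
  then show ?thesis by blast
qed

lemma Y0_Y0: assumes z: "z \<in> vert m" shows "Y0 (Y0 z) = z"
proof -
  interpret B: curve_data cr T e crE TE eE io m b c a q r p v w by (rule rotate_data)
  interpret C: curve_data cr T e crE TE eE io m c a b r p q v w by (rule B.rotate_data)
  have one: "cmp a (Y0 (Y0 z)) = cmp a z"
    if "curve_data cr T e crE TE eE io m a b c p q r v w" for a b c p q r
  proof -
    interpret A: curve_data cr T e crE TE eE io m a b c p q r v w by (rule that)
    have n: "E.nrm (cmp a v) \<noteq> 0" using A.plane_a by (simp add: E.plane_def)
    have Yv: "Y0 z \<in> vert m" if "z \<in> vert m" for z using Y_vert(1)[OF that vert_zero vert_zero] .
    have c: "cmp a (Y0 z) = cmp a z - (TE (cmp a v) (cmp a z) / E.nrm (cmp a v)) *s cmp a v" if "z \<in> vert m" for z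
      unfolding Y0_def cmp_lin A.cmp_R3[OF v that v] ..
    define k where "k = TE (cmp a v) (cmp a z) / E.nrm (cmp a v)"
    have k2: "TE (cmp a v) (cmp a (Y0 z)) / E.nrm (cmp a v) = - k"
      unfolding c[OF z] k_def[symmetric] E.T_diff_right E.T_scale_right E.T_self_nrm
      using n by (simp add: k_def field_simps)
    show ?thesis unfolding c[OF Yv[OF z]] k2 unfolding c[OF z] k_def[symmetric] by simp
  qed
  have Yv: "Y0 (Y0 z) \<in> vert m" using Y_vert(1) z vert_zero by blast
  show ?thesis
    by (rule cmp_eqI[OF Yv z one one one])
      (rule curve_data_axioms B.curve_data_axioms C.curve_data_axioms)+
qed

definition s1 where "s1 y0 = (SOME y1. \<exists>y2. sol y0 y1 y2)"
definition s2 where "s2 y0 = (SOME y2. sol y0 (s1 y0) y2)"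

lemma s12: "y0 \<in> vert m \<Longrightarrow> sol y0 (s1 y0) (s2 y0)"
  using someI_ex[OF sol_exists] unfolding s1_def s2_def by (rule someI_ex)

lemma s12_eq: "sol y0 y1 y2 \<Longrightarrow> s1 y0 = y1 \<and> s2 y0 = y2"
  using sol_unique s12 sol_def by metis

lemma s12_add: "x \<in> vert m \<Longrightarrow> y \<in> vert m \<Longrightarrow> s1 (x + y) = s1 x + s1 y \<and> s2 (x + y) = s2 x + s2 y"
  by (intro s12_eq sol_add s12)

lemma s12_scale: "x \<in> vert m \<Longrightarrow> s1 (k *s x) = k *s s1 x \<and> s2 (k *s x) = k *s s2 x"
  by (intro s12_eq sol_scale s12)

text \<open>The curve r_t of the overview. At t = 0 the construction yields the reflection
  \<open>Y0\<close> along v, so the V-part is reflected beforehand; by \<open>Y0_Y0\<close> the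
  value at t = 0 is then the identity.\<close>

definition rr where
  "rr t x = jp (gt t) (prL m x)
     + act (invL (gt t)) (YY (Y0 (x - prL m x)) (s1 (Y0 (x - prL m x))) (s2 (Y0 (x - prL m x))) t)"

lemma Y0_vert: "z \<in> vert m \<Longrightarrow> Y0 z \<in> vert m"
  using Y_vert(1) vert_zero by blast

lemma rr_add: "rr t (x + y) = rr t x + rr t y"
proof -
  have x: "x + y - prL m (x + y) = (x - prL m x) + (y - prL m y)" by (simp add: prL_add)
  have v: "Y0 (x - prL m x) \<in> vert m" "Y0 (y - prL m y) \<in> vert m" by (intro Y0_vert prL(2))+
  show ?thesis unfolding rr_def x Y_add
    by (simp add: s12_add[OF v] YY_add prL_add jp_lin act_lin)
qed

lemma rr_scale: "rr t (k *s x) = k *s rr t x"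
proof -
  have x: "k *s x - prL m (k *s x) = k *s (x - prL m x)" by (simp add: prL_scale vec.scale_right_diff_distrib)
  have v: "Y0 (x - prL m x) \<in> vert m" by (intro Y0_vert prL(2))
  show ?thesis unfolding rr_def x Y_scale
    by (simp add: s12_scale[OF v] YY_scale prL_scale jp_lin act_lin vec.scale_right_distrib)
qed

lemma rr_Nm: "Nm (rr t x) = Nm (gt t) * Nm x"
  unfolding rr_def
  using norm_sim[OF s12[OF Y0_vert[OF prL(2)[where x = x]]] prL(1)[where x = x], of t] by (simp add: Y0_Y0[OF prL(2)])

lemma act_unit_vert: "x \<in> vert m \<Longrightarrow> act e x = x"
  by (simp add: act_def X_unit vert_def)

lemma rr_zero: "rr 0 x = x"
proof -
  have i: "invL (gt 0) = e" by (simp add: invL_def gt_def)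
  show ?thesis unfolding rr_def i 
    by (simp add: gt_def jp_unit YY_def Y0_Y0[OF prL(2)] act_unit_vert[OF prL(2)])
qed

lemma rr_sol: "sol y0 y1 y2 \<Longrightarrow> rr t (Y0 y0) = act (invL (gt t)) (YY y0 y1 y2 t)"
proof -
  assume s: "sol y0 y1 y2"
  then have y: "y0 \<in> vert m" by (simp add: sol_def)
  have p: "prL m (Y0 y0) = 0" by (rule prL_vert[OF Y0_vert[OF y]])
  have j: "jp (gt t) 0 = 0" using jp_lin(2)[of "gt t" 0 0] by simp
  show ?thesis unfolding rr_def p by (simp add: Y0_Y0[OF y] j s12_eq[OF s])
qed

lemma rr_gen: "l \<in> gen m \<Longrightarrow> rr t l = jp (gt t) l"
proof -
  assume l: "l \<in> gen m"
  have "sol 0 0 0" using EQ_scale[of _ 0 0 0 0] by (simp add: sol_def vert_zero)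
  moreover have "Y0 0 = 0" using Y_scale(1)[of 0 0] by simp
  ultimately have "rr t 0 = act (invL (gt t)) (YY 0 0 0 t)" using rr_sol by metis
  moreover have "rr t 0 = 0" using rr_scale[of t 0 0] by simp
  moreover have "Y0 0 = 0" using Y_scale(1)[of 0 0] by simp
  moreover have "s1 0 = 0 \<and> s2 0 = 0" using s12_eq[OF \<open>sol 0 0 0\<close>] .
  ultimately show ?thesis unfolding rr_def by (simp add: prL_gen[OF l])
qed

lemma polyv_gt: "polyv 2 gt"
proof -
  have "polyv 2 (\<lambda>t. e + t^2 *s m)" by (intro polyv_add polyv_const polyv_power)
  then show ?thesis by (simp add: gt_def[abs_def])
qed

lemma polyv_YY: "polyv 4 (YY y0 y1 y2)"
proof -
  have h: "polyv 4 (\<lambda>t. t ^ k *s c')" if "k \<le> 4" for k c'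
    using polyv_mono[OF polyv_power that] .
  have h1: "polyv 4 (\<lambda>t. t *s c')" for c' using h[of 1] by simp
  show ?thesis unfolding YY_def[abs_def] by (intro polyv_add polyv_const h h1) auto
qed

text \<open>Multiplication by N(gt t) turns the inverse of gt t into its sharp, so that every entry
  becomes a polynomial in t.\<close>

lemma polyv_rr: "\<exists>d. polyv d (\<lambda>t. Nm (gt t) *s rr t x)"
proof -
  let ?z = "Y0 (x - prL m x)" and ?l = "prL m x"
  have eq: "Nm (gt t) *s rr t x = Nm (gt t) *s jp (gt t) ?l - sh (gt t) \<bowtie> YY ?z (s1 ?z) (s2 ?z) t" for t
  proof -
    have "Nm (gt t) \<noteq> 0" using gt_nonzero aniso by blast
    then show ?thesis
      unfolding rr_def act_def invL_def by (simp add: bilin vec.scale_right_distrib vec.scale_minus_right)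
  qed
  have jp: "\<exists>d. polyv d (\<lambda>t. jp (gt t) ?l)"
  proof -
    have x: "polyv 2 (\<lambda>t. gt t \<bowtie> ?l)" using polyv_X[OF polyv_gt polyv_const[of 0 ?l]] by simp
    have t1: "polyv 2 (\<lambda>t. T (gt t) e *s ?l)"
      using polyv_scale[OF polyf_T[OF polyv_gt polyv_const[of 0 e]] polyv_const[of 0 ?l]] by simp
    have t2: "polyv 2 (\<lambda>t. T ?l e *s gt t)" using polyv_scale[OF polyf_const[of 0 "T ?l e"] polyv_gt] by (simp only: add_0)
    have t3: "polyv 2 (\<lambda>t. T (gt t \<bowtie> ?l) e *s e)"
      using polyv_scale[OF polyf_T[OF x polyv_const[of 0 e]] polyv_const[of 0 e]] by simp
    have "polyv (0 + 2) (\<lambda>t. inverse 2 *s (gt t \<bowtie> ?l + T (gt t) e *s ?l + T ?l e *s gt t - T (gt t \<bowtie> ?l) e *s e))"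
      by (intro polyv_scale[OF polyf_const] polyv_diff[OF polyv_add[OF polyv_add[OF x t1] t2] t3])
    then show ?thesis unfolding jp_def by blast
  qed
  then obtain d where d: "polyv d (\<lambda>t. jp (gt t) ?l)" by blast
  have 1: "polyv (2 + (2 + 2) + d) (\<lambda>t. Nm (gt t) *s jp (gt t) ?l)"
    by (rule polyv_scale[OF polyf_Nm[OF polyv_gt] d])
  have 2: "polyv (2 + 2 + 4) (\<lambda>t. sh (gt t) \<bowtie> YY ?z (s1 ?z) (s2 ?z) t)"
    by (rule polyv_X[OF polyv_sh[OF polyv_gt] polyv_YY])
  have "polyv (2 + (2 + 2) + d + (2 + 2 + 4)) (\<lambda>t. Nm (gt t) *s jp (gt t) ?l - sh (gt t) \<bowtie> YY ?z (s1 ?z) (s2 ?z) t)"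
    by (rule polyv_diff[OF polyv_mono[OF 1] polyv_mono[OF 2]]) auto
  then show ?thesis unfolding eq by blast
qed

end

section \<open>Scalar extension to the algebraic closure\<close>

lemma linear_eq_on_axes:
  fixes F G :: "'b::field ^ 'n \<Rightarrow> 'b ^ 'm"
  assumes F: "\<And>x y. F (x + y) = F x + F y" "\<And>c x. F (c *s x) = c *s F x"
    and G: "\<And>x y. G (x + y) = G x + G y" "\<And>c x. G (c *s x) = c *s G x"
    and eq: "\<And>i. F (axis i 1) = G (axis i 1)"
  shows "F x = G x"
proof -
  have s: "H (\<Sum>i\<in>A. f i) = (\<Sum>i\<in>A. H (f i))" if "\<And>x y. H (x + y) = H x + H y" "\<And>c x. H (c *s x) = c *s H x"
    for H :: "'b ^ 'n \<Rightarrow> 'b ^ 'm" and f and A :: "'n set"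
  proof -
    have "H 0 = 0" using that(2)[of 0 0] by simp
    then show ?thesis by (induction A rule: infinite_finite_induct) (simp_all add: that(1))
  qed
  have "F (\<Sum>i\<in>UNIV. x $ i *s axis i 1) = G (\<Sum>i\<in>UNIV. x $ i *s axis i 1)"
    by (simp only: s[of F, OF F] s[of G, OF G] F(2) G(2) eq)
  then show ?thesis by (simp only: vec_axis_sum[symmetric])
qed

lemma linear_form_eq_on_axes:
  fixes F G :: "'b::field ^ 'n \<Rightarrow> 'b"
  assumes F: "\<And>x y. F (x + y) = F x + F y" "\<And>c x. F (c *s x) = c * F x"
    and G: "\<And>x y. G (x + y) = G x + G y" "\<And>c x. G (c *s x) = c * G x"
    and eq: "\<And>i. F (axis i 1) = G (axis i 1)"
  shows "F x = G x"
proof -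
  have "(\<lambda>x. (\<chi> i. F x) :: 'b ^ 1) x = (\<lambda>x. (\<chi> i. G x)) x"
    by (rule linear_eq_on_axes) (simp_all add: vec_eq_iff F G eq)
  then show ?thesis by (simp add: vec_eq_iff)
qed

definition emb :: "'a::field ^ 'n \<Rightarrow> 'a alg_closure ^ 'n" where
  "emb x = (\<chi> i. to_ac (x $ i))"

lemma emb_axis: "emb (axis i 1) = axis i 1"
  by (simp add: emb_def vec_eq_iff axis_def)

lemma emb_lin: "emb (x + y) = emb x + emb y" "emb (c *s x) = to_ac c *s emb x" "emb (x - y) = emb x - emb y"
  by (simp_all add: emb_def vec_eq_iff to_ac_add to_ac_mult to_ac_diff)

context cubic
begin

definition crE :: "'a alg_closure ^ 'n \<Rightarrow> 'a alg_closure ^ 'n \<Rightarrow> 'a alg_closure ^ 'n" where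
  "crE x y = (\<Sum>i\<in>UNIV. \<Sum>j\<in>UNIV. (x $ i * y $ j) *s emb (axis i 1 \<bowtie> axis j 1))"

definition TE :: "'a alg_closure ^ 'n \<Rightarrow> 'a alg_closure ^ 'n \<Rightarrow> 'a alg_closure" where
  "TE x y = (\<Sum>i\<in>UNIV. \<Sum>j\<in>UNIV. (x $ i * y $ j) * to_ac (T (axis i 1) (axis j 1)))"

lemma crE_lin: "crE (x + x') y = crE x y + crE x' y" "crE x (y + y') = crE x y + crE x y'"
  "crE (c *s x) y = c *s crE x y" "crE x (c *s y) = c *s crE x y"
  by (simp_all add: crE_def vec.scale_left_distrib sum.distrib vec.scale_sum_right algebra_simps)

lemma TE_lin: "TE (x + x') y = TE x y + TE x' y" "TE x (y + y') = TE x y + TE x y'"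
  "TE (c *s x) y = c * TE x y" "TE x (c *s y) = c * TE x y"
  by (simp_all add: TE_def sum.distrib sum_distrib_left algebra_simps)

lemma crE_emb: "crE (emb x) (emb y) = emb (x \<bowtie> y)"
proof -
  have 0: "emb 0 = 0" by (simp add: emb_def vec_eq_iff)
  have s: "emb (\<Sum>i\<in>A. f i) = (\<Sum>i\<in>A. emb (f i))" for A :: "'n set" and f :: "'n \<Rightarrow> 'a ^ 'n"
    by (induction A rule: infinite_finite_induct) (simp_all add: emb_lin 0)
  have "emb (x \<bowtie> y) = (\<Sum>i\<in>UNIV. \<Sum>j\<in>UNIV. to_ac (x $ i * y $ j) *s emb (axis i 1 \<bowtie> axis j 1))"
    by (subst X_axis) (simp only: s emb_lin)
  then show ?thesis by (simp add: crE_def emb_def[of x] emb_def[of y] to_ac_mult)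
qed

lemma TE_emb: "TE (emb x) (emb y) = to_ac (T x y)"
proof -
  have s: "to_ac (\<Sum>i\<in>A. f i) = (\<Sum>i\<in>A. to_ac (f i))" for A :: "'n set" and f :: "'n \<Rightarrow> 'a"
    by (induction A rule: infinite_finite_induct) (simp_all add: to_ac_add)
  show ?thesis by (subst T_axis) (simp add: TE_def emb_def s to_ac_mult)
qed

text \<open>Both sides are linear in each argument. The arguments are freed one at a time, each step
  needing agreement only on basis vectors, which are images of vectors over K.\<close>

lemma alg_closure_four:
  "crE (crE w x) (crE y z) + crE (crE w y) (crE x z) + crE (crE w z) (crE x y)
       = TE (crE x y) z *s w + TE (crE w y) z *s x + TE (crE w x) z *s y + TE (crE w x) y *s z"
proof -
  note L = crE_lin TE_lin vec.scale_left_distrib vec.scale_right_distrib ac_simps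
  let ?P = "\<lambda>w x y z. crE (crE w x) (crE y z) + crE (crE w y) (crE x z) + crE (crE w z) (crE x y)"
  let ?Q = "\<lambda>w x y z. TE (crE x y) z *s w + TE (crE w y) z *s x + TE (crE w x) z *s y + TE (crE w x) y *s z"
  have 0: "?P (emb w) (emb x) (emb y) (emb z) = ?Q (emb w) (emb x) (emb y) (emb z)" for w x y z
    by (simp add: crE_emb TE_emb emb_lin[symmetric] X_four)
  have 1: "?P w (emb x) (emb y) (emb z) = ?Q w (emb x) (emb y) (emb z)" for w x y z
    by (rule linear_eq_on_axes[where F = "\<lambda>w. ?P w (emb x) (emb y) (emb z)" and G = "\<lambda>w. ?Q w (emb x) (emb y) (emb z)"])
      (rule 0[of "axis _ 1", unfolded emb_axis] | simp add: L)+
  have 2: "?P w x (emb y) (emb z) = ?Q w x (emb y) (emb z)" for w x y z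
    by (rule linear_eq_on_axes[where F = "\<lambda>x. ?P w x (emb y) (emb z)" and G = "\<lambda>x. ?Q w x (emb y) (emb z)"])
      (rule 1[of _ "axis _ 1", unfolded emb_axis] | simp add: L)+
  have 3: "?P w x y (emb z) = ?Q w x y (emb z)" for w x y z
    by (rule linear_eq_on_axes[where F = "\<lambda>y. ?P w x y (emb z)" and G = "\<lambda>y. ?Q w x y (emb z)"])
      (rule 2[of _ _ "axis _ 1", unfolded emb_axis] | simp add: L)+
  show ?thesis
    by (rule linear_eq_on_axes[where F = "\<lambda>z. ?P w x y z" and G = "\<lambda>z. ?Q w x y z"])
      (rule 3[of _ _ _ "axis _ 1", unfolded emb_axis] | simp add: L)+
qed

lemma alg_closure_assoc: "TE (crE x y) z = TE x (crE y z)"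
proof -
  note L = crE_lin TE_lin
  have 0: "TE (crE (emb x) (emb y)) (emb z) = TE (emb x) (crE (emb y) (emb z))" for x y z
    by (simp add: crE_emb TE_emb T_X)
  have 1: "TE (crE x (emb y)) (emb z) = TE x (crE (emb y) (emb z))" for x y z
    by (rule linear_form_eq_on_axes[where F = "\<lambda>x. TE (crE x (emb y)) (emb z)"])
      (rule 0[of "axis _ 1", unfolded emb_axis] | simp add: L)+
  have 2: "TE (crE x y) (emb z) = TE x (crE y (emb z))" for x y z
    by (rule linear_form_eq_on_axes[where F = "\<lambda>y. TE (crE x y) (emb z)"])
      (rule 1[of _ "axis _ 1", unfolded emb_axis] | simp add: L)+
  show ?thesis
    by (rule linear_form_eq_on_axes[where F = "\<lambda>z. TE (crE x y) z"])
      (rule 2[of _ _ "axis _ 1", unfolded emb_axis] | simp add: L)+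
qed

lemma cubic_alg_closure: "cubic crE TE (emb e)"
proof
  show "(2 :: 'a alg_closure) \<noteq> 0" "(3 :: 'a alg_closure) \<noteq> 0"
    using two three by (metis to_ac_numeral to_ac_eq_0_iff)+
  have 1: "crE x (emb y) = crE (emb y) x" for x and y :: "'a ^ 'n"
    by (rule linear_eq_on_axes) (simp_all add: crE_lin emb_axis[symmetric] crE_emb X_commute[of y])
  show "crE x y = crE y x" for x y
    by (rule linear_eq_on_axes[of "\<lambda>y. crE x y" "\<lambda>y. crE y x"])
      (rule 1[of _ "axis _ 1", unfolded emb_axis] | simp add: crE_lin)+
  have 2: "TE x (emb y) = TE (emb y) x" for x and y :: "'a ^ 'n"
    by (rule linear_form_eq_on_axes) (simp_all add: TE_lin emb_axis[symmetric] TE_emb T_commute[of y])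
  show "TE x y = TE y x" for x y
    by (rule linear_form_eq_on_axes[of "\<lambda>y. TE x y" "\<lambda>y. TE y x"])
      (rule 2[of _ "axis _ 1", unfolded emb_axis] | simp add: TE_lin)+
  show "crE (emb e) x = TE x (emb e) *s emb e - x" for x
  proof (rule linear_eq_on_axes[where F = "\<lambda>x. crE (emb e) x"])
    show "crE (emb e) (axis i 1) = TE (axis i 1) (emb e) *s emb e - axis i 1" for i
      unfolding emb_axis[symmetric] crE_emb TE_emb emb_lin[symmetric] X_unit ..
  qed (simp_all add: crE_lin TE_lin vec_eq_iff algebra_simps)
  show "TE (emb e) (emb e) = 3" by (simp add: TE_emb T_unit)
qed (fact crE_lin TE_lin alg_closure_four alg_closure_assoc)+

end

context cubic_div
begin

lemma split_alg_closure: "split_cubic cr T e crE TE (emb e) to_ac"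
proof -
  interpret E: cubic crE TE "emb e" by (rule cubic_alg_closure)
  show ?thesis
    by unfold_locales (simp_all add: to_ac_add to_ac_mult emb_def[symmetric] crE_emb TE_emb)
qed

lemma split_field_exists:
  assumes m: "m \<notin> scal"
  obtains a b c p q r where "split_field cr T e crE TE (emb e) to_ac m a b c p q r"
proof -
  interpret split_cubic cr T e crE TE "emb e" to_ac by (rule split_alg_closure)
  obtain a b c p q r where "E.frm a b c" "em m = p *s a + q *s b + r *s c" "p \<noteq> q" "q \<noteq> r" "r \<noteq> p"
    "\<exists>k k' k''. a = k *s em e + k' *s em m + k'' *s em (sh m)"
    "\<exists>k k' k''. b = k *s em e + k' *s em m + k'' *s em (sh m)"
    "\<exists>k k' k''. c = k *s em e + k' *s em m + k'' *s em (sh m)"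
    by (rule frame_exists[OF m])
  then have "split_field cr T e crE TE (emb e) to_ac m a b c p q r" by unfold_locales (use m in auto)
  then show thesis by (rule that)
qed

end

section \<open>Jordan multiplication, and the representation on the complement of a
  subalgebra\<close>

context cubic_div
begin

lemma T_jp: "T (jp x y) z = T y (jp x z)"
  unfolding jp_def
  by (simp add: bilin T_X_unit T_X[of x y z] T_commute[of "y" "x \<bowtie> z"] T_X_left[of x y z] T_commute[of e z] T_commute[of y x] algebra_simps)

lemma T_act: "T (act x y) z = T y (act x z)"
  by (simp add: act_def bilin) (metis T_X X_commute)

lemma U_gen: "x \<in> gen m \<Longrightarrow> y \<in> gen m \<Longrightarrow> U x y \<in> gen m"
  unfolding U_def by (intro gen_intros gen_X gen_sh)

lemma jp_self: "jp x x = sh x + T x e *s x - T (sh x) e *s e"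
proof (rule scale_cancel[OF two])
  show "2 *s jp x x = 2 *s (sh x + T x e *s x - T (sh x) e *s e)"
    using two by (simp add: jp_def X_self bilin vec_eq_iff algebra_simps)
qed

lemma two_jp: "2 *s jp x y = x \<bowtie> y + T x e *s y + T y e *s x - T (x \<bowtie> y) e *s e"
  using two by (simp add: jp_def)

lemma X_X_left: "x \<bowtie> (x \<bowtie> y) = T x e *s ((T x e * T y e - T x y) *s e - x \<bowtie> y) + T y e *s (T (sh x) e *s e - sh x)
    - sh x \<bowtie> y - T (sh x) e *s y - T (sh x) y *s e - (T x e * T y e - T x y) *s x"
  using X_X_same[of x e y]
  by (simp add: X_unit X_unit_right bilin T_X_unit T_commute[of e y]) (simp add: vec_eq_iff algebra_simps)

lemma U_jp: "U x y = 2 *s jp x (jp x y) - jp (jp x x) y"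
proof (rule scale_cancel[OF two])
  have t: "T x x = T x e * T x e - 2 * T (sh x) e"
    using T_X_unit[of x x] by (simp add: X_self bilin)
  have "2 *s (2 *s jp x (jp x y) - jp (jp x x) y)
    = 2 *s (jp x (2 *s jp x y)) - 2 *s jp (jp x x) y"
    by (simp add: jp_lin vec.scale_right_diff_distrib)
  also have "\<dots> = 2 *s U x y"
    unfolding two_jp jp_self U_def
    by (simp add: two_jp bilin X_unit X_unit_right T_unit T_X_unit X_X_left X_self T_X_self t)
      (simp add: vec_eq_iff algebra_simps)
  finally show "2 *s U x y = 2 *s (2 *s jp x (jp x y) - jp (jp x x) y)" by simp
qed

lemma gen_span: "gen m = vec.span {e, m, sh m}"
proof
  show "gen m \<subseteq> vec.span {e, m, sh m}"
    unfolding gen_def by (clarify, intro vec.span_add vec.span_scale vec.span_base) auto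
  show "vec.span {e, m, sh m} \<subseteq> gen m"
    by (rule vec.span_minimal) (auto simp: subspace_gen gen_unit gen_self gen_sh_self)
qed

lemma dim_gen: assumes m: "m \<notin> scal" shows "vec.dim (gen m) = 3"
proof -
  note fi = field_independent[OF m]
  have d: "e \<noteq> m" "e \<noteq> sh m" "m \<noteq> sh m"
    using fi[of 1 "-1" 0] fi[of 1 0 "-1"] fi[of 0 1 "-1"] by auto
  have "vec.independent {e, m, sh m}"
  proof (rule vec.independent_if_scalars_zero)
    fix f x assume s: "(\<Sum>x\<in>{e, m, sh m}. f x *s x) = 0" and x: "x \<in> {e, m, sh m}"
    have "f e *s e + f m *s m + f (sh m) *s sh m = 0" using s d by (simp add: add.assoc)
    then show "f x = 0" using fi x by blast
  qed simp
  then have "vec.dim (gen m) = card {e, m, sh m}" unfolding gen_span by (rule vec.dim_span_eq_card_independent)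
  then show ?thesis using d by simp
qed

lemma gen_eq: assumes "m' \<in> gen m" "m' \<notin> scal" "m \<notin> scal" shows "gen m' = gen m"
proof -
  have "gen m' \<subseteq> gen m"
    unfolding gen_span[of m'] using assms(1)
    by (intro vec.span_minimal subspace_gen) (auto simp: gen_unit gen_sh)
  then show ?thesis
    using vec.subspace_dim_equal[OF subspace_gen subspace_gen] dim_gen assms by simp
qed

lemma vert_eq: assumes "gen m' = gen m" shows "vert m' = vert m"
  using assms vert_gen vertI by (metis subsetI subset_antisym)

text \<open>On every Peirce component both sides multiply by the same product of coordinates. For
  general subalgebras only the symmetrised rule \<open>rep\<close> is available.\<close>

lemma act_act:
  assumes m: "m \<notin> scal" and l: "l \<in> gen m" "k \<in> gen m" and x: "x \<in> vert m"
  shows "act l (act k x) = act (jp l k) x"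
proof -
  obtain a b c p q r where sf: "split_field cr T e crE TE (emb e) to_ac m a b c p q r"
    by (rule split_field_exists[OF m])
  interpret split_field cr T e crE TE "emb e" to_ac m a b c p q r by (rule sf)
  interpret B: split_field cr T e crE TE "emb e" to_ac m b c a q r p by (rule rotate)
  interpret C: split_field cr T e crE TE "emb e" to_ac m c a b r p q by (rule B.rotate)
  show ?thesis
    by (rule cmp_eqI) (simp_all add: act_vert gen_jp l x cmp_act' B.cmp_act' C.cmp_act' coe_jp B.coe_jp C.coe_jp)
qed

lemma act_unit: "T x e = 0 \<Longrightarrow> act e x = x"
  by (simp add: act_def X_unit)

lemma vert_unit: "x \<in> vert m \<Longrightarrow> T x e = 0"
  by (simp add: vert_def)

text \<open>The derivative at y in direction x of y^3 - T(y) y^2 + T(y#) y - N(y) e = 0: the left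
  side varies the powers, the right side the coefficients.\<close>

lemma phi:
  "2 *s jp (jp y y) x + U y x - T y e *s (2 *s jp y x) + T (sh y) e *s x
    = T x e *s sh y + T y x *s y + (T (sh y) x - T (sh y) e * T x e) *s e"
proof -
  have t: "T (y \<bowtie> x) e = T y e * T x e - T y x" "T (sh y \<bowtie> x) e = T (sh y) e * T x e - T (sh y) x"
    by (simp_all add: T_X_unit)
  show ?thesis unfolding two_jp jp_self U_def
    by (simp add: bilin X_unit T_unit t) (simp add: vec_eq_iff algebra_simps)
qed

text \<open>By \<open>phi\<close> and the independence of e, m, m#, the three traces of x against
  them vanish. This tests membership in V by an expression that can be evaluated in a special
  representation.\<close>

lemma phi_vert:
  assumes "m \<notin> scal" "2 *s jp (jp m m) x + U m x - T m e *s (2 *s jp m x) + T (sh m) e *s x = 0"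
  shows "x \<in> vert m"
proof -
  have "(T (sh m) x - T (sh m) e * T x e) *s e + T m x *s m + T x e *s sh m = 0"
    using assms(2) unfolding phi by (simp add: algebra_simps)
  from field_independent[OF assms(1) this] show ?thesis by (simp add: vert_def T_commute[of x])
qed

end

locale subalg = cubic_div +
  fixes S
  assumes sub: "vec.subspace S" and S_unit: "e \<in> S" and S_X: "s \<in> S \<Longrightarrow> t \<in> S \<Longrightarrow> s \<bowtie> t \<in> S"
begin

definition "Y = {y. \<forall>s\<in>S. T y s = 0}"

lemma YD: "y \<in> Y \<Longrightarrow> s \<in> S \<Longrightarrow> T y s = 0"
  by (simp add: Y_def)

lemma subspace_Y: "vec.subspace Y"
  by (auto simp: vec.subspace_def Y_def bilin)

lemmas S_add = vec.subspace_add[OF sub]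
lemmas S_scale = vec.subspace_scale[OF sub]
lemmas S_diff = vec.subspace_diff[OF sub]
lemmas S_minus = vec.subspace_neg[OF sub]
lemmas S_zero = vec.subspace_0[OF sub]
lemmas Y_add = vec.subspace_add[OF subspace_Y]
lemmas Y_scale = vec.subspace_scale[OF subspace_Y]
lemmas Y_diff = vec.subspace_diff[OF subspace_Y]
lemma S_sh: "s \<in> S \<Longrightarrow> sh s \<in> S"
  unfolding sh_def by (intro S_scale S_X)

lemma S_jp: "s \<in> S \<Longrightarrow> t \<in> S \<Longrightarrow> jp s t \<in> S"
  unfolding jp_def by (intro S_scale S_add S_diff S_X S_unit)

lemma S_U: "s \<in> S \<Longrightarrow> t \<in> S \<Longrightarrow> U s t \<in> S"
  unfolding U_def by (intro S_scale S_diff S_X S_sh)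

lemma S_invL: "s \<in> S \<Longrightarrow> invL s \<in> S"
  unfolding invL_def by (intro S_scale S_sh)

lemma S_act: "s \<in> S \<Longrightarrow> t \<in> S \<Longrightarrow> act s t \<in> S"
  unfolding act_def by (intro S_minus S_X)

lemma gen_S: assumes "m \<in> S" shows "gen m \<subseteq> S"
  unfolding gen_span using assms by (intro vec.span_minimal sub) (auto simp: S_unit S_sh)

lemma Y_vert: "m \<in> S \<Longrightarrow> y \<in> Y \<Longrightarrow> y \<in> vert m"
  using vertI gen_S YD by blast

lemma act_Y: "s \<in> S \<Longrightarrow> y \<in> Y \<Longrightarrow> act s y \<in> Y"
  unfolding Y_def by (simp add: T_act S_act)

lemma Y_unit: "y \<in> Y \<Longrightarrow> act e y = y"
  by (rule act_unit) (rule YD[OF _ S_unit])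

text \<open>\<open>X_four\<close> at e, s, t, y, where all traces of y against S vanish. So
  \<open>act\<close> is a special representation of S: Jordan products become symmetrised products
  of operators on Y.\<close>

lemma rep:
  assumes s: "s \<in> S" and t: "t \<in> S" and y: "y \<in> Y"
  shows "act s (act t y) + act t (act s y) = act (2 *s jp s t) y"
proof -
  have z: "T y e = 0" "T e y = 0" "T s y = 0" "T t y = 0" "T (s \<bowtie> t) y = 0"
    using YD[OF y S_unit] YD[OF y S_X[OF s t]] YD[OF y s] YD[OF y t] by (simp_all add: T_commute)
  show ?thesis
    unfolding act_def two_jp
    using X_four[of e s t y]
    by (simp add: z X_unit bilin T_X_unit T_commute[of e t]) (simp add: z X_commute[of y] vec_eq_iff algebra_simps)
qed

lemma rep_sq:
  assumes s: "s \<in> S" and y: "y \<in> Y"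
  shows "act s (act s y) = act (jp s s) y"
proof (rule scale_cancel[OF two])
  have "2 *s act s (act s y) = act s (act s y) + act s (act s y)" by (simp add: vec_eq_iff)
  then show "2 *s act s (act s y) = 2 *s act (jp s s) y" using rep[OF s s y] by (simp only: act_lin)
qed

text \<open>U s t = 2 s (s t) - s^2 t in Jordan products. Expanding both by \<open>rep\<close>,
  everything except the operator product s t s cancels.\<close>

lemma rep_U:
  assumes s: "s \<in> S" and t: "t \<in> S" and y: "y \<in> Y"
  shows "act (U s t) y = act s (act t (act s y))"
proof (rule scale_cancel[OF two])
  have j: "2 *s jp s t \<in> S" "jp s s \<in> S" by (rule S_scale[OF S_jp[OF s t]], rule S_jp[OF s s])
  have 1: "act s (act t (act s y)) + act t (act s (act s y)) = act (2 *s jp s t) (act s y)"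
    by (rule rep[OF s t act_Y[OF s y]])
  have 2: "act s (act s (act t y)) + act s (act t (act s y)) = act s (act (2 *s jp s t) y)"
    using rep[OF s t y] by (metis act_lin(1))
  have ss: "act s (act s u) = act (jp s s) u" if "u \<in> Y" for u
    by (rule rep_sq[OF s that])
  have 3: "act (2 *s jp s t) (act s y) + act s (act (2 *s jp s t) y) = act (2 *s (jp (2 *s jp s t) s)) y"
    by (rule rep[OF j(1) s y])
  have 4: "act (jp s s) (act t y) + act t (act (jp s s) y) = act (2 *s jp (jp s s) t) y"
    by (rule rep[OF j(2) t y])
  have 5: "act (2 *s (jp (2 *s jp s t) s)) y
      = (act s (act t (act s y)) + act t (act s (act s y))) + (act s (act s (act t y)) + act s (act t (act s y)))"
    by (simp only: 1 2 3)
  have 6: "act (2 *s jp (jp s s) t) y = act s (act s (act t y)) + act t (act s (act s y))"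
    by (simp only: 4[symmetric] ss[OF y] ss[OF act_Y[OF t y]])
  have "2 *s act s (act t (act s y)) = act (2 *s (jp (2 *s jp s t) s)) y - act (2 *s jp (jp s s) t) y"
    unfolding 5 6 by (simp add: vec_eq_iff)
  also have "\<dots> = act (2 *s U s t) y"
    unfolding U_jp jp_commute[of "2 *s jp s t" s] jp_lin act_lin vec.scale_right_diff_distrib ..
  finally show "2 *s act (U s t) y = 2 *s act s (act t (act s y))" by (simp only: act_lin)
qed

lemma act_sh: assumes s: "s \<in> S" and y: "y \<in> Y"
  shows "act (sh s) (act s y) = Nm s *s y"
  using sh_X_sh[of s y] YD[OF y S_sh[OF s]] by (simp add: act_def bilin T_commute[of "sh s"])

lemma act_sh': assumes s: "s \<in> S" and y: "y \<in> Y"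
  shows "act s (act (sh s) y) = Nm s *s y"
proof -
  have sh: "act (sh s) u = act s (act s u) - T s e *s act s u + T (sh s) e *s u" if "u \<in> Y" for u
    using that by (simp add: rep_sq[OF s] jp_self act_lin Y_unit)
  show ?thesis using act_sh[OF s y] unfolding sh[OF y] sh[OF act_Y[OF s y]] by (simp add: act_lin)
qed

lemma act_invL: assumes s: "s \<in> S" "s \<noteq> 0" and y: "y \<in> Y"
  shows "act (invL s) (act s y) = y" "act s (act (invL s) y) = y"
proof -
  have "Nm s \<noteq> 0" using s aniso by blast
  then show "act (invL s) (act s y) = y" "act s (act (invL s) y) = y"
    using act_sh[OF s(1) y] act_sh'[OF s(1) y] by (simp_all add: invL_def act_lin)
qed

text \<open>Nonzero elements of S act invertibly, so an element of S is determined by its effect on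
  a single nonzero vector of Y. Identities in S are later proved by evaluating them on one such
  vector.\<close>

lemma rep_inj: assumes "s \<in> S" "t \<in> S" "y \<in> Y" "y \<noteq> 0" "act s y = act t y" shows "s = t"
proof (rule ccontr)
  assume "s \<noteq> t"
  then have "act (invL (s - t)) (act (s - t) y) = y"
    using assms by (intro act_invL S_diff) auto
  moreover have "act (s - t) y = 0" using assms(5) by (simp add: act_lin)
  ultimately show False using assms(4) by (simp add: act_lin)
qed

lemma S_Y: "\<exists>s\<in>S. x - s \<in> Y"
proof -
  have "\<exists>s\<in>S. \<forall>t\<in>S. T (x - s) t = 0"
    by (rule orth_decomp[OF sub]) (use T_sh_nonzero S_sh in blast)
  then show ?thesis by (simp add: Y_def)
qed

end

section \<open>Splitting x = z + z* on the complement of the subalgebra generated by L and x\<close>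

text \<open>The automorphism \<tau> is given by its effect on coordinates, a cyclic shift; that it
  respects e and products follows by comparing coordinates.\<close>

locale twisted = split_field +
  fixes x and \<tau>
  assumes x: "x \<in> vert m" and qx: "prL m (x \<bowtie> x) \<noteq> 0"
    and tau_gen: "\<And>l. l \<in> gen m \<Longrightarrow> \<tau> l \<in> gen m"
    and tau_a: "\<And>l. l \<in> gen m \<Longrightarrow> coe a (\<tau> l) = coe c l"
    and tau_b: "\<And>l. l \<in> gen m \<Longrightarrow> coe b (\<tau> l) = coe a l"
    and tau_c: "\<And>l. l \<in> gen m \<Longrightarrow> coe c (\<tau> l) = coe b l"
begin

lemma rot1: "twisted cr T e crE TE eE io m b c a q r p x \<tau>"
  using rotate x qx tau_gen tau_a tau_b tau_c by (simp add: twisted_def twisted_axioms_def)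

lemma rot2: "twisted cr T e crE TE eE io m c a b r p q x \<tau>"
  by (rule twisted.rot1[OF rot1])

definition "Qx = - prL m (sh x)"
definition "bx = sh x - prL m (sh x)"

lemma Qx_gen: "Qx \<in> gen m" unfolding Qx_def by (intro gen_minus prL(1))
lemma bx: "bx \<in> vert m" unfolding bx_def by (rule prL(2))

lemma coe_Qx: "coe a Qx = E.nrm (cmp a x)"
  unfolding Qx_def sh_def prL_scale coe_lin coe_prL_X[OF x x] E.nrm_def
  by (simp add: io_divide io_one io_numeral)

lemma cmp_bx: "cmp a bx = cmp b x \<otimes>\<^sub>E cmp c x"
proof -
  have "bx = inverse 2 *s vX m x x" by (simp add: bx_def vX_def sh_def prL_scale vec.scale_right_diff_distrib)
  then have "cmp a bx = io (inverse 2) *s (cmp b x \<otimes>\<^sub>E cmp c x + cmp b x \<otimes>\<^sub>E cmp c x)"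
    by (simp only: cmp_lin cmp_vX'[OF x x] E.X_commute[of "cmp c x" "cmp b x"])
  also have "\<dots> = cmp b x \<otimes>\<^sub>E cmp c x"
    using E.two by (simp add: vec_eq_iff io_divide io_one io_numeral)
  finally show ?thesis .
qed

lemma io_n: "io (Nm x) = TE (cmp a x) (cmp b x \<otimes>\<^sub>E cmp c x)"
  using E.Nm_frame[OF f peirce_cmp_all[OF x], of 0 0 0] by (simp add: em_Nm[symmetric] em_vert[OF x])

lemma tau_eq: "l \<in> gen m \<Longrightarrow> \<tau> (\<tau> (\<tau> l)) = l"
  by (rule coe_eqI) (simp_all add: tau_gen tau_a tau_b tau_c)

lemma tau_jp: "l \<in> gen m \<Longrightarrow> k \<in> gen m \<Longrightarrow> \<tau> (jp l k) = jp (\<tau> l) (\<tau> k)"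
  by (rule coe_eqI) (simp_all add: tau_gen tau_a gen_jp coe_jp
     split_field.coe_jp[OF rotate] split_field.coe_jp[OF split_field.rotate[OF rotate]])

lemma tau_unit: "\<tau> e = e"
  by (rule coe_eqI) (simp_all add: tau_gen gen_unit tau_a coe_unit
    split_field.coe_unit[OF split_field.rotate[OF rotate]])

lemma aa: "l \<in> gen m \<Longrightarrow> k \<in> gen m \<Longrightarrow> y \<in> vert m \<Longrightarrow> act l (act k y) = act (jp l k) y"
  by (rule act_act[OF m])

definition "SS = {l + act l' x + act l'' bx | l l' l''. l \<in> gen m \<and> l' \<in> gen m \<and> l'' \<in> gen m}"

lemma SSI: "l \<in> gen m \<Longrightarrow> l' \<in> gen m \<Longrightarrow> l'' \<in> gen m \<Longrightarrow> l + act l' x + act l'' bx \<in> SS"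
  by (auto simp: SS_def)

lemma subspace_SS: "vec.subspace SS"
  unfolding vec.subspace_def
proof (intro conjI ballI allI)
  show "0 \<in> SS" using SSI[of 0 0 0] by (simp add: gen_zero act_lin)
  fix s t k assume "s \<in> SS"
  then obtain l l' l'' where s: "s = l + act l' x + act l'' bx" "l \<in> gen m" "l' \<in> gen m" "l'' \<in> gen m"
    by (auto simp: SS_def)
  show "k *s s \<in> SS" using SSI[of "k *s l" "k *s l'" "k *s l''"] s
    by (simp add: gen_scale act_lin vec.scale_right_distrib)
  assume "t \<in> SS"
  then obtain k k' k'' where t: "t = k + act k' x + act k'' bx" "k \<in> gen m" "k' \<in> gen m" "k'' \<in> gen m"
    by (auto simp: SS_def)
  show "s + t \<in> SS" using SSI[of "l + k" "l' + k'" "l'' + k''"] s t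
    by (simp add: gen_add act_lin add_ac)
qed

lemmas SS_add = vec.subspace_add[OF subspace_SS]
lemmas SS_diff = vec.subspace_diff[OF subspace_SS]
lemmas SS_minus = vec.subspace_neg[OF subspace_SS]
lemmas SS_scale = vec.subspace_scale[OF subspace_SS]

lemma SS_gen: "l \<in> gen m \<Longrightarrow> l \<in> SS"
  using SSI[of l 0 0] by (simp add: gen_zero act_lin)
lemma SS_x: "l \<in> gen m \<Longrightarrow> act l x \<in> SS"
  using SSI[of 0 l 0] by (simp add: gen_zero act_lin)
lemma SS_bx: "l \<in> gen m \<Longrightarrow> act l bx \<in> SS"
  using SSI[of 0 0 l] by (simp add: gen_zero act_lin)

text \<open>This and the next two lemmas are the V-parts of the multiplication table of L + L x + L
  b, with b the V-part of x#. The a-component suffices; \<open>rot1\<close> and \<open>rot2\<close>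
  give the others.\<close>

lemma x_x_a: assumes "l \<in> gen m" "k \<in> gen m"
  shows "cmp a (vX m (act l x) (act k x)) = cmp a (act (l \<bowtie> k) bx)"
  using assms by (simp add: cmp_vX' act_vert x bx cmp_act' gen_X coe_X cmp_bx split_field.cmp_act'[OF rotate]
      split_field.cmp_act'[OF split_field.rotate[OF rotate]] E.bilin)
    (simp add: E.X_commute[of "cmp c x" "cmp b x"] vec_eq_iff algebra_simps)

lemma x_b_a: assumes "l \<in> gen m" "k \<in> gen m"
  shows "cmp a (vX m (act l x) (act k bx)) = cmp a (act (jp Qx l \<bowtie> k) x)"
proof -
  note P = peirce_cmp_all[OF x]
  have 1: "cmp b x \<otimes>\<^sub>E (cmp b x \<otimes>\<^sub>E cmp a x) = E.nrm (cmp b x) *s cmp a x"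
    using E.X_X_peirce[OF E.frm_flip[OF fb] E.peirce_swap[OF P(2)] E.peirce_swap[OF P(1)]] .
  have 2: "cmp c x \<otimes>\<^sub>E (cmp c x \<otimes>\<^sub>E cmp a x) = E.nrm (cmp c x) *s cmp a x"
    using E.X_X_peirce[OF fc P(3) P(1)] .
  show ?thesis
    using assms by (simp add: cmp_vX' act_vert x bx cmp_act' gen_X gen_jp Qx_gen coe_X twisted.cmp_bx[OF rot1] twisted.cmp_bx[OF rot2]
      split_field.cmp_act'[OF rotate] split_field.cmp_act'[OF split_field.rotate[OF rotate]]
      split_field.coe_jp[OF rotate] split_field.coe_jp[OF split_field.rotate[OF rotate]]
      twisted.coe_Qx[OF rot1] twisted.coe_Qx[OF rot2] E.bilin)
     (simp add: 1[unfolded E.X_commute[of "cmp b x" "cmp a x"]] 2 vec_eq_iff algebra_simps)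
qed

lemma b_b_a: assumes "l \<in> gen m" "k \<in> gen m"
  shows "cmp a (vX m (act l bx) (act k bx)) = cmp a (Nm x *s act (l \<bowtie> k) x - act (jp (l \<bowtie> k) Qx) bx)"
proof -
  note P = peirce_cmp_all[OF x]
  have 1: "(cmp a x \<otimes>\<^sub>E cmp b x) \<otimes>\<^sub>E (cmp a x \<otimes>\<^sub>E cmp c x)
     = io (Nm x) *s cmp a x - E.nrm (cmp a x) *s (cmp b x \<otimes>\<^sub>E cmp c x)"
    using E.X_X_X_peirce[OF f P] by (simp add: io_n E.T_X)
  show ?thesis
    using assms by (simp add: cmp_vX' act_vert x bx cmp_act' gen_X gen_jp Qx_gen coe_X coe_jp cmp_bx twisted.cmp_bx[OF rot1] twisted.cmp_bx[OF rot2]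
      split_field.cmp_act'[OF rotate] split_field.cmp_act'[OF split_field.rotate[OF rotate]] cmp_lin coe_Qx E.bilin)
     (simp add: 1 1[unfolded E.X_commute[of "cmp a x \<otimes>\<^sub>E cmp b x"]] E.X_commute[of "cmp c x" "cmp a x"] vec_eq_iff algebra_simps)
qed

lemma vX_eqI: 
  assumes "cmp a (vX m u w) = cmp a z" "cmp b (vX m u w) = cmp b z" "cmp c (vX m u w) = cmp c z" "z \<in> vert m"
  shows "u \<bowtie> w = prL m (u \<bowtie> w) + z"
proof -
  have "vX m u w = z" by (rule cmp_eqI[OF vX_vert assms(4) assms(1-3)])
  then show ?thesis by (simp add: vX_def algebra_simps)
qed

lemma SS_X: assumes "s \<in> SS" "t \<in> SS" shows "s \<bowtie> t \<in> SS"
proof -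
  from assms(1) obtain l l' l'' where s: "s = l + act l' x + act l'' bx" and l: "l \<in> gen m" "l' \<in> gen m" "l'' \<in> gen m"
    by (auto simp: SS_def)
  from assms(2) obtain k k' k'' where t: "t = k + act k' x + act k'' bx" and k: "k \<in> gen m" "k' \<in> gen m" "k'' \<in> gen m"
    by (auto simp: SS_def)
  have gx: "l \<bowtie> act k x \<in> SS" "l \<bowtie> act k bx \<in> SS" if "l \<in> gen m" "k \<in> gen m" for l k
  proof -
    have "l \<bowtie> act k x = - act (jp l k) x" "l \<bowtie> act k bx = - act (jp l k) bx"
      using that by (simp_all add: aa[symmetric] x bx act_def[of l])
    then show "l \<bowtie> act k x \<in> SS" "l \<bowtie> act k bx \<in> SS" using that by (simp_all add: SS_minus SS_x SS_bx gen_jp)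
  qed
  have xx: "act l x \<bowtie> act k x \<in> SS" if "l \<in> gen m" "k \<in> gen m" for l k
    using vX_eqI[OF x_x_a[OF that] twisted.x_x_a[OF rot1 that] twisted.x_x_a[OF rot2 that]] that
    by (metis SS_add SS_gen SS_bx prL(1) gen_X bx act_vert)
  have xb: "act l x \<bowtie> act k bx \<in> SS" if "l \<in> gen m" "k \<in> gen m" for l k
    using vX_eqI[OF x_b_a[OF that] twisted.x_b_a[OF rot1 that] twisted.x_b_a[OF rot2 that]] that
    by (metis SS_add SS_gen SS_x prL(1) gen_X gen_jp Qx_gen x act_vert)
  have bb: "act l bx \<bowtie> act k bx \<in> SS" if lk: "l \<in> gen m" "k \<in> gen m" for l k
  proof -
    let ?z = "Nm x *s act (l \<bowtie> k) x - act (jp (l \<bowtie> k) Qx) bx"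
    have g: "l \<bowtie> k \<in> gen m" "jp (l \<bowtie> k) Qx \<in> gen m" using lk by (auto intro: gen_X gen_jp Qx_gen)
    have "?z \<in> vert m" using g by (intro vert_diff vert_scale act_vert x bx)
    moreover have "?z \<in> SS" using g by (intro SS_diff SS_scale SS_x SS_bx)
    ultimately show ?thesis
      using vX_eqI[OF b_b_a[OF that] twisted.b_b_a[OF rot1 that] twisted.b_b_a[OF rot2 that]]
      by (metis SS_add SS_gen prL(1))
  qed
  show ?thesis unfolding s t X_add X_add_right
    using gx xx xb bb l k X_commute SS_gen[OF gen_X] by (intro SS_add) metis+
qed

lemma subalg_SS: "subalg cr T e SS"
  by unfold_locales (simp_all add: subspace_SS SS_gen gen_unit SS_X)

end

sublocale twisted \<subseteq> subalg cr T e SS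
  by (rule subalg_SS)

context twisted
begin

text \<open>The a-component of \<open>act x y\<close> is - x_b y_c - x_c y_b; \<open>zz\<close>
  keeps the first product and \<open>zs\<close> the second. Replacing x by m x weights them with q
  and r, and subtracting \<tau>(m) times the original, i.e. r times it, leaves q - r times the
  first. The a-coordinate of \<tau>^2(m) - \<tau>(m) is q - r.\<close>

definition "zz y = act (invL (\<tau> (\<tau> m) - \<tau> m)) (act (act m x) y - act (\<tau> m) (act x y))"
definition "zs y = act x y - zz y"

lemma m_S: "m \<in> SS" by (rule SS_gen[OF gen_self])
lemma x_S: "x \<in> SS" using SS_x[OF gen_unit] act_unit[OF vert_unit[OF x]] by simp
lemma bx_S: "bx \<in> SS" using SS_bx[OF gen_unit] act_unit[OF vert_unit[OF bx]] by simp

lemma Yv: "y \<in> Y \<Longrightarrow> y \<in> vert m"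
  by (rule Y_vert[OF m_S])

lemma gen_act_Y: "l \<in> gen m \<Longrightarrow> y \<in> Y \<Longrightarrow> act l y \<in> Y"
  using act_Y SS_gen by blast

lemma vX_Y: assumes "s \<in> SS" "y \<in> Y" shows "prL m (s \<bowtie> y) = 0" "act s y = - vX m s y"
proof -
  have "s \<bowtie> y = - act s y" by (simp add: act_def)
  then show "prL m (s \<bowtie> y) = 0" using prL_vert[OF vert_minus[OF Yv[OF act_Y[OF assms]]]] by simp
  then show "act s y = - vX m s y" by (simp add: vX_def act_def)
qed

lemma cmp_L: "s \<in> SS \<Longrightarrow> s \<in> vert m \<Longrightarrow> y \<in> Y \<Longrightarrow> cmp a (act s y) = - (cmp b s \<otimes>\<^sub>E cmp c y) - cmp c s \<otimes>\<^sub>E cmp b y"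
  by (simp add: vX_Y(2) cmp_lin cmp_vX' Yv)

lemma TE_Y: "s \<in> SS \<Longrightarrow> s \<in> vert m \<Longrightarrow> y \<in> Y \<Longrightarrow> TE (cmp a s) (cmp a y) = 0"
  using coe_prL_X[of s y] vX_Y(1)[of s y] Yv[of y] coe_lin(2)[of a 0 0] by simp

lemma zz_Y: "y \<in> Y \<Longrightarrow> zz y \<in> Y"
  unfolding zz_def by (intro Y_diff gen_act_Y act_Y SS_x x_S invL_gen gen_diff tau_gen gen_self)

lemma zs_Y: "y \<in> Y \<Longrightarrow> zs y \<in> Y"
  unfolding zs_def by (intro Y_diff act_Y x_S zz_Y)

lemma tau_diff: "\<tau> (\<tau> m) - \<tau> m \<in> gen m" "coe a (\<tau> (\<tau> m) - \<tau> m) = q - r" "\<tau> (\<tau> m) - \<tau> m \<noteq> 0"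
proof -
  show 1: "\<tau> (\<tau> m) - \<tau> m \<in> gen m" by (intro gen_diff tau_gen gen_self)
  show 2: "coe a (\<tau> (\<tau> m) - \<tau> m) = q - r"
    by (simp add: coe_lin tau_a tau_c tau_gen gen_self split_field.coe_m[OF rotate] split_field.coe_m[OF split_field.rotate[OF rotate]])
  show "\<tau> (\<tau> m) - \<tau> m \<noteq> 0"
  proof
    assume "\<tau> (\<tau> m) - \<tau> m = 0"
    then have "coe a 0 = q - r" using 2 by simp
    then show False using qr coe_lin(2)[of a 0 0] by simp
  qed
qed

lemma zz_a: assumes y: "y \<in> Y" shows "cmp a (zz y) = - (cmp b x \<otimes>\<^sub>E cmp c y)"
proof -
  have v: "act (act m x) y \<in> vert m" "act (\<tau> m) (act x y) \<in> vert m" "act x y \<in> vert m"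
    using y by (auto intro!: Yv act_Y SS_gen SS_x x_S tau_gen gen_self)
  have 1: "cmp a (act (act m x) y) = - (q *s (cmp b x \<otimes>\<^sub>E cmp c y)) - r *s (cmp c x \<otimes>\<^sub>E cmp b y)"
    by (simp add: cmp_L SS_x gen_self y act_vert x split_field.cmp_act'[OF rotate] split_field.cmp_act'[OF split_field.rotate[OF rotate]]
        split_field.coe_m[OF rotate] split_field.coe_m[OF split_field.rotate[OF rotate]] E.bilin)
  have 2: "cmp a (act (\<tau> m) (act x y)) = r *s (- (cmp b x \<otimes>\<^sub>E cmp c y) - cmp c x \<otimes>\<^sub>E cmp b y)"
    by (simp add: cmp_act' tau_gen gen_self v tau_a split_field.coe_m[OF split_field.rotate[OF rotate]] cmp_L x_S x y)
  have 3: "cmp a (zz y) = inverse (q - r) *s (cmp a (act (act m x) y) - cmp a (act (\<tau> m) (act x y)))"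
    unfolding zz_def using tau_diff v by (simp add: cmp_act' invL_gen vert_diff coe_invL cmp_lin)
  have "cmp a (act (act m x) y) - cmp a (act (\<tau> m) (act x y)) = (q - r) *s (- (cmp b x \<otimes>\<^sub>E cmp c y))"
    unfolding 1 2 by (simp add: vec_eq_iff algebra_simps)
  from 3[unfolded this] show ?thesis using qr by (simp only: vec.scale_scale) simp
qed

lemma zs_a: "y \<in> Y \<Longrightarrow> cmp a (zs y) = - (cmp c x \<otimes>\<^sub>E cmp b y)"
  unfolding zs_def cmp_lin zz_a by (simp add: cmp_L x_S x)

lemmas z_cmp = zz_a zs_a twisted.zz_a[OF rot1] twisted.zs_a[OF rot1] twisted.zz_a[OF rot2] twisted.zs_a[OF rot2]

lemma Y_eqI: "y \<in> Y \<Longrightarrow> y' \<in> Y \<Longrightarrow> cmp a y = cmp a y' \<Longrightarrow> cmp b y = cmp b y' \<Longrightarrow> cmp c y = cmp c y' \<Longrightarrow> y = y'"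
  by (rule cmp_eqI[OF Yv Yv])

lemma actY_a: "l \<in> gen m \<Longrightarrow> y \<in> Y \<Longrightarrow> cmp a (act l y) = coe a l *s cmp a y"
  by (rule cmp_act'[OF _ Yv])

lemmas actY = actY_a twisted.actY_a[OF rot1] twisted.actY_a[OF rot2]

lemma lin: "zz (y + y') = zz y + zz y'" "zz (k *s y) = k *s zz y" "zz (y - y') = zz y - zz y'"
   "zs (y + y') = zs y + zs y'" "zs (k *s y) = k *s zs y" "zs (y - y') = zs y - zs y'"
  by (simp_all add: zz_def zs_def act_lin vec.scale_right_diff_distrib)

lemma zz_act: "l \<in> gen m \<Longrightarrow> y \<in> Y \<Longrightarrow> zz (act l y) = act (\<tau> l) (zz y)"
  by (rule Y_eqI) (simp_all add: zz_Y gen_act_Y tau_gen z_cmp actY tau_a tau_b tau_c E.bilin)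

lemma zs_act: "l \<in> gen m \<Longrightarrow> y \<in> Y \<Longrightarrow> zs (act (\<tau> l) y) = act l (zs y)"
  by (rule Y_eqI) (simp_all add: zs_Y gen_act_Y tau_gen z_cmp actY tau_a tau_b tau_c E.bilin)

lemma XX_next: "y \<in> vert m \<Longrightarrow> cmp c x \<otimes>\<^sub>E (cmp c x \<otimes>\<^sub>E cmp a y) = E.nrm (cmp c x) *s cmp a y"
  using E.X_X_peirce[OF fc peirce_cmp_all(3)[OF x] peirce_cmp_all(1)] .

lemma XX_prev: "y \<in> vert m \<Longrightarrow> cmp b x \<otimes>\<^sub>E (cmp b x \<otimes>\<^sub>E cmp a y) = E.nrm (cmp b x) *s cmp a y"
  using E.X_X_peirce[OF E.frm_flip[OF fb] E.peirce_swap[OF peirce_cmp_all(2)[OF x]] E.peirce_swap[OF peirce_cmp_all(1)]] .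

lemmas XX = XX_next XX_prev twisted.XX_next[OF rot1] twisted.XX_prev[OF rot1] twisted.XX_next[OF rot2] twisted.XX_prev[OF rot2]
lemmas coe_Q = coe_Qx twisted.coe_Qx[OF rot1] twisted.coe_Qx[OF rot2]

lemma zz_zs: "y \<in> Y \<Longrightarrow> zz (zs y) = act (\<tau> (\<tau> Qx)) y"
  by (rule Y_eqI) (simp_all add: zs_Y zz_Y gen_act_Y tau_gen Qx_gen z_cmp actY tau_a tau_b tau_c E.bilin XX Yv coe_Q)

lemma L_x_a: assumes "l \<in> gen m" "y \<in> Y"
  shows "cmp a (act (act l x) y) = cmp a (act (\<tau> (\<tau> l)) (zz y) + zs (act (\<tau> (\<tau> l)) y))"
  using assms by (simp add: cmp_L SS_x act_vert x split_field.cmp_act'[OF rotate] split_field.cmp_act'[OF split_field.rotate[OF rotate]]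
     E.bilin cmp_lin actY zz_Y gen_act_Y tau_gen z_cmp tau_a tau_b tau_c)

lemma L_x: "l \<in> gen m \<Longrightarrow> y \<in> Y \<Longrightarrow> act (act l x) y = act (\<tau> (\<tau> l)) (zz y) + zs (act (\<tau> (\<tau> l)) y)"
  by (rule Y_eqI[OF _ _ L_x_a twisted.L_x_a[OF rot1] twisted.L_x_a[OF rot2]])
    (simp_all add: act_Y SS_x Y_add gen_act_Y zz_Y zs_Y tau_gen)

text \<open>As y is orthogonal to the subalgebra, T(x_b, y_b) and T(x_c, y_c) vanish, and the
  polarised Clifford relation becomes anticommutation: x and y may be exchanged in nested products
  at the cost of a sign.\<close>

lemma bx_swap: assumes y: "y \<in> Y"
  shows "cmp b bx \<otimes>\<^sub>E cmp c y = - (cmp c x \<otimes>\<^sub>E (cmp a x \<otimes>\<^sub>E cmp c y))"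
    "cmp c bx \<otimes>\<^sub>E cmp b y = - (cmp b x \<otimes>\<^sub>E (cmp a x \<otimes>\<^sub>E cmp b y))"
proof -
  note P = peirce_cmp_all[OF x] and PY = peirce_cmp_all[OF Yv[OF y]]
  have t: "TE (cmp b x) (cmp b y) = 0" "TE (cmp c x) (cmp c y) = 0"
    using twisted.TE_Y[OF rot1 x_S x y] twisted.TE_Y[OF rot2 x_S x y] by auto
  have "cmp c x \<otimes>\<^sub>E (cmp c y \<otimes>\<^sub>E cmp a x) + cmp c y \<otimes>\<^sub>E (cmp c x \<otimes>\<^sub>E cmp a x) = 0"
    using E.X_X_peirce_lin[OF fc P(3) PY(3) P(1)] t by simp
  then show "cmp b bx \<otimes>\<^sub>E cmp c y = - (cmp c x \<otimes>\<^sub>E (cmp a x \<otimes>\<^sub>E cmp c y))"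
    unfolding twisted.cmp_bx[OF rot1] 
    by (simp add: E.X_commute[of "cmp c y"] eq_neg_iff_add_eq_0 add.commute)
  have "cmp b x \<otimes>\<^sub>E (cmp b y \<otimes>\<^sub>E cmp a x) + cmp b y \<otimes>\<^sub>E (cmp b x \<otimes>\<^sub>E cmp a x) = 0"
    using E.X_X_peirce_lin'[OF fb P(2) PY(2) P(1)] t by simp
  then show "cmp c bx \<otimes>\<^sub>E cmp b y = - (cmp b x \<otimes>\<^sub>E (cmp a x \<otimes>\<^sub>E cmp b y))"
    unfolding twisted.cmp_bx[OF rot2] 
    by (simp add: E.X_commute[of "cmp b y"] E.X_commute[of "cmp b x" "cmp a x"] eq_neg_iff_add_eq_0 add.commute)
qed

lemma L_b_a: assumes l: "l \<in> gen m" and y: "y \<in> Y"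
  shows "cmp a (act (act l bx) y) = cmp a (act (\<tau> l) (zz (zz y)) + zs (zs (act (\<tau> l) y)))"
  using assms by (simp add: cmp_L SS_bx act_vert bx split_field.cmp_act'[OF rotate] split_field.cmp_act'[OF split_field.rotate[OF rotate]]
     E.bilin cmp_lin actY zz_Y zs_Y gen_act_Y tau_gen z_cmp tau_a tau_b tau_c bx_swap)

lemma L_b: "l \<in> gen m \<Longrightarrow> y \<in> Y \<Longrightarrow> act (act l bx) y = act (\<tau> l) (zz (zz y)) + zs (zs (act (\<tau> l) y))"
  by (rule Y_eqI[OF _ _ L_b_a twisted.L_b_a[OF rot1] twisted.L_b_a[OF rot2]])
    (simp_all add: act_Y SS_bx Y_add gen_act_Y zz_Y zs_Y tau_gen)

text \<open>By \<open>bx_swap\<close> both cubes are expressed through b, the V-part of x#. The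
  polarised Clifford relations for x and b in the b- and c-components give N(x) y twice, and
  \<open>X_four\<close> at x_a, y_a, x_b, x_c gives it once more for the unwanted terms.\<close>

lemma cube_a: assumes y: "y \<in> Y" shows "cmp a (zz (zz (zz y)) + zs (zs (zs y))) = cmp a (Nm x *s y)"
proof -
  note P = peirce_cmp_all[OF x] and PY = peirce_cmp_all[OF Yv[OF y]] and PB = peirce_cmp_all[OF bx]
  have t: "TE (cmp a x) (cmp a y) = 0" "TE (cmp a bx) (cmp a y) = 0"
    using TE_Y[OF x_S x y] TE_Y[OF bx_S bx y] by auto
  have z1: "cmp a (zz (zz (zz y))) = - (cmp b x \<otimes>\<^sub>E (cmp a x \<otimes>\<^sub>E (cmp c x \<otimes>\<^sub>E cmp a y)))"
    by (simp add: z_cmp zz_Y y E.bilin)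
  have z2: "cmp a (zs (zs (zs y))) = - (cmp c x \<otimes>\<^sub>E (cmp a x \<otimes>\<^sub>E (cmp b x \<otimes>\<^sub>E cmp a y)))"
    by (simp add: z_cmp zs_Y y E.bilin)
  have s1: "cmp b bx \<otimes>\<^sub>E cmp a y = - (cmp a x \<otimes>\<^sub>E (cmp c x \<otimes>\<^sub>E cmp a y))"
    using twisted.bx_swap(2)[OF rot2 y] .
  have s2: "cmp c bx \<otimes>\<^sub>E cmp a y = - (cmp a x \<otimes>\<^sub>E (cmp b x \<otimes>\<^sub>E cmp a y))"
    using twisted.bx_swap(1)[OF rot1 y] .
  have n: "TE (cmp b x) (cmp b bx) = io (Nm x)" "TE (cmp c x) (cmp c bx) = io (Nm x)"
    using twisted.io_n[OF rot1] twisted.io_n[OF rot2] twisted.cmp_bx[OF rot1] twisted.cmp_bx[OF rot2] by simp_all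
  have l1: "cmp b x \<otimes>\<^sub>E (cmp b bx \<otimes>\<^sub>E cmp a y) + cmp b bx \<otimes>\<^sub>E (cmp b x \<otimes>\<^sub>E cmp a y) = io (Nm x) *s cmp a y"
    using E.X_X_peirce_lin'[OF fb P(2) PB(2) PY(1)] n by simp
  have l2: "cmp c x \<otimes>\<^sub>E (cmp c bx \<otimes>\<^sub>E cmp a y) + cmp c bx \<otimes>\<^sub>E (cmp c x \<otimes>\<^sub>E cmp a y) = io (Nm x) *s cmp a y"
    using E.X_X_peirce_lin[OF fc P(3) PB(3) PY(1)] n by simp
  have "cmp c bx \<otimes>\<^sub>E (cmp c x \<otimes>\<^sub>E cmp a y) + cmp b bx \<otimes>\<^sub>E (cmp b x \<otimes>\<^sub>E cmp a y) = io (Nm x) *s cmp a y"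
  proof -
    have xy: "cmp a x \<otimes>\<^sub>E cmp a y = 0" using E.X_peirce_same[OF f P(1) PY(1)] t by simp
    have k1: "TE (cmp a y \<otimes>\<^sub>E cmp b x) (cmp c x) = 0"
      using t(2) unfolding cmp_bx by (metis E.T_X E.T_commute)
    have k2: "TE (cmp a x \<otimes>\<^sub>E cmp b x) (cmp c x) = io (Nm x)" by (simp add: io_n E.T_X)
    have "(cmp a x \<otimes>\<^sub>E cmp b x) \<otimes>\<^sub>E (cmp a y \<otimes>\<^sub>E cmp c x) + (cmp a x \<otimes>\<^sub>E cmp c x) \<otimes>\<^sub>E (cmp a y \<otimes>\<^sub>E cmp b x) = io (Nm x) *s cmp a y"
      using E.X_four[of "cmp a x" "cmp a y" "cmp b x" "cmp c x"] by (simp add: xy k1 k2)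
    then show ?thesis unfolding twisted.cmp_bx[OF rot1] twisted.cmp_bx[OF rot2]
      by (simp only: E.X_commute[of "cmp c x" "cmp a x"] E.X_commute[of "cmp a y"])
  qed
  then have "(cmp b x \<otimes>\<^sub>E (cmp a x \<otimes>\<^sub>E (cmp c x \<otimes>\<^sub>E cmp a y)) + cmp c x \<otimes>\<^sub>E (cmp a x \<otimes>\<^sub>E (cmp b x \<otimes>\<^sub>E cmp a y)))
      + io (Nm x) *s cmp a y = 0"
    using l1 l2 unfolding s1 s2 E.bilin by (simp add: vec_eq_iff algebra_simps)
  then show ?thesis unfolding cmp_lin z1 z2
    by (simp only: add_eq_0_iff minus_add_distrib)
qed

lemma cube: "y \<in> Y \<Longrightarrow> zz (zz (zz y)) + zs (zs (zs y)) = Nm x *s y"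
  by (rule Y_eqI[OF _ _ cube_a twisted.cube_a[OF rot1] twisted.cube_a[OF rot2]])
    (simp_all add: Y_add Y_scale zz_Y zs_Y)

end

context subalg
begin

text \<open>If Q vanished on Y, polarisation would make Y totally isotropic for the trace form. As
  y# differs from an element of Y by one of S, T(y, y#) = 3 N(y) would be zero.\<close>

lemma Y_anisotropic: assumes y: "y \<in> Y" "y \<noteq> 0" shows "\<exists>v\<in>Y. prL m (v \<bowtie> v) \<noteq> 0"
proof (rule ccontr)
  assume "\<not> ?thesis"
  then have z: "prL m (v \<bowtie> v) = 0" if "v \<in> Y" for v using that by blast
  have "T u w = 0" if uw: "u \<in> Y" "w \<in> Y" for u w
  proof -
    have "(u + w) \<bowtie> (u + w) = u \<bowtie> u + w \<bowtie> w + 2 *s (u \<bowtie> w)"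
      by (simp add: bilin X_commute[of w u] vec_eq_iff)
    then have "2 *s prL m (u \<bowtie> w) = 0"
      using z[OF Y_add[OF uw]] z[OF uw(1)] z[OF uw(2)] by (simp add: prL_add prL_scale)
    then have "prL m (u \<bowtie> w) = 0" using two by simp
    then have "T (u \<bowtie> w) e = 0" using prL(2)[of "u \<bowtie> w" m] vert_unit by simp
    then show ?thesis using YD[OF uw(1) S_unit] by (simp add: T_X_unit)
  qed
  moreover obtain s where "s \<in> S" "sh y - s \<in> Y" using S_Y by blast
  ultimately have "T y (sh y) = 0" using y(1) YD[OF y(1), of s] by (metis T_diff_right diff_zero)
  then show False using T_sh_nonzero[OF y(2)] by blast
qed

end

section \<open>The skew central operator and the factorisation of s -> z s z* on S\<close>

context twisted
begin

text \<open>z^3 and z*^3 have sum N(x) and product N(Q(x)), so z^3 satisfies X^2 - N(x) X + N(Q(x))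
  = 0. Here \<open>dl\<close> is z^3 minus half the sum, and \<open>dd\<close>, its square, is a
  quarter of the discriminant.\<close>

definition "n2 = Nm x / 2"
definition "dl y = zz (zz (zz y)) - n2 *s y"
definition "dd = n2^2 - Nm Qx"

lemma n2: "Nm x = n2 + n2"
  unfolding n2_def using two by (simp add: field_simps)

lemma dl_Y: "y \<in> Y \<Longrightarrow> dl y \<in> Y"
  unfolding dl_def by (intro Y_diff Y_scale zz_Y)

lemma dl_lin: "dl (y + y') = dl y + dl y'" "dl (y - y') = dl y - dl y'" "dl (k *s y) = k *s dl y"
  by (simp_all add: dl_def lin vec_eq_iff algebra_simps)

lemma dl_zs: "y \<in> Y \<Longrightarrow> dl y = n2 *s y - zs (zs (zs y))"
  using cube[of y] unfolding dl_def n2 vec.scale_left_distrib by (simp add: algebra_simps)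

lemma dl_act_gen: "l \<in> gen m \<Longrightarrow> y \<in> Y \<Longrightarrow> dl (act l y) = act l (dl y)"
  unfolding dl_def by (simp add: zz_act zz_Y tau_gen tau_eq act_lin)

lemma dl_comm_zz: "dl (zz y) = zz (dl y)"
  by (simp add: dl_def lin)

lemma dl_comm_zs: "y \<in> Y \<Longrightarrow> dl (zs y) = zs (dl y)"
  by (simp add: dl_zs zs_Y lin)

lemma dl_S: assumes s: "s \<in> SS" and y: "y \<in> Y" shows "dl (act s y) = act s (dl y)"
proof -
  from s obtain l l' l'' where s: "s = l + act l' x + act l'' bx" "l \<in> gen m" "l' \<in> gen m" "l'' \<in> gen m"
    by (auto simp: SS_def)
  show ?thesis unfolding s(1) act_lin dl_lin
    using s(2-4) y by (simp add: L_x L_b dl_lin dl_act_gen dl_comm_zz dl_comm_zs zz_Y zs_Y gen_act_Y tau_gen dl_Y)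
qed

lemma norm_tau: "jp (\<tau> Qx) (jp Qx (\<tau> (\<tau> Qx))) = Nm Qx *s e"
  by (rule coe_eqI) (simp_all add: gen_jp tau_gen Qx_gen gen_scale gen_unit coe_jp tau_a tau_c coe_lin coe_unit io_Nm)

lemma dl_dl: assumes y: "y \<in> Y" shows "dl (dl y) = dd *s y"
proof -
  have "zz (zz (zz (zs (zs (zs y))))) = act (\<tau> Qx) (act Qx (act (\<tau> (\<tau> Qx)) y))"
    using y by (simp add: zz_zs zs_Y zz_Y zz_act tau_gen Qx_gen gen_act_Y tau_eq)
  also have "\<dots> = act (jp (\<tau> Qx) (jp Qx (\<tau> (\<tau> Qx)))) y"
    using y by (simp add: aa tau_gen Qx_gen gen_jp Yv)
  also have "\<dots> = Nm Qx *s y" unfolding norm_tau using y by (simp add: act_lin Y_unit)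
  finally have 1: "zz (zz (zz (zs (zs (zs y))))) = Nm Qx *s y" .
  have 2: "zz (zz (zz y)) = Nm x *s y - zs (zs (zs y))" using cube[OF y] by (simp add: algebra_simps)
  have "dl (dl y) = zz (zz (zz (n2 *s y - zs (zs (zs y))))) - n2 *s (n2 *s y - zs (zs (zs y)))"
    unfolding dl_zs[OF y] by (simp add: dl_def)
  also have "\<dots> = n2 *s (Nm x *s y - zs (zs (zs y))) - Nm Qx *s y - n2 *s (n2 *s y - zs (zs (zs y)))"
    by (simp add: lin 1 2)
  also have "\<dots> = dd *s y" unfolding n2 by (simp add: dd_def vec_eq_iff algebra_simps power2_eq_square)
  finally show ?thesis .
qed

text \<open>\<open>zs\<close> is the adjoint of \<open>zz\<close> for the trace form: every
  \<open>act s\<close> is selfadjoint, so taking adjoints in the definition of \<open>zz\<close>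
  only reverses products.\<close>

lemma T_zz: assumes y: "y \<in> Y" "y' \<in> Y" shows "T (zz y) y' = T y (zs y')"
proof -
  let ?k = "\<tau> (\<tau> m) - \<tau> m" and ?u = "act (invL (\<tau> (\<tau> m) - \<tau> m)) y'"
  have u: "?u \<in> Y" using y by (intro gen_act_Y invL_gen tau_diff(1))
  have "act (act m x) ?u - act x (act (\<tau> m) ?u) = zs (act (\<tau> (\<tau> m)) ?u) - zs (act (\<tau> m) ?u)"
    using u L_x[OF gen_self u] L_x[OF gen_unit gen_act_Y[OF tau_gen[OF gen_self] u]] act_unit[OF vert_unit[OF x]]
    by (simp add: tau_unit zz_act tau_gen gen_self gen_act_Y Y_unit zz_Y)
  also have "\<dots> = zs (act ?k ?u)" by (simp add: act_lin lin)
  also have "act ?k ?u = y'" using y(2) tau_diff by (intro act_invL SS_gen) auto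
  finally show ?thesis
    unfolding zz_def by (simp add: T_act T_diff T_diff_right[symmetric])
qed

lemma T_dl: assumes y: "y \<in> Y" "y' \<in> Y" shows "T (dl y) y' = - T y (dl y')"
  unfolding dl_zs[OF y(2)] using y by (simp add: dl_def bilin T_zz zz_Y zs_Y)

text \<open>z s z* stays in the subalgebra. By \<open>L_x\<close> and \<open>L_b\<close> the element
  s is a word in z, z* and L; z z* is \<tau>^2(Q(x)), and semilinearity moves all elements of L to
  one side.\<close>

lemma Zmap: assumes s: "s \<in> SS" shows "\<exists>t\<in>SS. \<forall>y\<in>Y. act t y = zz (act s (zs y))"
proof -
  from s obtain l l' l'' where s: "s = l + act l' x + act l'' bx" "l \<in> gen m" "l' \<in> gen m" "l'' \<in> gen m"
    by (auto simp: SS_def)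
  let ?t = "jp (\<tau> l) (\<tau> (\<tau> Qx)) + act (\<tau> (jp l' Qx)) x + act (jp (\<tau> l'') Qx) bx"
  have g: "jp (\<tau> l) (\<tau> (\<tau> Qx)) \<in> gen m" "\<tau> (jp l' Qx) \<in> gen m" "jp (\<tau> l'') Qx \<in> gen m"
    using s(2-4) by (simp_all add: gen_jp tau_gen Qx_gen)
  have "act ?t y = zz (act s (zs y))" if y: "y \<in> Y" for y
  proof -
    have 1: "zz (act l (zs y)) = act (jp (\<tau> l) (\<tau> (\<tau> Qx))) y"
      using y s(2) by (simp add: zz_act zs_Y zz_zs aa tau_gen Qx_gen Yv)
    have zs': "zs (act k u) = act (\<tau> (\<tau> k)) (zs u)" if "k \<in> gen m" "u \<in> Y" for k u
      using zs_act[of "\<tau> (\<tau> k)" u] that by (simp add: tau_gen tau_eq)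
    have 2: "zz (act (act l' x) (zs y)) = act (act (\<tau> (jp l' Qx)) x) y"
      using y s(3) by (simp add: L_x zz_Y zs_Y lin zz_act gen_act_Y tau_gen zz_zs Qx_gen tau_eq tau_jp gen_jp zs'
          aa Yv jp_commute[of "\<tau> (\<tau> Qx)" "\<tau> (\<tau> l')"])
    have 3: "zz (act (act l'' bx) (zs y)) = act (act (jp (\<tau> l'') Qx) bx) y"
      using y s(4) by (simp add: L_b zz_Y zs_Y lin zz_act gen_act_Y tau_gen zz_zs Qx_gen tau_eq tau_jp gen_jp zs'
          aa Yv jp_commute[of l'' "\<tau> (\<tau> Qx)"])
    show ?thesis unfolding s(1) act_lin lin 1 2 3 ..
  qed
  then show ?thesis using SSI[OF g] by blast
qed

text \<open>As operators, \<open>sp\<close> is z^2 + z z* + z*^2 and \<open>eps0\<close> is N(x)/2 +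
  z x z* (\<open>L_sp\<close>, \<open>L_h\<close>). Thus z sp = z^3 + z x z* and sp z* = z x z* +
  z*^3. Since z^3 = N(x)/2 + dl and z*^3 = N(x)/2 - dl, these are eps0 + dl and eps0 - dl.\<close>

definition "sp = \<tau> (\<tau> Qx) + bx"
definition "eps0 = n2 *s e + act (\<tau> Qx) x"

lemma Qx_nonzero: "Qx \<noteq> 0"
  using qx two by (simp add: Qx_def sh_def prL_scale)

lemma sp_S: "sp \<in> SS" unfolding sp_def by (intro SS_add SS_gen bx_S tau_gen Qx_gen)
lemma eps0_S: "eps0 \<in> SS" unfolding eps0_def by (intro SS_add SS_gen SS_x gen_scale gen_unit tau_gen Qx_gen)

lemma tau_nonzero: "l \<in> gen m \<Longrightarrow> l \<noteq> 0 \<Longrightarrow> \<tau> l \<noteq> 0"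
proof
  assume l: "l \<in> gen m" "l \<noteq> 0" and "\<tau> l = 0"
  then have "coe b 0 = coe a l" using tau_b[of l] by simp
  then show False using coe_inj[OF l(1)] l(2) coe_lin(2)[of b 0 0] by simp
qed

lemma sp_nonzero: "sp \<noteq> 0"
proof
  assume "sp = 0"
  then have "bx = - \<tau> (\<tau> Qx)" by (simp add: sp_def add_eq_0_iff)
  then have "bx \<in> gen m" by (simp add: gen_minus tau_gen Qx_gen)
  then have "bx = 0" using gen_vert bx by blast
  then have "\<tau> (\<tau> Qx) = 0" using \<open>sp = 0\<close> by (simp add: sp_def)
  then show False using tau_nonzero tau_gen Qx_gen Qx_nonzero by metis
qed

lemma x_nonzero: "x \<noteq> 0"
  using qx prL_scale[of m 0 0] by auto

text \<open>Otherwise \<tau>(Q(x)) x would lie in both L and V and vanish, although \<tau>(Q(x)) and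
  x are nonzero. So \<open>eps0\<close> generates a cubic field.\<close>

lemma eps0_scal: "eps0 \<notin> scal"
proof
  assume "eps0 \<in> scal"
  then obtain k where "eps0 = k *s e" by (auto simp: scal_def)
  then have "act (\<tau> Qx) x = (k - n2) *s e" by (simp add: eps0_def vec_eq_iff algebra_simps)
  then have "act (\<tau> Qx) x \<in> gen m" by (simp add: gen_scale gen_unit gen_diff)
  then have z: "act (\<tau> Qx) x = 0" using gen_vert act_vert[OF tau_gen[OF Qx_gen] x] by blast
  have "cmp a (act (\<tau> Qx) x) = 0 \<and> cmp b (act (\<tau> Qx) x) = 0 \<and> cmp c (act (\<tau> Qx) x) = 0"
    unfolding z by (simp add: cmp_lin)
  moreover have "coe a (\<tau> Qx) \<noteq> 0" "coe b (\<tau> Qx) \<noteq> 0" "coe c (\<tau> Qx) \<noteq> 0"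
    using coe_inj split_field.coe_inj[OF rotate] split_field.coe_inj[OF split_field.rotate[OF rotate]]
      tau_nonzero[OF Qx_gen Qx_nonzero] tau_gen[OF Qx_gen] by blast+
  ultimately have "cmp a x = 0" "cmp b x = 0" "cmp c x = 0"
    using cmp_act'[OF tau_gen[OF Qx_gen] x] split_field.cmp_act'[OF rotate tau_gen[OF Qx_gen] x]
     split_field.cmp_act'[OF split_field.rotate[OF rotate] tau_gen[OF Qx_gen] x] by simp_all
  then show False using x_nonzero em_vert[OF x] em_eq_0 by simp
qed

text \<open>If dd = 0, the element l = N(x) / (2 Q(x)) of L has N(l) = N(x)/2 and T(l, x#) = - 3
  N(x)/2. Then N(l + x) = 0, and x = - l would lie in L.\<close>

lemma dd_nonzero: "dd \<noteq> 0"
proof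
  assume d: "dd = 0"
  let ?l = "n2 *s invL Qx"
  have l: "?l \<in> gen m" by (intro gen_scale invL_gen Qx_gen)
  have N: "Nm Qx \<noteq> 0" using Qx_nonzero aniso by blast
  have s: "sh x = bx - Qx" by (simp add: bx_def Qx_def)
  have "T ?l (sh x) = - (3 * n2)"
    using N T_sh_self(2)[of Qx] vert_gen[OF bx gen_sh[OF Qx_gen]]
    by (simp add: s bilin T_commute[of _ bx] invL_def)
  moreover have "T (sh ?l) x = 0" using vert_gen[OF x gen_sh[OF l]] by (simp add: T_commute)
  moreover have "Nm ?l = n2"
  proof -
    have "Nm ?l = n2 ^ 3 / Nm Qx" using N by (simp add: Nm_scale invL_def Nm_sh field_simps eval_nat_numeral)
    also have "\<dots> = n2" using d N by (simp add: dd_def field_simps power2_eq_square power3_eq_cube)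
    finally show ?thesis .
  qed
  ultimately have "Nm (?l + x) = 0" unfolding Nm_add n2 by simp
  then have "x = - ?l" using aniso by (metis add_eq_0_iff)
  then have "x \<in> gen m" using gen_minus[OF l] by simp
  then show False using gen_vert x x_nonzero by blast
qed

lemma zs_act': "k \<in> gen m \<Longrightarrow> u \<in> Y \<Longrightarrow> act (\<tau> (\<tau> k)) (zs u) = zs (act k u)"
  using zs_act[of "\<tau> (\<tau> k)" u] by (simp add: tau_gen tau_eq)

lemma L_h: "y \<in> Y \<Longrightarrow> act eps0 y = n2 *s y + zz (zz (zs y)) + zz (zs (zs y))"
  unfolding eps0_def by (simp add: act_lin Y_unit L_x tau_gen Qx_gen tau_eq zz_zs zs_Y zz_act zs_act')

lemma L_sp: "y \<in> Y \<Longrightarrow> act sp y = zz (zz y) + zz (zs y) + zs (zs y)"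
  using L_b[OF gen_unit, of y] act_unit[OF vert_unit[OF bx]]
  by (simp add: sp_def act_lin zz_zs tau_unit Y_unit zz_Y)

lemma zz_sp: "y \<in> Y \<Longrightarrow> zz (act sp y) = dl y + act eps0 y"
  by (simp add: L_sp L_h lin dl_def)

lemma sp_zs: "y \<in> Y \<Longrightarrow> act sp (zs y) = act eps0 y - dl y"
  by (simp add: L_sp L_h dl_zs zs_Y)

definition "eps = invL eps0"
text \<open>Chosen such that 1 + mm = (1 + dl eps)(1 - dl eps) as operators on Y.\<close>

definition "mm = (- dd) *s jp eps eps"

lemma eps0_nonzero: "eps0 \<noteq> 0"
  using eps0_scal scalI[of 0] by auto

lemma eps_S: "eps \<in> SS" unfolding eps_def by (rule S_invL[OF eps0_S])

lemma E_E0: "y \<in> Y \<Longrightarrow> act eps (act eps0 y) = y" "y \<in> Y \<Longrightarrow> act eps0 (act eps y) = y"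
  unfolding eps_def using act_invL[OF eps0_S eps0_nonzero] by auto

lemma eps_scal: "eps \<notin> scal"
proof
  assume "eps \<in> scal"
  then obtain k where "inverse (Nm eps0) *s sh eps0 = k *s e" by (auto simp: scal_def eps_def invL_def)
  then have "Nm eps0 *s (inverse (Nm eps0) *s sh eps0) = Nm eps0 *s (k *s e)" by simp
  moreover have N: "Nm eps0 \<noteq> 0" using eps0_nonzero aniso by blast
  ultimately have s: "sh eps0 = (Nm eps0 * k) *s e" by simp
  have "Nm eps0 *s eps0 = (Nm eps0 * k)^2 *s e" by (simp only: sh_sh[symmetric] s sh_scale sh_unit)
  then have "Nm eps0 *s eps0 = Nm eps0 *s ((Nm eps0 * k^2) *s e)" by (simp add: power2_eq_square algebra_simps)
  then have "eps0 = (Nm eps0 * k^2) *s e" by (rule scale_cancel[OF N])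
  then show False using eps0_scal scalI by metis
qed

lemma mm_scal: "mm \<notin> scal"
proof
  assume "mm \<in> scal"
  then obtain k where "mm = k *s e" by (auto simp: scal_def)
  then have "(dd * T (sh eps) e - k) *s e + (- dd * T eps e) *s eps + (- dd) *s sh eps = 0"
    unfolding mm_def jp_self by (simp add: vec_eq_iff algebra_simps)
  then show False using field_independent[OF eps_scal] dd_nonzero by fastforce
qed

lemma gen_mm: "gen mm = gen eps"
proof (rule gen_eq[OF _ mm_scal eps_scal])
  show "mm \<in> gen eps" unfolding mm_def by (intro gen_scale gen_jp gen_self)
qed

lemma vert_mm: "vert mm = vert eps"
  by (rule vert_eq[OF gen_mm])

lemma mm_S: "mm \<in> SS" unfolding mm_def by (intro S_scale S_jp eps_S)

lemma L_mm: "y \<in> Y \<Longrightarrow> act mm y = - (dd *s act eps (act eps y))"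
  unfolding mm_def act_lin by (simp add: rep_sq eps_S)

text \<open>The commutator part of (1 + dl eps) s (1 - dl eps) is represented in the subalgebra. The
  full product is eps z (sp s sp) z* eps, hence represented by \<open>Zmap\<close> and
  \<open>U\<close>; its remaining parts s and - dd eps s eps are removed.\<close>

lemma Cmap: assumes s: "s \<in> SS"
  shows "\<exists>t\<in>SS. \<forall>y\<in>Y. act t y = dl (act eps (act s y)) - dl (act s (act eps y))"
proof -
  have u: "U sp s \<in> SS" by (rule S_U[OF sp_S s])
  obtain t where t: "t \<in> SS" "\<And>y. y \<in> Y \<Longrightarrow> act t y = zz (act (U sp s) (zs y))" using Zmap[OF u] by blast
  let ?t = "U eps t - s + dd *s U eps s"
  have "act ?t y = dl (act eps (act s y)) - dl (act s (act eps y))" if y: "y \<in> Y" for y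
  proof -
    have ey: "act eps y \<in> Y" by (rule act_Y[OF eps_S y])
    have z: "zs (act eps y) \<in> Y" by (rule zs_Y[OF ey])
    have "act (U eps t) y = act eps (zz (act sp (act s (act sp (zs (act eps y))))))"
      unfolding rep_U[OF eps_S t(1) y] t(2)[OF ey] rep_U[OF sp_S s z] ..
    also have "act sp (zs (act eps y)) = y - dl (act eps y)"
      unfolding sp_zs[OF ey] by (simp add: E_E0 y)
    also have "zz (act sp (act s (y - dl (act eps y)))) = dl (act s (y - dl (act eps y))) + act eps0 (act s (y - dl (act eps y)))"
      by (rule zz_sp) (intro act_Y s Y_diff y dl_Y ey)
    also have "act eps \<dots> = dl (act eps (act s y)) - dd *s act eps (act s (act eps y)) + act s y - dl (act s (act eps y))"
      using y s ey by (simp add: act_lin dl_lin dl_S[symmetric] eps_S eps0_S act_Y dl_Y E_E0 dl_dl)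
    finally show ?thesis by (simp add: act_lin rep_U eps_S s y)
  qed
  moreover have "?t \<in> SS" by (intro S_add S_diff S_scale S_U eps_S s t(1))
  ultimately show ?thesis by blast
qed

lemma eps_cubic: assumes u: "u \<in> Y"
  shows "act eps (act eps (act eps u)) = T eps e *s act eps (act eps u) - T (sh eps) e *s act eps u + Nm eps *s u"
proof -
  have sh: "act (sh eps) w = act eps (act eps w) - T eps e *s act eps w + T (sh eps) e *s w" if "w \<in> Y" for w
    using that by (simp add: rep_sq[OF eps_S] jp_self act_lin Y_unit)
  show ?thesis using act_sh[OF eps_S u] unfolding sh[OF act_Y[OF eps_S u]] by (simp add: algebra_simps)
qed

text \<open>With t = dl [eps, s] the expression of \<open>phi_vert\<close> telescopes to dl times
  the commutator of s with eps^3 - T(eps) eps^2 + T(eps#) eps. That polynomial is the scalar N(eps),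
  so the commutator vanishes.\<close>

lemma C_vert:
  assumes s: "s \<in> SS" and t: "t \<in> SS" "\<And>y. y \<in> Y \<Longrightarrow> act t y = dl (act eps (act s y)) - dl (act s (act eps y))"
    and v: "v \<in> Y" "v \<noteq> 0"
  shows "t \<in> vert eps"
proof (rule phi_vert[OF eps_scal])
  let ?p = "2 *s jp (jp eps eps) t + U eps t - T eps e *s (2 *s jp eps t) + T (sh eps) e *s t"
  have j: "jp eps eps \<in> SS" by (intro S_jp eps_S)
  have ev: "act eps v \<in> Y" by (rule act_Y[OF eps_S v(1)])
  have 1: "act (2 *s jp (jp eps eps) t) v = act eps (act eps (act t v)) + act t (act eps (act eps v))"
    by (simp only: rep[OF j t(1) v(1), symmetric] rep_sq[OF eps_S act_Y[OF t(1) v(1)]] rep_sq[OF eps_S v(1)])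
  have 2: "act (2 *s jp eps t) v = act eps (act t v) + act t (act eps v)"
    by (rule rep[OF eps_S t(1) v(1), symmetric])
  have "act ?p v = act eps (act eps (act t v)) + act t (act eps (act eps v)) + act eps (act t (act eps v))
      - T eps e *s (act eps (act t v) + act t (act eps v)) + T (sh eps) e *s act t v"
    unfolding act_lin(6,7,8)[of "_ + _"] act_lin(6,7) 1 act_lin(8)[of "T eps e"] act_lin(8)[of "T (sh eps) e"] 2 rep_U[OF eps_S t(1) v(1)] ..
  also have "\<dots> = dl (act eps (act eps (act eps (act s v))) - act s (act eps (act eps (act eps v)))
       - T eps e *s (act eps (act eps (act s v)) - act s (act eps (act eps v))) + T (sh eps) e *s (act eps (act s v) - act s (act eps v)))"
    using v s by (simp add: t(2) ev act_Y eps_S act_lin dl_lin dl_S[symmetric] dl_Y vec.scale_right_diff_distrib)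
  also have "\<dots> = dl 0"
    unfolding eps_cubic[OF act_Y[OF s v(1)]] eps_cubic[OF v(1)]
    by (rule arg_cong[of _ _ dl]) (simp add: act_lin vec_eq_iff algebra_simps)
  also have "\<dots> = 0" using dl_lin(3)[of 0 0] by simp
  finally have "act ?p v = act 0 v" by (simp add: act_lin)
  moreover have "?p \<in> SS" using t(1) j by (intro S_add S_diff S_scale S_U S_jp eps_S)
  ultimately show "?p = 0" using rep_inj[OF _ S_zero v] by blast
qed

end

section \<open>R-trivial similarities as compositions of rational paths from the identity\<close>

context cubic
begin

text \<open>The function f is at once a common denominator of the family and a marker: off its zeros
  the multiplier \<mu> is nonzero, so R t is a similarity there.\<close>

definition rpath :: "('a ^ 'n \<Rightarrow> 'a ^ 'n) \<Rightarrow> bool" where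
  "rpath \<rho> \<longleftrightarrow> (\<exists>(R :: 'a \<Rightarrow> 'a ^ 'n \<Rightarrow> 'a ^ 'n) f \<mu>. (\<forall>t x y. R t (x + y) = R t x + R t y) \<and> (\<forall>t k x. R t (k *s x) = k *s R t x)
     \<and> (\<exists>d. polyf d f) \<and> f 0 \<noteq> 0 \<and> f 1 \<noteq> 0 \<and> (\<forall>x. \<exists>d. polyv d (\<lambda>t. f t *s R t x))
     \<and> (\<forall>t x. Nm (R t x) = \<mu> t * Nm x) \<and> (\<forall>t. f t \<noteq> 0 \<longrightarrow> \<mu> t \<noteq> 0) \<and> (\<forall>x. R 0 x = x) \<and> (\<forall>x. R 1 x = \<rho> x))"

inductive rtriv :: "('a ^ 'n \<Rightarrow> 'a ^ 'n) \<Rightarrow> bool" where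
  rtriv_id: "rtriv (\<lambda>x. x)"
| rtriv_step: "rpath \<rho> \<Longrightarrow> rtriv \<rho>' \<Longrightarrow> rtriv (\<lambda>x. \<rho>' (\<rho> x))"

lemma rtriv_rpath: "rpath \<rho> \<Longrightarrow> rtriv \<rho>"
  using rtriv_step[OF _ rtriv_id] by blast

lemma rtriv_comp: "rtriv \<rho> \<Longrightarrow> rtriv \<rho>' \<Longrightarrow> rtriv (\<lambda>x. \<rho>' (\<rho> x))"
proof (induction rule: rtriv.induct)
  case (rtriv_step \<rho>1 \<rho>2)
  show ?case using rtriv.rtriv_step[OF rtriv_step(1) rtriv_step.IH[OF rtriv_step.prems]] by simp
qed simp

lemma rpath_lin: assumes "rpath \<rho>"
  shows "\<rho> (x + y) = \<rho> x + \<rho> y" "\<rho> (k *s x) = k *s \<rho> x" "\<exists>\<nu>. \<nu> \<noteq> 0 \<and> (\<forall>x. Nm (\<rho> x) = \<nu> * Nm x)"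
proof -
  obtain R :: "'a \<Rightarrow> 'a ^ 'n \<Rightarrow> 'a ^ 'n" and f \<mu> :: "'a \<Rightarrow> 'a" where R: "\<forall>t x y. R t (x + y) = R t x + R t y" "\<forall>t k x. R t (k *s x) = k *s R t x"
     "f 1 \<noteq> (0::'a)" "\<forall>t x. Nm (R t x) = \<mu> t * Nm x" "\<forall>t. f t \<noteq> 0 \<longrightarrow> \<mu> t \<noteq> 0" "\<forall>x. R 1 x = \<rho> x"
    using assms unfolding rpath_def by (elim exE conjE) (rule that; assumption)
  show "\<rho> (x + y) = \<rho> x + \<rho> y" "\<rho> (k *s x) = k *s \<rho> x" using R(1,2,6) by metis+
  show "\<exists>\<nu>. \<nu> \<noteq> 0 \<and> (\<forall>x. Nm (\<rho> x) = \<nu> * Nm x)" using R(3-6) by metis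
qed

lemma rtriv_lin: assumes "rtriv \<rho>"
  shows "\<rho> (x + y) = \<rho> x + \<rho> y" "\<rho> (k *s x) = k *s \<rho> x" "\<exists>\<nu>. \<nu> \<noteq> 0 \<and> (\<forall>x. Nm (\<rho> x) = \<nu> * Nm x)"
proof -
  have "(\<forall>x y. \<rho> (x + y) = \<rho> x + \<rho> y) \<and> (\<forall>k x. \<rho> (k *s x) = k *s \<rho> x) \<and> (\<exists>\<nu>. \<nu> \<noteq> 0 \<and> (\<forall>x. Nm (\<rho> x) = \<nu> * Nm x))"
    using assms
  proof (induction rule: rtriv.induct)
    case rtriv_id
    have "\<exists>\<nu>. \<nu> \<noteq> 0 \<and> (\<forall>x. Nm x = \<nu> * Nm x)" by (rule exI[of _ 1]) simp
    then show ?case by simp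
  next
    case (rtriv_step \<rho> \<rho>')
    note r = rpath_lin[OF rtriv_step(1)]
    from r(3) obtain \<nu> where "\<nu> \<noteq> 0" "\<forall>x. Nm (\<rho> x) = \<nu> * Nm x" by blast
    moreover from rtriv_step.IH obtain \<nu>' where "\<nu>' \<noteq> 0" "\<forall>x. Nm (\<rho>' x) = \<nu>' * Nm x" by blast
    ultimately have "\<exists>\<nu>. \<nu> \<noteq> 0 \<and> (\<forall>x. Nm (\<rho>' (\<rho> x)) = \<nu> * Nm x)"
      by (intro exI[of _ "\<nu>' * \<nu>"]) simp
    then show ?case using rtriv_step.IH r by simp
  qed
  then show "\<rho> (x + y) = \<rho> x + \<rho> y" "\<rho> (k *s x) = k *s \<rho> x" "\<exists>\<nu>. \<nu> \<noteq> 0 \<and> (\<forall>x. Nm (\<rho> x) = \<nu> * Nm x)"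
    by blast+
qed

lemma polyf_line: "polyf 1 (\<lambda>t. \<alpha> + t * \<beta>)"
  unfolding polyf_def by (rule exI[of _ "[:\<alpha>, \<beta>:]"]) simp

lemma rtriv_scale: assumes "k \<noteq> 0" shows "rtriv (\<lambda>x. k *s x)"
proof (rule rtriv_rpath)
  define f where "f t = 1 + t * (k - 1)" for t
  have f: "polyf 1 f" unfolding f_def by (rule polyf_line)
  have "polyv (1 + 1 + 0) (\<lambda>t. f t *s (f t *s x))" for x
    using polyv_scale[OF polyf_mult[OF f f] polyv_const[of 0 x]] by (simp only: vec.scale_scale)
  moreover have "f 0 = 1" "f 1 = k" by (simp_all add: f_def)
  ultimately show "rpath (\<lambda>x. k *s x)"
    unfolding rpath_def using f assms
    by (intro exI[of _ "\<lambda>t x. f t *s x"] exI[of _ f] exI[of _ "\<lambda>t. f t ^ 3"])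
      (auto simp: Nm_scale vec.scale_right_distrib mult.commute)
qed

lemma U_unit: "U e y = y"
  by (simp add: U_def X_unit T_commute[of e y])

lemma U_lin: "U x (y + z) = U x y + U x z" "U x (k *s y) = k *s U x y"
  by (simp_all add: U_def bilin vec_eq_iff algebra_simps)

lemma U_sym: "T (U x y) z = T y (U x z)"
  by (simp add: U_def bilin T_X_left[of "sh x" y z] T_X T_commute[of y x])

text \<open>The line from e to x gives a path from the identity to U x. It may meet zeros of the
  norm in between, which \<open>rpath\<close> permits.\<close>

lemma rtriv_U: assumes "Nm x \<noteq> 0" shows "rtriv (U x)"
proof (rule rtriv_rpath)
  let ?l = "\<lambda>t. e + t *s (x - e)"
  have l: "polyv 1 ?l"
    unfolding polyv_def vector_add_component vector_smult_component by (intro allI polyf_line)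
  have f: "polyf (1 + (1 + 1)) (\<lambda>t. Nm (?l t))" by (rule polyf_Nm[OF l])
  have "polyv (1 + (1 + 1) + (1 + 1)) (\<lambda>t. Nm (?l t) *s U (?l t) y)" for y
  proof (rule polyv_scale[OF f])
    have "polyv (1 + 0 + 1) (\<lambda>t. T (?l t) y *s ?l t)" by (rule polyv_scale[OF polyf_T[OF l polyv_const] l])
    moreover have "polyv (1 + 1 + 0) (\<lambda>t. sh (?l t) \<bowtie> y)" by (rule polyv_X[OF polyv_sh[OF l] polyv_const])
    ultimately show "polyv (1 + 1) (\<lambda>t. U (?l t) y)" unfolding U_def by (intro polyv_diff) (simp_all only: add_0_right)
  qed
  then show "rpath (U x)"
    unfolding rpath_def using f assms
    by (intro exI[of _ "\<lambda>t. U (?l t)"] exI[of _ "\<lambda>t. Nm (?l t)"] exI[of _ "\<lambda>t. Nm (?l t) ^ 2"])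
      (auto simp: U_lin Nm_U U_unit)
qed

end

context curve_data
begin

lemma rtriv_rr: "rtriv (rr 1)"
proof (rule rtriv_rpath)
  have "Nm (gt t) \<noteq> 0" for t using gt_nonzero aniso by blast
  moreover have "\<exists>d. polyf d (\<lambda>t. Nm (gt t))" using polyf_Nm[OF polyv_gt] by blast
  ultimately show "rpath (rr 1)"
    unfolding rpath_def using polyv_rr
    by (intro exI[of _ rr] exI[of _ "\<lambda>t. Nm (gt t)"]) (auto simp: rr_add rr_scale rr_Nm rr_zero)
qed

end

context split_cubic
begin

lemma split_field_in:
  assumes m: "m \<notin> scal"
  obtains a b c p q r where "split_field cr T e crE TE eE io m a b c p q r"
proof -
  obtain a b c p q r where "E.frm a b c" "em m = p *s a + q *s b + r *s c" "p \<noteq> q" "q \<noteq> r" "r \<noteq> p"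
    "\<exists>k k' k''. a = k *s em e + k' *s em m + k'' *s em (sh m)"
    "\<exists>k k' k''. b = k *s em e + k' *s em m + k'' *s em (sh m)"
    "\<exists>k k' k''. c = k *s em e + k' *s em m + k'' *s em (sh m)"
    by (rule frame_exists[OF m])
  then have "split_field cr T e crE TE eE io m a b c p q r" by unfold_locales (use m in auto)
  then show thesis by (rule that)
qed

end

section \<open>The twist of L realised by an R-trivial similarity\<close>

context twisted
begin

lemma gen_eps_comm: assumes "l \<in> gen eps" "u \<in> Y" shows "act l (act eps u) = act eps (act l u)"
  using act_act[OF eps_scal assms(1) gen_self Y_vert[OF eps_S assms(2)]]
    act_act[OF eps_scal gen_self assms(1) Y_vert[OF eps_S assms(2)]] by (simp add: jp_commute[of l])

text \<open>The curve for K[eps] with v in Y and w = eps dl v. On SS the reflections act trivially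
  because SS is orthogonal to Y. For s orthogonal to K[eps], the coefficients s, the element of
  \<open>Cmap\<close> and - dd eps s eps solve the divisibility equations, so by uniqueness they are
  the curve through s.\<close>

lemma semilinear_curve:
  assumes v: "v \<in> Y" "prL mm (v \<bowtie> v) \<noteq> 0"
  shows "\<exists>\<rho>. rtriv \<rho> \<and> (\<forall>s\<in>SS. \<rho> s \<in> SS \<and> (\<forall>u\<in>Y. act (\<rho> s) u = act s u + dl (act eps (act s u)) - dl (act s (act eps u))
      - dd *s act eps (act s (act eps u))))"
proof -
  let ?w = "act eps (dl v)"
  have v0: "v \<noteq> 0" using v(2) prL_scale[of mm 0 0] by auto
  have dv: "dl v \<in> Y" by (rule dl_Y[OF v(1)])
  have w: "?w \<in> Y" by (rule act_Y[OF eps_S dv])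
  have gS: "l \<in> SS" if "l \<in> gen eps" for l using gen_S[OF eps_S] that by blast
  have YV: "u \<in> vert mm" if "u \<in> Y" for u by (rule Y_vert[OF mm_S that])
  have comm: "act l (act eps u) = act eps (act l u)" if "l \<in> gen mm" "u \<in> Y" for l u
    using gen_eps_comm that gen_mm by simp
  have TX: "T (u \<bowtie> u') l = - T u (act l u')" for u u' l
    by (simp add: act_def bilin T_X X_commute[of l])
  \<comment> \<open>dl is skew and commutes with S, and eps commutes with l; so T(v, l eps dl v)
    equals its own negative.\<close>
  have orth: "prL mm (v \<bowtie> ?w) = 0"
  proof (rule prL_vert, rule vertI)
    fix l assume "l \<in> gen mm"
    then have l: "l \<in> gen eps" "l \<in> SS" using gen_mm gS by auto
    let ?A = "T v (act l ?w)"
    have "?A = T (act eps (act l v)) (dl v)" by (simp only: T_act)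
    also have "\<dots> = - T (dl (act eps (act l v))) v"
      using T_dl[OF act_Y[OF eps_S act_Y[OF l(2) v(1)]] v(1)] by simp
    also have "\<dots> = - T (act eps (act l (dl v))) v"
      by (simp only: dl_S[OF eps_S act_Y[OF l(2) v(1)]] dl_S[OF l(2) v(1)])
    also have "\<dots> = - ?A" by (simp only: gen_eps_comm[OF l(1) dv] T_commute[of _ v])
    finally have "2 * ?A = 0" by simp
    then show "T (v \<bowtie> ?w) l = 0" using two by (simp add: TX)
  qed
  \<comment> \<open>Moving one dl across by skewness turns the pairing of w with itself into that of
    v with - dl^2 eps^2 v, and this operator is mm.\<close>
  have ratio: "jp mm (prL mm (v \<bowtie> v)) = prL mm (?w \<bowtie> ?w)"
  proof (rule prL_eqI[symmetric])
    show g: "jp mm (prL mm (v \<bowtie> v)) \<in> gen mm" by (intro gen_jp gen_self prL(1))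
    show "?w \<bowtie> ?w - jp mm (prL mm (v \<bowtie> v)) \<in> vert mm"
    proof (rule vertI)
      fix l assume l': "l \<in> gen mm"
      then have l: "l \<in> gen eps" "l \<in> SS" using gen_mm gS by auto
      have jl: "jp mm l \<in> gen mm" by (intro gen_jp gen_self l')
      have "T (jp mm (prL mm (v \<bowtie> v))) l = T (prL mm (v \<bowtie> v)) (jp mm l)" by (rule T_jp)
      also have "\<dots> = T (v \<bowtie> v) (jp mm l)"
        using vert_gen[OF prL(2) jl, of "v \<bowtie> v"] by (simp add: bilin)
      also have "\<dots> = - T v (act mm (act l v))"
        by (simp only: TX act_act[OF mm_scal gen_self l' YV[OF v(1)]])
      also have "\<dots> = dd * T v (act eps (act eps (act l v)))"
        using L_mm[OF act_Y[OF l(2) v(1)]] by (simp add: bilin)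
      finally have 1: "T (jp mm (prL mm (v \<bowtie> v))) l = dd * T v (act eps (act eps (act l v)))" .
      have "T (?w \<bowtie> ?w) l = - T (dl v) (act eps (act l ?w))" by (simp only: TX T_act)
      also have "\<dots> = T v (dl (act eps (act l ?w)))"
        using T_dl[OF v(1) act_Y[OF eps_S act_Y[OF l(2) w]]] by simp
      also have "dl (act eps (act l ?w)) = dd *s act eps (act l (act eps v))"
        using v l dv by (simp add: dl_S eps_S act_Y dl_Y dl_dl act_lin)
      also have "act l (act eps v) = act eps (act l v)" by (rule gen_eps_comm[OF l(1) v(1)])
      finally show "T (?w \<bowtie> ?w - jp mm (prL mm (v \<bowtie> v))) l = 0" by (simp add: T_diff 1 bilin)
    qed
  qed
  obtain a' b' c' p' q' r' where sf: "split_field cr T e crE TE eE io mm a' b' c' p' q' r'"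
    by (rule split_field_in[OF mm_scal])
  interpret F: split_field cr T e crE TE eE io mm a' b' c' p' q' r' by (rule sf)
  interpret V: curve_data cr T e crE TE eE io mm a' b' c' p' q' r' v ?w
    by unfold_locales (use YV v w orth ratio in auto)
  have vXY: "vX mm u s = - act s u" "prL mm (u \<bowtie> s) = 0" if "u \<in> Y" "s \<in> SS" for u s
  proof -
    have us: "u \<bowtie> s = - act s u" by (simp add: act_def X_commute[of s])
    show "prL mm (u \<bowtie> s) = 0" unfolding us by (rule prL_vert[OF vert_minus[OF YV[OF act_Y[OF that(2,1)]]]])
    then show "vX mm u s = - act s u" unfolding vX_def us by simp
  qed
  have R0: "V.R3 u s z = 0" if "u \<in> Y" "s \<in> SS" for u s z
    using vXY(2)[OF that] by (simp add: V.R3_def act_lin)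
  let ?P = "\<lambda>s. V.rr 1 s \<in> SS \<and> (\<forall>u\<in>Y. act (V.rr 1 s) u = act s u + dl (act eps (act s u)) - dl (act s (act eps u))
      - dd *s act eps (act s (act eps u)))"
  have powY: "(act mm ^^ k) v \<in> Y" for k by (induction k) (simp_all add: v act_Y mm_S)
  have mE: "act mm (act eps (dl u)) = act eps (dl (act mm u))" if "u \<in> Y" for u
    using that by (simp add: comm[OF gen_self dl_Y] dl_S mm_S)
  have poww: "(act mm ^^ k) ?w = act eps (dl ((act mm ^^ k) v))" for k
    by (induction k) (simp_all add: mE powY)
  have vertP: "?P s" if s: "s \<in> SS" "s \<in> vert mm" for s
  proof -
    obtain t where t: "t \<in> SS" "\<And>y. y \<in> Y \<Longrightarrow> act t y = dl (act eps (act s y)) - dl (act s (act eps y))"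
      using Cmap[OF s(1)] by blast
    have tv: "t \<in> vert mm" unfolding vert_mm by (rule C_vert[OF s(1) t v(1) v0])
    let ?y = "(- dd) *s U eps s"
    have yS: "?y \<in> SS" by (intro S_scale S_U eps_S s)
    have yv: "?y \<in> vert mm"
    proof (intro vert_scale vertI)
      fix l assume "l \<in> gen mm"
      then have "U eps l \<in> gen mm" unfolding gen_mm by (intro U_gen gen_self)
      then show "T (U eps s) l = 0" unfolding U_sym by (rule vert_gen[OF s(2)])
    qed
    have Ly: "act ?y u = - (dd *s act eps (act s (act eps u)))" if "u \<in> Y" for u
      unfolding act_lin rep_U[OF eps_S s(1) that] by simp
    note R = R0[OF v(1)] R0[OF w]
    have YYs: "V.Y0 s = s" "V.Y1 s t = t" "V.Y2 s t ?y = ?y + act mm s" "V.Y3 t ?y = act mm t" "V.Y4 ?y = act mm ?y"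
      unfolding V.Y_defs by (simp_all only: R s t yS diff_zero)
    have dlm: "dl (- u) = - dl u" for u using dl_lin(3)[of "-1" u] by simp
    \<comment> \<open>As operators t mm + s mm eps dl = ?y eps dl: the two terms s eps mm dl cancel,
      and both sides become - dd dl eps s eps^2.\<close>
    have key: "act t (act mm u) + act s (act mm (act eps (dl u))) - act ?y (act eps (dl u)) = 0" if u: "u \<in> Y" for u
      unfolding Ly[OF act_Y[OF eps_S dl_Y[OF u]]] using u s
      by (simp add: t(2) L_mm act_Y eps_S mm_S dl_Y act_lin dl_lin dlm dl_S[symmetric] vec_eq_iff)
    \<comment> \<open>For z orthogonal to K[mm], \<open>act mm z\<close> is T(mm) z minus twice the
      Jordan product; \<open>rep\<close> turns this into operators.\<close>
    have am: "act (act mm z) u = T mm e *s act z u - act mm (act z u) - act z (act mm u)"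
      if "z \<in> SS" "z \<in> vert mm" "u \<in> Y" for z u
    proof -
      have "T (mm \<bowtie> z) e = 0" "T z e = 0"
        using vert_gen[OF that(2) gen_self] vert_unit[OF that(2)] by (simp_all add: T_X_unit T_commute[of mm])
      then have "act mm z = T mm e *s z - 2 *s jp mm z" by (simp add: two_jp act_def)
      then have "act (act mm z) u = T mm e *s act z u - act (2 *s jp mm z) u" by (simp only: act_lin)
      then show ?thesis unfolding rep[OF mm_S that(1,3), symmetric] by (simp add: algebra_simps)
    qed
    have "V.EQ k s t ?y = 0" for k
    proof -
      define u where "u = (act mm ^^ k) v"
      have u: "u \<in> Y" unfolding u_def by (rule powY)
      define w' where "w' = act eps (dl u)"
      have w': "w' \<in> Y" unfolding w'_def by (intro act_Y eps_S dl_Y u)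
      have pw: "(act mm ^^ k) v = u" "(act mm ^^ (k+1)) v = act mm u" "(act mm ^^ (k+2)) v = act mm (act mm u)"
        "(act mm ^^ k) ?w = w'" "(act mm ^^ (k+1)) ?w = act mm w'" "(act mm ^^ (k+2)) ?w = act mm (act mm w')"
        by (simp_all add: u_def w'_def poww)
      have Mu: "act mm u \<in> Y" "act mm (act mm u) \<in> Y" "act mm w' \<in> Y" "act mm (act mm w') \<in> Y"
        by (intro act_Y mm_S u w')+
      have k1: "act ?y w' = act t (act mm u) + act s (act mm w')"
        using key[OF u] unfolding w'_def by (simp only: right_minus_eq) 
      have k2: "act ?y (act mm w') = act t (act mm (act mm u)) + act s (act mm (act mm w'))"
        using key[OF Mu(1)] unfolding w'_def mE[OF u] by (simp only: right_minus_eq)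
      have mS: "act mm s \<in> SS" "act mm t \<in> SS" "act mm ?y \<in> SS" by (intro S_act mm_S s t yS)+
      have "V.EQ k s t ?y = - act t (act mm (act mm u)) - act s (act mm (act mm w')) + act (act mm t) (act mm u)
          + act (?y + act mm s) (act mm w') - act (act mm ?y) w'"
        unfolding V.EQ_def YYs pw vXY(1)[OF Mu(1) mS(2)] vXY(1)[OF Mu(2) t(1)] vXY(1)[OF Mu(4) s(1)]
          vXY(1)[OF Mu(3) S_add[OF yS mS(1)]] vXY(1)[OF w' mS(3)] by simp
      also have "\<dots> = 0"
        unfolding act_lin(6) am[OF t(1) tv Mu(1)] am[OF s Mu(3)] am[OF yS yv w'] k1 k2 act_lin(1)
        by (simp add: vec_eq_iff algebra_simps)
      finally show ?thesis .
    qed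
    then have sol: "V.sol s t ?y" unfolding V.sol_def using s tv yv by blast
    have sum: "s + t + ?y \<in> vert mm" using s tv yv by (intro vert_add)
    have "V.rr 1 s = act (invL (V.gt 1)) (V.YY s t ?y 1)" using V.rr_sol[OF sol, of 1] by (simp only: YYs)
    \<comment> \<open>The coefficients regroup as e + mm acting on s + t + ?y, so at t = 1 the
      inverse of \<open>V.gt 1\<close> cancels.\<close>
    also have "V.YY s t ?y 1 = act (V.gt 1) (s + t + ?y)"
      unfolding V.YY_def YYs V.gt_def
      using act_unit[OF vert_unit[OF s(2)]] act_unit[OF vert_unit[OF tv]] act_unit[OF vert_unit[OF yv]]
      by (auto simp: act_lin)
    also have "act (invL (V.gt 1)) \<dots> = act (jp (invL (V.gt 1)) (V.gt 1)) (s + t + ?y)"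
      by (rule act_act[OF mm_scal invL_gen[OF V.gt_gen] V.gt_gen sum])
    also have "jp (invL (V.gt 1)) (V.gt 1) = e"
    proof (rule F.coe_eqI)
      have "coe a' (V.gt 1) \<noteq> 0" using F.coe_inj V.gt_gen V.gt_nonzero by blast
      then show "coe a' (jp (invL (V.gt 1)) (V.gt 1)) = coe a' e"
        by (simp add: F.coe_jp invL_gen V.gt_gen F.coe_invL V.gt_nonzero F.coe_unit)
    qed (simp_all add: gen_jp invL_gen V.gt_gen gen_unit)
    also have "act e (s + t + ?y) = s + t + ?y" by (rule act_unit[OF vert_unit[OF sum]])
    finally have rr: "V.rr 1 s = s + t + ?y" .
    show ?thesis unfolding rr
      by (intro conjI S_add s t yS ballI) (simp only: act_lin(6) Ly t(2), simp)
  qed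
  have genP: "?P l" if l: "l \<in> gen mm" for l
  proof -
    have lS: "l \<in> SS" using l gen_mm gS by blast
    have gS': "V.gt 1 \<in> SS" using V.gt_gen gen_mm gS by blast
    have "act (jp (V.gt 1) l) u = act l u + dl (act eps (act l u)) - dl (act l (act eps u)) - dd *s act eps (act l (act eps u))"
      if u: "u \<in> Y" for u
    proof -
      have lu: "act l u \<in> Y" by (rule act_Y[OF lS u])
      have "act (jp (V.gt 1) l) u = act (V.gt 1) (act l u)"
        by (rule act_act[OF mm_scal V.gt_gen l YV[OF u], symmetric])
      also have "\<dots> = act l u - dd *s act eps (act eps (act l u))"
        unfolding V.gt_def act_lin using lu by (simp add: Y_unit L_mm)
      finally show ?thesis unfolding comm[OF l u] by simp
    qed
    then show ?thesis unfolding V.rr_gen[OF l] using S_jp[OF gS' lS] by blast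
  qed
  have "?P s" if s: "s \<in> SS" for s
  proof -
    have lS: "prL mm s \<in> SS" using prL(1) gen_mm gS by blast
    have rr: "V.rr 1 s = V.rr 1 (prL mm s) + V.rr 1 (s - prL mm s)" by (simp add: V.rr_add[symmetric])
    have ss: "act s u = act (prL mm s) u + act (s - prL mm s) u" for u by (simp add: act_lin)
    note P1 = genP[OF prL(1)[of mm s]] and P2 = vertP[OF S_diff[OF s lS] prL(2)]
    show ?thesis unfolding rr using P1 P2
      by (auto simp: S_add act_lin(6) ss dl_lin act_lin(1) vec.scale_right_distrib)
  qed
  then show ?thesis using V.rtriv_rr by blast
qed

text \<open>By \<open>rep_inj\<close> both sides need only be compared on one nonzero vector of Y.
  There U eps0, the end point of the curve and U of the inverse of sp multiply out to z l z*, which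
  is \<tau>(l) \<tau>^2(Q(x)).\<close>

lemma semilinear:
  assumes y: "y \<in> Y" "y \<noteq> 0"
  shows "\<exists>\<rho>. rtriv \<rho> \<and> (\<forall>l\<in>gen m. \<rho> l = jp (\<tau> l) (\<tau> (\<tau> Qx)))"
proof -
  obtain v where v: "v \<in> Y" "prL mm (v \<bowtie> v) \<noteq> 0" using Y_anisotropic[OF y] by blast
  obtain \<rho> where r: "rtriv \<rho>" and rs: "\<And>s. s \<in> SS \<Longrightarrow> \<rho> s \<in> SS"
    "\<And>s u. s \<in> SS \<Longrightarrow> u \<in> Y \<Longrightarrow> act (\<rho> s) u = act s u + dl (act eps (act s u)) - dl (act s (act eps u))
      - dd *s act eps (act s (act eps u))"
    using semilinear_curve[OF v] by blast
  let ?i = "invL sp"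
  have iS: "?i \<in> SS" by (rule S_invL[OF sp_S])
  have N: "Nm ?i \<noteq> 0" "Nm eps0 \<noteq> 0"
  proof -
    have "Nm sp \<noteq> 0" using sp_nonzero aniso by blast
    then show "Nm ?i \<noteq> 0" by (simp add: invL_def Nm_scale Nm_sh)
    show "Nm eps0 \<noteq> 0" using eps0_nonzero aniso by blast
  qed
  have "rtriv (\<lambda>x. U eps0 (\<rho> (U ?i x)))"
    by (rule rtriv_comp[OF rtriv_comp[OF rtriv_U[OF N(1)] r] rtriv_U[OF N(2)]])
  moreover have "U eps0 (\<rho> (U ?i l)) = jp (\<tau> l) (\<tau> (\<tau> Qx))" if l: "l \<in> gen m" for l
  proof (rule rep_inj[OF _ _ y])
    define s where "s = U ?i l"
    have s: "s \<in> SS" unfolding s_def by (intro S_U iS SS_gen l)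
    show "U eps0 (\<rho> (U ?i l)) \<in> SS" by (intro S_U eps0_S rs iS SS_gen l)
    show "jp (\<tau> l) (\<tau> (\<tau> Qx)) \<in> SS" by (intro SS_gen gen_jp tau_gen l Qx_gen)
    let ?d = "act eps0 y - dl y"
    have d: "?d \<in> Y" "act eps0 y \<in> Y" by (intro Y_diff act_Y eps0_S dl_Y y)+
    have zy: "zs y \<in> Y" by (rule zs_Y[OF y(1)])
    have "act (U eps0 (\<rho> s)) y = act eps0 (act (\<rho> s) (act eps0 y))"
      by (rule rep_U[OF eps0_S rs(1)[OF s] y(1)])
    also have "\<dots> = act eps0 (act s ?d) + dl (act s ?d)"
      unfolding rs(2)[OF s d(2)] using s y d
      by (simp add: act_lin dl_lin E_E0 act_Y eps_S eps0_S dl_Y dl_S[symmetric] dl_dl)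
    also have "\<dots> = zz (act sp (act s ?d))"
      using zz_sp[OF act_Y[OF s d(1)]] by (simp only: add.commute)
    also have "?d = act sp (zs y)" by (rule sp_zs[OF y(1), symmetric])
    also have "act sp (act s (act sp (zs y))) = act l (zs y)"
    proof -
      have "act s (act sp (zs y)) = act ?i (act l (act ?i (act sp (zs y))))"
        unfolding s_def by (rule rep_U[OF iS SS_gen[OF l] act_Y[OF sp_S zy]])
      also have "act ?i (act sp (zs y)) = zs y" by (rule act_invL(1)[OF sp_S sp_nonzero zy])
      finally show ?thesis using act_invL(2)[OF sp_S sp_nonzero gen_act_Y[OF l zy]] by simp
    qed
    also have "zz (act l (zs y)) = act (jp (\<tau> l) (\<tau> (\<tau> Qx))) y"
      using y(1) l by (simp add: zz_act zs_Y zz_zs aa tau_gen Qx_gen Yv)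
    finally show "act (U eps0 (\<rho> (U ?i l))) y = act (jp (\<tau> l) (\<tau> (\<tau> Qx))) y" unfolding s_def .
  qed
  ultimately show ?thesis by blast
qed

end

section \<open>Multiplications of L by quotients of values of Q\<close>

context cubic
begin

text \<open>N(x + y) - N(x - y) - 2 N(y) = 2 T(x#, y), so a norm equation polarises on a subspace
  with no formula for the sharp of g x.\<close>

lemma sim_polar:
  assumes g: "\<And>x y. g (x + y) = g x + g y" "\<And>k x. g (k *s x) = k *s g x" "\<And>x. x \<in> W \<Longrightarrow> Nm (g x) = \<nu> * Nm x"
    and W: "vec.subspace W" and xyz: "x \<in> W" "y \<in> W" "z \<in> W"
  shows "T (sh (g x)) (g y) = \<nu> * T (sh x) y" "T (g x \<bowtie> g y) (g z) = \<nu> * T (x \<bowtie> y) z"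
proof -
  have h: "2 * T (sh x) y = Nm (x + y) - Nm (x + (-1) *s y) - 2 * Nm y" for x y
    by (simp add: Nm_add Nm_diff algebra_simps)
  have s: "T (sh (g x)) (g y) = \<nu> * T (sh x) y" if "x \<in> W" "y \<in> W" for x y
  proof (rule mult_cancel[OF two])
    have m: "x + y \<in> W" "x + (-1) *s y \<in> W" by (intro vec.subspace_add[OF W] vec.subspace_scale[OF W] that)+
    have "2 * T (sh (g x)) (g y) = \<nu> * (2 * T (sh x) y)"
      unfolding h g(1,2)[symmetric] g(3)[OF m(1)] g(3)[OF m(2)] g(3)[OF that(2)] by (simp add: algebra_simps)
    then show "2 * T (sh (g x)) (g y) = 2 * (\<nu> * T (sh x) y)" by simp
  qed
  show "T (sh (g x)) (g y) = \<nu> * T (sh x) y" by (rule s[OF xyz(1,2)])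
  have X: "x \<bowtie> y = sh (x + y) - sh x - sh y" for x y by (simp add: sh_add)
  show "T (g x \<bowtie> g y) (g z) = \<nu> * T (x \<bowtie> y) z"
    unfolding X[of "g x" "g y"] X[of x y] T_diff g(1)[symmetric] s[OF vec.subspace_add[OF W xyz(1,2)] xyz(3)] s[OF xyz(1,3)] s[OF xyz(2,3)]
    by (simp add: algebra_simps)
qed

end

context cubic_div
begin

lemma gen_jp_assoc:
  assumes m: "m \<notin> scal" and l: "k \<in> gen m" "l \<in> gen m" "l' \<in> gen m"
  shows "jp (jp k l) l' = jp k (jp l l')"
proof -
  obtain a b c p q r where sf: "split_field cr T e crE TE (emb e) to_ac m a b c p q r"
    by (rule split_field_exists[OF m])
  interpret split_field cr T e crE TE "emb e" to_ac m a b c p q r by (rule sf)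
  show ?thesis by (rule coe_eqI) (simp_all add: gen_jp l coe_jp)
qed

lemma gen_inv:
  assumes m: "m \<notin> scal" and l: "l \<in> gen m" "l \<noteq> 0" shows "jp (invL l) l = e" "invL l \<noteq> 0"
proof -
  obtain a b c p q r where sf: "split_field cr T e crE TE (emb e) to_ac m a b c p q r"
    by (rule split_field_exists[OF m])
  interpret split_field cr T e crE TE "emb e" to_ac m a b c p q r by (rule sf)
  have n: "coe a l \<noteq> 0" using coe_inj l by blast
  show 1: "jp (invL l) l = e"
    by (rule coe_eqI) (simp_all add: gen_jp l coe_jp invL_gen gen_unit coe_invL coe_unit n)
  show "invL l \<noteq> 0"
  proof
    assume "invL l = 0"
    then have "jp 0 l = e" using 1 by simp
    then show False using unit_nonzero by (simp add: jp_def)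
  qed
qed

lemma gen_Nm_jp:
  assumes m: "m \<notin> scal" and l: "k \<in> gen m" "l \<in> gen m" shows "Nm (jp k l) = Nm k * Nm l"
proof -
  obtain a b c p q r where sf: "split_field cr T e crE TE (emb e) to_ac m a b c p q r"
    by (rule split_field_exists[OF m])
  interpret split_field cr T e crE TE "emb e" to_ac m a b c p q r by (rule sf)
  have "to_ac (Nm (jp k l)) = to_ac (Nm k * Nm l)"
    by (simp only: io_Nm gen_jp l coe_jp split_field.coe_jp[OF rotate] split_field.coe_jp[OF split_field.rotate[OF rotate]] io_mult)
      (simp add: ac_simps)
  then show ?thesis by (simp only: io_eq)
qed

lemma gen_cancel:
  assumes m: "m \<notin> scal" and k: "k \<in> gen m" "k \<noteq> 0" and l: "l \<in> gen m" "l' \<in> gen m" "jp k l = jp k l'"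
  shows "l = l'"
proof -
  have "jp (jp (invL k) k) l = jp (jp (invL k) k) l'"
    using gen_jp_assoc[OF m invL_gen[OF k(1)] k(1)] l by simp
  then show ?thesis by (simp add: gen_inv[OF m k] jp_unit)
qed

lemma jp_nonzero:
  assumes m: "m \<notin> scal" and k: "k \<in> gen m" "k \<noteq> 0" "l \<in> gen m" "l \<noteq> 0" shows "jp k l \<noteq> 0"
proof
  assume "jp k l = 0"
  then have "Nm k * Nm l = 0" using gen_Nm_jp[OF m k(1,3)] by simp
  then show False using aniso k by auto
qed

lemma gen_U: assumes m: "m \<notin> scal" and l: "k \<in> gen m" "l \<in> gen m" shows "U k l = jp k (jp k l)"
  unfolding U_jp gen_jp_assoc[OF m l(1,1,2)] by (simp add: vec_eq_iff)

lemma prL_act: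
  assumes m: "m \<notin> scal" and l: "l \<in> gen m" and x: "x \<in> vert m" "y \<in> vert m"
  shows "prL m (x \<bowtie> act l y) = jp l (prL m (x \<bowtie> y))"
proof -
  obtain a b c p q r where sf: "split_field cr T e crE TE (emb e) to_ac m a b c p q r"
    by (rule split_field_exists[OF m])
  interpret split_field cr T e crE TE "emb e" to_ac m a b c p q r by (rule sf)
  show ?thesis
    by (rule coe_eqI) (simp_all add: prL(1) gen_jp l coe_jp coe_prL_X x act_vert cmp_act' E.bilin)
qed

lemma jp_lin_left: "jp (x + y) z = jp x z + jp y z" "jp (k *s x) z = k *s jp x z" "jp (x - y) z = jp x z - jp y z"
  using jp_lin(1)[of z x y] jp_lin(2)[of z k x] jp_lin(1)[of z "x - y" y] by (simp_all add: jp_commute[of _ z])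

text \<open>Multiplication of L by Q(y) / Q(x) is induced by an R-trivial similarity; stated without
  division.\<close>

definition reach where
  "reach m x y \<longleftrightarrow> (\<exists>\<rho>. rtriv \<rho> \<and> (\<forall>l\<in>gen m. \<rho> l \<in> gen m \<and> jp (prL m (x \<bowtie> x)) (\<rho> l) = jp (prL m (y \<bowtie> y)) l))"

lemma reach_trans: assumes "reach m x y" "reach m y z" shows "reach m x z"
proof -
  obtain \<rho> \<rho>' where "rtriv \<rho>" "\<forall>l\<in>gen m. \<rho> l \<in> gen m \<and> jp (prL m (x \<bowtie> x)) (\<rho> l) = jp (prL m (y \<bowtie> y)) l"
    "rtriv \<rho>'" "\<forall>l\<in>gen m. \<rho>' l \<in> gen m \<and> jp (prL m (y \<bowtie> y)) (\<rho>' l) = jp (prL m (z \<bowtie> z)) l"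
    using assms unfolding reach_def by blast
  then show ?thesis unfolding reach_def
    by (intro exI[of _ "\<lambda>l. \<rho> (\<rho>' l)"]) (simp add: rtriv_comp)
qed

text \<open>Choose k in L with w = k y - x orthogonal to x. Then k^2 Q(y) = Q(x) + Q(w), so h = k^2
  Q(y) / Q(x) is 1 + Q(w) / Q(x). Multiplication by h is the end point of a curve if h is outside K
  and a homothety otherwise; U of the inverse of k removes k^2.\<close>

lemma reach_step:
  assumes m: "m \<notin> scal" and x: "x \<in> vert m" and y: "y \<in> vert m"
    and qx: "prL m (x \<bowtie> x) \<noteq> 0" and qy: "prL m (y \<bowtie> y) \<noteq> 0" and qxy: "prL m (x \<bowtie> y) \<noteq> 0"
  shows "reach m x y"
proof -
  let ?a = "prL m (x \<bowtie> x)" and ?b = "prL m (y \<bowtie> y)" and ?p = "prL m (x \<bowtie> y)"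
  note G = prL(1)[of m]
  note as = gen_jp_assoc[OF m]
  define k where "k = jp (invL ?p) ?a"
  have k: "k \<in> gen m" unfolding k_def by (intro gen_jp invL_gen G)
  have k0: "k \<noteq> 0" unfolding k_def by (intro jp_nonzero[OF m] invL_gen G gen_inv[OF m] qxy qx)
  have "jp ?p k = jp (jp ?p (invL ?p)) ?a" unfolding k_def by (rule as[OF G invL_gen[OF G] G, symmetric])
  then have kp: "jp k ?p = ?a"
    by (simp add: jp_commute[of ?p "invL ?p"] gen_inv[OF m G qxy] jp_unit jp_commute[of ?p k])
  define w where "w = act k y - x"
  have w: "w \<in> vert m" unfolding w_def by (intro vert_diff act_vert k x y)
  have orth: "prL m (x \<bowtie> w) = 0"
    unfolding w_def X_diff_right prL_diff prL_act[OF m k x y] kp by simp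
  have kk: "jp k (jp k ?b) \<in> gen m" by (intro gen_jp k G)
  have ww: "prL m (w \<bowtie> w) = jp k (jp k ?b) - ?a"
  proof -
    have "prL m (w \<bowtie> w) = prL m (w \<bowtie> act k y) - prL m (x \<bowtie> w)"
      unfolding w_def[symmetric] by (subst (2) w_def) (simp add: X_diff_right prL_diff X_commute[of w x])
    also have "\<dots> = jp k (prL m (y \<bowtie> w))"
      using prL_act[OF m k w y] orth by (simp add: X_commute[of w y])
    also have "prL m (y \<bowtie> w) = jp k ?b - ?p"
      unfolding w_def by (simp add: X_diff_right prL_diff prL_act[OF m k y y] X_commute[of y x])
    finally show ?thesis using jp_lin(1)[of k "jp k ?b - ?p" ?p] by (simp add: kp algebra_simps)
  qed
  define h where "h = jp (invL ?a) (jp k (jp k ?b))"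
  have h: "h \<in> gen m" unfolding h_def by (intro gen_jp invL_gen G k)
  have h0: "h \<noteq> 0" unfolding h_def by (intro jp_nonzero[OF m] gen_jp invL_gen G gen_inv[OF m] k k0 qx qy)
  have ah: "jp ?a h = jp k (jp k ?b)"
  proof -
    have "jp ?a h = jp (jp (invL ?a) ?a) (jp k (jp k ?b))"
      unfolding h_def jp_commute[of "invL ?a" ?a] by (rule as[OF G invL_gen[OF G] kk, symmetric])
    then show ?thesis by (simp add: gen_inv[OF m G qx] jp_unit)
  qed
  have "\<exists>\<rho>. rtriv \<rho> \<and> (\<forall>l\<in>gen m. \<rho> l = jp h l)"
  proof (cases "h - e \<in> scal")
    case True
    then obtain c where "h - e = c *s e" by (auto simp: scal_def)
    then have hc: "h = (c + 1) *s e" by (simp add: vec_eq_iff algebra_simps)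
    have "c + 1 \<noteq> 0" using h0 unfolding hc by (metis vec.scale_zero_left)
    then have "rtriv (\<lambda>l. (c + 1) *s l)" by (rule rtriv_scale)
    then show ?thesis using hc by (auto simp: jp_lin_left jp_unit)
  next
    case False
    let ?m = "h - e"
    have gm: "gen ?m = gen m" by (rule gen_eq[OF _ False m]) (intro gen_diff h gen_unit)
    have vm: "vert ?m = vert m" by (rule vert_eq[OF gm])
    have pm: "prL ?m = prL m" by (rule ext) (simp add: prL_def gm vm)
    have ratio: "jp ?m ?a = prL m (w \<bowtie> w)"
      unfolding ww jp_lin_left jp_commute[of h] ah by (simp add: jp_unit)
    obtain a b c p q r where sf: "split_field cr T e crE TE (emb e) to_ac ?m a b c p q r"
      by (rule split_field_exists[OF False])
    interpret split_field cr T e crE TE "emb e" to_ac ?m a b c p q r by (rule sf)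
    interpret V: curve_data cr T e crE TE "emb e" to_ac ?m a b c p q r x w
      by unfold_locales (use x w orth ratio qx vm pm in auto)
    have "V.rr 1 l = jp h l" if "l \<in> gen m" for l
      using V.rr_gen[of l 1] that gm by (simp add: V.gt_def)
    then show ?thesis using V.rtriv_rr by blast
  qed
  then obtain \<rho> where r: "rtriv \<rho>" "\<And>l. l \<in> gen m \<Longrightarrow> \<rho> l = jp h l" by blast
  have ik: "invL k \<in> gen m" "Nm (invL k) \<noteq> 0" using invL_gen[OF k] gen_inv[OF m k k0] aniso by blast+
  have "rtriv (\<lambda>l. U (invL k) (\<rho> l))" by (rule rtriv_comp[OF r(1) rtriv_U[OF ik(2)]])
  moreover have "U (invL k) (\<rho> l) \<in> gen m \<and> jp ?a (U (invL k) (\<rho> l)) = jp ?b l" if l: "l \<in> gen m" for l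
  proof
    have hl: "jp h l \<in> gen m" by (intro gen_jp h l)
    have u: "U (invL k) (\<rho> l) = jp (invL k) (jp (invL k) (jp h l))"
      unfolding r(2)[OF l] by (rule gen_U[OF m ik(1) hl])
    have iih: "jp (invL k) (jp (invL k) (jp h l)) \<in> gen m" by (intro gen_jp ik h l)
    show "U (invL k) (\<rho> l) \<in> gen m" unfolding u by (rule iih)
    have sw: "jp ?a (jp (invL k) z) = jp (invL k) (jp ?a z)" if "z \<in> gen m" for z
      using as[OF G ik(1) that] as[OF ik(1) G that] by (metis jp_commute)
    have kc: "jp (invL k) (jp k z) = z" if "z \<in> gen m" for z
      using as[OF ik(1) k that] gen_inv[OF m k k0] by (simp add: jp_unit)
    have "jp ?a (U (invL k) (\<rho> l)) = jp (invL k) (jp (invL k) (jp ?a (jp h l)))"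
      unfolding u sw[OF gen_jp[OF ik(1) hl]] sw[OF hl] ..
    also have "jp ?a (jp h l) = jp k (jp k (jp ?b l))"
      unfolding as[OF G h l, symmetric] ah as[OF k gen_jp[OF k G] l] as[OF k G l] ..
    also have "jp (invL k) (jp (invL k) (jp k (jp k (jp ?b l)))) = jp ?b l"
      using kc[OF gen_jp[OF k gen_jp[OF G l]]] kc[OF gen_jp[OF G l]] by simp
    finally show "jp ?a (U (invL k) (\<rho> l)) = jp ?b l" .
  qed
  ultimately show ?thesis unfolding reach_def by blast
qed

text \<open>For orthogonal x and y the path goes through x + k y. The values Q(x) + k^2 Q(y) for k =
  1 and k = 2 differ by 3 Q(y), so they do not both vanish.\<close>

lemma reach_all:
  assumes m: "m \<notin> scal" and x: "x \<in> vert m" and y: "y \<in> vert m"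
    and qx: "prL m (x \<bowtie> x) \<noteq> 0" and qy: "prL m (y \<bowtie> y) \<noteq> 0"
  shows "reach m x y"
proof (cases "prL m (x \<bowtie> y) = 0")
  case False
  then show ?thesis using reach_step assms by blast
next
  case True
  have step: "reach m x y" if k: "k \<noteq> 0" "prL m (x \<bowtie> x) + k^2 *s prL m (y \<bowtie> y) \<noteq> 0" for k
  proof -
    let ?z = "x + k *s y"
    have z: "?z \<in> vert m" by (intro vert_add vert_scale x y)
    have "?z \<bowtie> ?z = x \<bowtie> x + (2 * k) *s (x \<bowtie> y) + k^2 *s (y \<bowtie> y)"
      by (simp add: bilin X_commute[of y x] vec_eq_iff algebra_simps power2_eq_square)
    then have "prL m (?z \<bowtie> ?z) = prL m (x \<bowtie> x) + k^2 *s prL m (y \<bowtie> y)"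
      by (simp only: prL_add prL_scale True) simp
    then have z1: "prL m (?z \<bowtie> ?z) \<noteq> 0" using k(2) by simp
    have zz: "prL m (x \<bowtie> ?z) \<noteq> 0" "prL m (?z \<bowtie> y) \<noteq> 0"
      using True k qx qy by (simp_all add: X_add X_add_right X_scale X_scale_right prL_add prL_scale)
    show ?thesis
      by (rule reach_trans[OF reach_step[OF m x z qx z1 zz(1)] reach_step[OF m z y z1 qy zz(2)]])
  qed
  show ?thesis
  proof (cases "prL m (x \<bowtie> x) + 1^2 *s prL m (y \<bowtie> y) = 0")
    case False
    then show ?thesis using step[of 1] by simp
  next
    case t: True
    have "prL m (x \<bowtie> x) + 2^2 *s prL m (y \<bowtie> y) \<noteq> 0"
    proof
      assume "prL m (x \<bowtie> x) + 2^2 *s prL m (y \<bowtie> y) = 0"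
      moreover have "prL m (x \<bowtie> x) = - prL m (y \<bowtie> y)" using t by (simp add: add_eq_0_iff)
      ultimately have "3 *s prL m (y \<bowtie> y) = 0" by (simp add: vec_eq_iff)
      then show False using three qy by simp
    qed
    then show ?thesis by (rule step[OF two])
  qed
qed

lemma subalg_gen: "subalg cr T e (gen m)"
  by unfold_locales (simp_all add: subspace_gen gen_unit gen_X)

lemma gen_nondeg: "x \<in> gen m \<Longrightarrow> (\<And>l. l \<in> gen m \<Longrightarrow> T x l = 0) \<Longrightarrow> x = 0"
  using gen_vert vertI by blast

lemma gen_X_span: "l \<in> gen m \<Longrightarrow> (\<And>k k'. k \<in> gen m \<Longrightarrow> k' \<in> gen m \<Longrightarrow> T x (k \<bowtie> k') = 0) \<Longrightarrow> T x l = 0"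
proof -
  assume l: "l \<in> gen m" and h: "\<And>k k'. k \<in> gen m \<Longrightarrow> k' \<in> gen m \<Longrightarrow> T x (k \<bowtie> k') = 0"
  have "2 * T x e = 0" using h[OF gen_unit gen_unit] by (simp add: X_self bilin)
  then have "T x e = 0" using two by simp
  moreover have "T x (e \<bowtie> l) = 0" by (rule h[OF gen_unit l])
  ultimately show ?thesis by (simp add: X_unit bilin)
qed

lemma vert_aniso: assumes m: "m \<notin> scal" and big: "CARD('n) > 3" shows "\<exists>z\<in>vert m. prL m (z \<bowtie> z) \<noteq> 0"
proof -
  interpret G: subalg cr T e "gen m" by (rule subalg_gen)
  have Yv: "G.Y = vert m" using G.Y_vert[OF gen_self] vert_gen by (auto simp: G.Y_def)
  have "gen m \<noteq> UNIV"
  proof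
    assume "gen m = UNIV"
    then have "vec.dim (UNIV :: ('a ^ 'n) set) = 3" using dim_gen[OF m] by simp
    then show False using big by (simp add: vec.dim_UNIV card_cart_basis)
  qed
  then obtain x0 where "x0 \<notin> gen m" by blast
  moreover obtain s where "s \<in> gen m" "x0 - s \<in> G.Y" using G.S_Y by blast
  ultimately show ?thesis using G.Y_anisotropic[of "x0 - s" m] Yv by auto
qed

text \<open>For z in V the similarity equation gives u Q(g z) = \<nu> Q(z). Hence the R-trivial map
  for Q(g z) / Q(z) multiplies L by \<nu> / u, and U u divided by \<nu> corrects this to u.\<close>

lemma linear_case:
  assumes m: "m \<notin> scal" and big: "CARD('n) > 3"
    and g: "\<And>x y. g (x + y) = g x + g y" "\<And>k x. g (k *s x) = k *s g x" "\<And>x. Nm (g x) = \<nu> * Nm x" "\<nu> \<noteq> 0"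
    and gl: "\<And>l. l \<in> gen m \<Longrightarrow> g l = jp u l" and u: "u \<in> gen m"
  shows "\<exists>\<rho>. rtriv \<rho> \<and> (\<forall>l\<in>gen m. \<rho> l = g l)"
proof -
  have ge: "g e = u" using gl[OF gen_unit] by (simp add: jp_commute[of u] jp_unit)
  have Nu: "Nm u = \<nu>" using g(3)[of e] by (simp add: ge)
  have u0: "u \<noteq> 0" using Nu g(4) by auto
  obtain z where z: "z \<in> vert m" "prL m (z \<bowtie> z) \<noteq> 0" using vert_aniso[OF m big] by blast
  have P: "T (g x \<bowtie> g y) (g z) = \<nu> * T (x \<bowtie> y) z" for x y z
    by (rule sim_polar(2)[where W = UNIV]) (simp_all add: g)
  have surj: "\<exists>k\<in>gen m. g k = l" if l: "l \<in> gen m" for l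
  proof
    show k: "jp (invL u) l \<in> gen m" by (intro gen_jp invL_gen u l)
    show "g (jp (invL u) l) = l"
      unfolding gl[OF k] gen_jp_assoc[OF m u invL_gen[OF u] l, symmetric] jp_commute[of u "invL u"] gen_inv(1)[OF m u u0] by (rule jp_unit)
  qed
  have gz: "g z \<in> vert m"
  proof (rule vertI, erule gen_X_span)
    fix k k' assume "k \<in> gen m" "k' \<in> gen m"
    then obtain l l' where l: "l \<in> gen m" "l' \<in> gen m" "k = g l" "k' = g l'" using surj by metis
    have "T (g l \<bowtie> g l') (g z) = 0" unfolding P using vert_gen[OF z(1) gen_X[OF l(1,2)]] by (simp add: T_commute)
    then show "T (g z) (k \<bowtie> k') = 0" using l by (simp add: T_commute)
  qed
  have rel: "jp u (prL m (g z \<bowtie> g z)) = \<nu> *s prL m (z \<bowtie> z)"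
  proof -
    have "jp u (prL m (g z \<bowtie> g z)) - \<nu> *s prL m (z \<bowtie> z) = 0"
    proof (rule gen_nondeg)
      show "jp u (prL m (g z \<bowtie> g z)) - \<nu> *s prL m (z \<bowtie> z) \<in> gen m"
        by (intro gen_diff gen_jp gen_scale u prL(1))
      fix l assume l: "l \<in> gen m"
      have pr: "T (prL m y) l = T y l" if "l \<in> gen m" for y l
        using vert_gen[OF prL(2) that, of y] by (simp add: bilin)
      have "T (jp u (prL m (g z \<bowtie> g z))) l = T (prL m (g z \<bowtie> g z)) (jp u l)" by (rule T_jp)
      also have "\<dots> = T (g z \<bowtie> g z) (g l)" using pr[OF gen_jp[OF u l]] gl[OF l] by simp
      also have "\<dots> = \<nu> * T (prL m (z \<bowtie> z)) l" unfolding P pr[OF l] ..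
      finally show "T (jp u (prL m (g z \<bowtie> g z)) - \<nu> *s prL m (z \<bowtie> z)) l = 0" by (simp add: bilin)
    qed
    then show ?thesis by simp
  qed
  have q2: "prL m (g z \<bowtie> g z) \<noteq> 0"
  proof
    assume "prL m (g z \<bowtie> g z) = 0"
    then have "\<nu> *s prL m (z \<bowtie> z) = 0" using rel jp_lin(2)[of u 0 0] by simp
    then show False using z(2) g(4) by simp
  qed
  obtain \<rho> where r: "rtriv \<rho>" and rl: "\<And>l. l \<in> gen m \<Longrightarrow> \<rho> l \<in> gen m"
     "\<And>l. l \<in> gen m \<Longrightarrow> jp (prL m (z \<bowtie> z)) (\<rho> l) = jp (prL m (g z \<bowtie> g z)) l"
    using reach_all[OF m z(1) gz z(2) q2] unfolding reach_def by blast
  have ur: "jp u (\<rho> l) = \<nu> *s l" if l: "l \<in> gen m" for l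
  proof (rule gen_cancel[OF m prL(1) z(2)])
    show "jp u (\<rho> l) \<in> gen m" "\<nu> *s l \<in> gen m" by (intro gen_jp gen_scale u rl l)+
    have "jp (prL m (z \<bowtie> z)) (jp u (\<rho> l)) = jp u (jp (prL m (z \<bowtie> z)) (\<rho> l))"
      using gen_jp_assoc[OF m prL(1) u rl(1)[OF l]] gen_jp_assoc[OF m u prL(1) rl(1)[OF l]] by (metis jp_commute)
    also have "\<dots> = jp (\<nu> *s prL m (z \<bowtie> z)) l"
      unfolding rl(2)[OF l] rel[symmetric] by (rule gen_jp_assoc[OF m u prL(1) l, symmetric])
    finally show "jp (prL m (z \<bowtie> z)) (jp u (\<rho> l)) = jp (prL m (z \<bowtie> z)) (\<nu> *s l)"
      by (simp add: jp_lin jp_lin_left)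
  qed
  have "rtriv (\<lambda>x. U u (inverse \<nu> *s \<rho> x))"
    by (rule rtriv_comp[OF rtriv_comp[OF r rtriv_scale] rtriv_U]) (use g(4) Nu in auto)
  moreover have "U u (inverse \<nu> *s \<rho> l) = g l" if l: "l \<in> gen m" for l
    unfolding gen_U[OF m u gen_scale[OF rl(1)[OF l]]] jp_lin ur[OF l] gl[OF l] using g(4) by simp
  ultimately show ?thesis by blast
qed

end

section \<open>Automorphisms of L, and agreement with g on L\<close>

context twisted
begin

lemma dim_SS: "vec.dim SS \<le> 9"
proof -
  let ?B = "[e, m, sh m, act e x, act m x, act (sh m) x, act e bx, act m bx, act (sh m) bx]"
  have "SS \<subseteq> vec.span (set ?B)"
  proof
    fix s assume "s \<in> SS"
    then obtain l l' l'' where s: "s = l + act l' x + act l'' bx" and l: "l \<in> gen m" "l' \<in> gen m" "l'' \<in> gen m"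
      by (auto simp: SS_def)
    have 1: "l \<in> vec.span (set ?B)"
      using l(1) unfolding gen_def by (clarify, intro vec.span_add vec.span_scale vec.span_base) auto
    have 2: "act l' x \<in> vec.span (set ?B)"
      using l(2) unfolding gen_def by (clarify, unfold act_lin, intro vec.span_add vec.span_scale vec.span_base) auto
    have 3: "act l'' bx \<in> vec.span (set ?B)"
      using l(3) unfolding gen_def by (clarify, unfold act_lin, intro vec.span_add vec.span_scale vec.span_base) auto
    show "s \<in> vec.span (set ?B)" unfolding s by (intro vec.span_add 1 2 3)
  qed
  then have "vec.dim SS \<le> card (set ?B)" by (rule vec.dim_le_card) simp
  also have "\<dots> \<le> length ?B" by (rule card_length)
  finally show ?thesis by simp
qed

end

context cubic_div
begin

lemma sim_bij:
  assumes g: "\<And>x y. g (x + y) = g x + g y" "\<And>k x. g (k *s x) = k *s g x" "\<And>x. Nm (g x) = \<nu> * Nm x" "\<nu> \<noteq> 0"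
  shows "bij g"
proof -
  have l: "Vector_Spaces.linear (*s) (*s) g" by unfold_locales (simp_all add: g)
  have "inj g"
  proof (rule injI)
    fix x y assume "g x = g y"
    moreover have "g (x + (-1) *s y) = g x + (-1) *s g y" by (simp only: g)
    ultimately have "g (x - y) = 0" by simp
    then have "Nm (x - y) = 0" using g(3)[of "x - y"] g(4) by simp
    then show "x = y" using aniso by force
  qed
  then show ?thesis using vec.linear_inj_imp_surj[OF l] by (simp add: bij_def)
qed

text \<open>More than nine dimensions leave a nonzero vector orthogonal to the subalgebra, which is
  what \<open>semilinear\<close> acts on.\<close>

lemma cyclic_case:
  assumes sf: "split_field cr T e crE TE (emb e) to_ac m a b c p q r" and big: "CARD('n) > 9"
    and t: "\<And>l. l \<in> gen m \<Longrightarrow> \<tau> l \<in> gen m"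
      "\<And>l. l \<in> gen m \<Longrightarrow> split_cubic.coe TE to_ac a (\<tau> l) = split_cubic.coe TE to_ac c l"
      "\<And>l. l \<in> gen m \<Longrightarrow> split_cubic.coe TE to_ac b (\<tau> l) = split_cubic.coe TE to_ac a l"
      "\<And>l. l \<in> gen m \<Longrightarrow> split_cubic.coe TE to_ac c (\<tau> l) = split_cubic.coe TE to_ac b l"
  shows "\<exists>\<rho> k. rtriv \<rho> \<and> k \<in> gen m \<and> k \<noteq> 0 \<and> (\<forall>l\<in>gen m. \<rho> l = jp k (\<tau> l))"
proof -
  interpret split_field cr T e crE TE "emb e" to_ac m a b c p q r by (rule sf)
  obtain x where x: "x \<in> vert m" "prL m (x \<bowtie> x) \<noteq> 0" using vert_aniso[OF m] big by auto
  interpret W: twisted cr T e crE TE "emb e" to_ac m a b c p q r x \<tau>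
    by unfold_locales (use x t in auto)
  have "W.SS \<noteq> UNIV"
  proof
    assume "W.SS = UNIV"
    then have "vec.dim (UNIV :: ('a ^ 'n) set) \<le> 9" using W.dim_SS by simp
    then show False using big by (simp add: vec.dim_UNIV card_cart_basis)
  qed
  then obtain x0 where "x0 \<notin> W.SS" by blast
  moreover obtain s where "s \<in> W.SS" "x0 - s \<in> W.Y" using W.S_Y by blast
  ultimately obtain \<rho> where "rtriv \<rho>" "\<forall>l\<in>gen m. \<rho> l = jp (\<tau> l) (\<tau> (\<tau> W.Qx))"
    using W.semilinear[of "x0 - s"] by auto
  then show ?thesis
    using W.tau_gen W.Qx_gen W.tau_nonzero W.Qx_nonzero
    by (intro exI[of _ \<rho>] exI[of _ "\<tau> (\<tau> W.Qx)"]) (auto simp: jp_commute)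
qed

text \<open>With u = g e, the map \<sigma> = u^{-1} g preserves e and the norm on L, hence its
  traces and its product. So \<sigma> m has the conjugates of m as coordinates in permuted order. A
  coordinate left in place forces \<sigma> m = m, which leaves the two 3-cycles.\<close>

lemma match_on_gen:
  assumes m: "m \<notin> scal" and big: "CARD('n) > 9"
    and g: "\<And>x y. g (x + y) = g x + g y" "\<And>k x. g (k *s x) = k *s g x" "\<And>x. Nm (g x) = \<nu> * Nm x" "\<nu> \<noteq> 0"
    and gL: "g ` gen m = gen m"
  shows "\<exists>\<rho>. rtriv \<rho> \<and> (\<forall>l\<in>gen m. \<rho> l = g l)"
proof -
  define u where "u = g e"
  have u: "u \<in> gen m" using gL gen_unit unfolding u_def by blast
  have Nu: "Nm u = \<nu>" using g(3)[of e] by (simp add: u_def)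
  have u0: "u \<noteq> 0" using Nu g(4) by auto
  have iu: "invL u \<in> gen m" by (rule invL_gen[OF u])
  define \<sigma> where "\<sigma> l = jp (invL u) (g l)" for l
  have sl: "\<sigma> (x + y) = \<sigma> x + \<sigma> y" "\<sigma> (k *s x) = k *s \<sigma> x" for x y k
    by (simp_all add: \<sigma>_def g jp_lin)
  have sd: "\<sigma> (x - y) = \<sigma> x - \<sigma> y" for x y using sl(1)[of "x - y" y] by simp
  have gg: "g l \<in> gen m" if "l \<in> gen m" for l using gL that by blast
  have sg: "\<sigma> l \<in> gen m" if "l \<in> gen m" for l unfolding \<sigma>_def by (intro gen_jp iu gg that)
  have gs: "g l = jp u (\<sigma> l)" if "l \<in> gen m" for l
    unfolding \<sigma>_def gen_jp_assoc[OF m u iu gg[OF that], symmetric] jp_commute[of u "invL u"] gen_inv[OF m u u0] jp_unit ..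
  have ss: "\<exists>l\<in>gen m. \<sigma> l = k" if k: "k \<in> gen m" for k
  proof -
    obtain l where l: "l \<in> gen m" "g l = jp u k" using gL gen_jp[OF u k] by (metis imageE)
    have "\<sigma> l = k"
      unfolding \<sigma>_def l(2) gen_jp_assoc[OF m iu u k, symmetric] gen_inv[OF m u u0] jp_unit ..
    then show ?thesis using l by blast
  qed
  have se: "\<sigma> e = e" unfolding \<sigma>_def u_def[symmetric] by (rule gen_inv(1)[OF m u u0])
  have N: "Nm (\<sigma> l) = 1 * Nm l" if "l \<in> gen m" for l
  proof -
    have "Nm (invL u) * \<nu> = 1" using gen_Nm_jp[OF m iu u] gen_inv(1)[OF m u u0] Nu by simp
    then show ?thesis unfolding \<sigma>_def gen_Nm_jp[OF m iu gg[OF that]] g(3) by (simp add: mult.assoc[symmetric])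
  qed
  have P: "T (sh (\<sigma> x)) (\<sigma> y) = T (sh x) y" "T (\<sigma> x \<bowtie> \<sigma> y) (\<sigma> z) = T (x \<bowtie> y) z"
    if "x \<in> gen m" "y \<in> gen m" "z \<in> gen m" for x y z
    using sim_polar[of \<sigma> "gen m" 1 x y z, OF sl N subspace_gen that] by simp_all
  have Te: "T (\<sigma> l) e = T l e" if "l \<in> gen m" for l
    using P(1)[OF gen_unit that gen_unit] by (simp add: se T_commute)
  have sX: "\<sigma> (l \<bowtie> k) = \<sigma> l \<bowtie> \<sigma> k" if lk: "l \<in> gen m" "k \<in> gen m" for l k
  proof -
    have TT: "T (\<sigma> l) (\<sigma> k) = T l k" if "l \<in> gen m" "k \<in> gen m" for l k
      using P(2)[OF that gen_unit] Te that by (simp add: se T_X_unit)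
    have "\<sigma> (l \<bowtie> k) - \<sigma> l \<bowtie> \<sigma> k = 0"
    proof (rule gen_nondeg)
      show "\<sigma> (l \<bowtie> k) - \<sigma> l \<bowtie> \<sigma> k \<in> gen m" by (intro gen_diff sg gen_X lk)
      fix j assume "j \<in> gen m"
      then obtain i where i: "i \<in> gen m" "\<sigma> i = j" using ss by blast
      show "T (\<sigma> (l \<bowtie> k) - \<sigma> l \<bowtie> \<sigma> k) j = 0"
        unfolding i(2)[symmetric] T_diff TT[OF gen_X[OF lk] i(1)] P(2)[OF lk i(1)] by simp
    qed
    then show ?thesis by simp
  qed
  have ssh: "\<sigma> (sh l) = sh (\<sigma> l)" if "l \<in> gen m" for l
    unfolding sh_def by (simp only: sl sX that)
  have sj: "\<sigma> (jp l k) = jp (\<sigma> l) (\<sigma> k)" if "l \<in> gen m" "k \<in> gen m" for l k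
  proof -
    have "T (\<sigma> l \<bowtie> \<sigma> k) e = T (l \<bowtie> k) e" using Te[OF gen_X[OF that]] sX[OF that] by simp
    then show ?thesis unfolding jp_def using that by (simp only: sl sd sX se Te)
  qed
  \<comment> \<open>An R-trivial \<rho> equal to k \<sigma> on L makes \<rho>^{-1} g linear over L,
    the case already settled.\<close>
  have finish: ?thesis if r: "rtriv \<rho>" "k \<in> gen m" "k \<noteq> 0" "\<And>l. l \<in> gen m \<Longrightarrow> \<rho> l = jp k (\<sigma> l)" for \<rho> k
  proof -
    note rl = rtriv_lin[OF r(1)]
    obtain \<mu> where mu: "\<mu> \<noteq> 0" "\<And>x. Nm (\<rho> x) = \<mu> * Nm x" using rl(3) by blast
    have bij: "bij \<rho>" by (rule sim_bij[OF rl(1,2) mu(2,1)])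
    define i where "i = inv_into UNIV \<rho>"
    have ri: "\<rho> (i x) = x" "i (\<rho> x) = x" for x
      using bij by (simp_all add: i_def bij_def surj_f_inv_f)
    have il: "i (x + y) = i x + i y" "i (c *s x) = c *s i x" for x y c
    proof -
      have "\<rho> (i x + i y) = x + y" "\<rho> (c *s i x) = c *s x" by (simp_all add: rl ri)
      then show "i (x + y) = i x + i y" "i (c *s x) = c *s i x" using ri(2) by metis+
    qed
    have iN: "Nm (i x) = inverse \<mu> * Nm x" for x
      using mu(2)[of "i x"] mu(1) by (simp add: ri)
    obtain u' where u': "u' \<in> gen m" "\<sigma> u' = jp (invL k) u"
      using ss[OF gen_jp[OF invL_gen[OF r(2)] u]] by blast
    have gi: "i (g l) = jp u' l" if l: "l \<in> gen m" for l
    proof -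
      have "\<rho> (jp u' l) = jp k (jp (jp (invL k) u) (\<sigma> l))"
        unfolding r(4)[OF gen_jp[OF u'(1) l]] sj[OF u'(1) l] u'(2) ..
      also have "\<dots> = jp (jp (jp k (invL k)) u) (\<sigma> l)"
        using gen_jp_assoc[OF m r(2) gen_jp[OF invL_gen[OF r(2)] u] sg[OF l]] gen_jp_assoc[OF m r(2) invL_gen[OF r(2)] u]
        by simp
      also have "\<dots> = g l"
        unfolding jp_commute[of k "invL k"] gen_inv(1)[OF m r(2,3)] jp_unit gs[OF l] ..
      finally show ?thesis using ri(2) by metis
    qed
    have "\<exists>\<rho>1. rtriv \<rho>1 \<and> (\<forall>l\<in>gen m. \<rho>1 l = i (g l))"
    proof (rule linear_case[OF m, where u = u' and \<nu> = "inverse \<mu> * \<nu>" and g = "\<lambda>x. i (g x)"])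
      show "3 < CARD('n)" using big by simp
      show "Nm (i (g x)) = (inverse \<mu> * \<nu>) * Nm x" for x by (simp add: iN g)
      show "inverse \<mu> * \<nu> \<noteq> 0" using mu g(4) by simp
      show "u' \<in> gen m" by (rule u'(1))
    qed (simp_all add: g il gi)
    then obtain \<rho>1 where "rtriv \<rho>1" "\<forall>l\<in>gen m. \<rho>1 l = i (g l)" by blast
    then show ?thesis using rtriv_comp[of \<rho>1 \<rho>] r(1) ri(1) by (intro exI[of _ "\<lambda>x. \<rho> (\<rho>1 x)"]) simp
  qed
  obtain a b c p q r where sf: "split_field cr T e crE TE (emb e) to_ac m a b c p q r"
    by (rule split_field_exists[OF m])
  interpret A: split_field cr T e crE TE "emb e" to_ac m a b c p q r by (rule sf)
  interpret B: split_field cr T e crE TE "emb e" to_ac m b c a q r p by (rule A.rotate)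
  interpret C: split_field cr T e crE TE "emb e" to_ac m c a b r p q by (rule B.rotate)
  define x y z where "x = A.coe a (\<sigma> m)" and "y = A.coe b (\<sigma> m)" and "z = A.coe c (\<sigma> m)"
  note sm = sg[OF gen_self]
  have s1: "x + y + z = p + q + r"
    unfolding x_def y_def z_def A.em_T_unit[OF sm, symmetric] Te[OF gen_self]
    by (simp only: A.em_T_unit[OF gen_self] A.coe_m B.coe_m C.coe_m)
  have s2: "y * z + z * x + x * y = q * r + r * p + p * q"
  proof -
    have "T (sh (\<sigma> m)) e = T (sh m) e" using Te[OF gen_sh_self] ssh[OF gen_self] by simp
    then have "to_ac (T (sh (\<sigma> m)) e) = to_ac (T (sh m) e)" by simp
    then show ?thesis
      unfolding x_def y_def z_def A.em_T_unit[OF gen_sh[OF sm]] A.em_T_unit[OF gen_sh_self] A.coe_sh[OF sm] B.coe_sh[OF sm] C.coe_sh[OF sm]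
        A.coe_sh[OF gen_self] B.coe_sh[OF gen_self] C.coe_sh[OF gen_self] A.coe_m B.coe_m C.coe_m .
  qed
  have s3: "x * y * z = p * q * r"
  proof -
    have "to_ac (Nm (\<sigma> m)) = to_ac (Nm m)" using N[OF gen_self] by simp
    then show ?thesis
      unfolding x_def y_def z_def A.io_Nm[OF sm] A.io_Nm[OF gen_self] A.coe_m B.coe_m C.coe_m .
  qed
  have id: ?thesis if "\<sigma> m = m"
  proof (rule finish[OF rtriv_id gen_unit unit_nonzero])
    fix l assume "l \<in> gen m"
    then obtain \<alpha> \<beta> \<gamma> where "l = \<alpha> *s e + \<beta> *s m + \<gamma> *s sh m" by (auto simp: gen_def)
    then show "l = jp e (\<sigma> l)" using ssh[OF gen_self] that by (simp add: jp_unit sl se)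
  qed
  have idx: ?thesis if "x = p \<or> y = q \<or> z = r"
  proof (rule id)
    show "\<sigma> m = m"
      using that A.coe_eqI[OF sm gen_self] B.coe_eqI[OF sm gen_self] C.coe_eqI[OF sm gen_self]
      unfolding x_def y_def z_def A.coe_m B.coe_m C.coe_m by blast
  qed
  have co: "A.coe d (\<sigma> l) = A.coe d' l"
    if "A.coe d (\<sigma> m) = A.coe d' m" "A.coe d (sh (\<sigma> m)) = A.coe d' (sh m)" "A.coe d e = 1" "A.coe d' e = 1" "l \<in> gen m"
    for d d' l
  proof -
    from that(5) obtain \<alpha> \<beta> \<gamma> where "l = \<alpha> *s e + \<beta> *s m + \<gamma> *s sh m" by (auto simp: gen_def)
    then show ?thesis using that ssh[OF gen_self] by (simp add: sl se A.coe_lin)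
  qed
  have cs: "A.coe a (sh (\<sigma> m)) = y * z" "A.coe b (sh (\<sigma> m)) = z * x" "A.coe c (sh (\<sigma> m)) = x * y"
    "A.coe a (sh m) = q * r" "A.coe b (sh m) = r * p" "A.coe c (sh m) = p * q"
    by (simp_all add: A.coe_sh B.coe_sh C.coe_sh sm gen_self A.coe_m B.coe_m C.coe_m x_def y_def z_def)
  note cu = A.coe_unit B.coe_unit C.coe_unit
  note xs = x_def[symmetric] y_def[symmetric] z_def[symmetric] A.coe_m B.coe_m C.coe_m cs cu
  have "(x - p) * (x - q) * (x - r) = x^3 - (p + q + r) * x^2 + (q * r + r * p + p * q) * x - p * q * r"
    by (simp add: algebra_simps power2_eq_square power3_eq_cube)
  also have "\<dots> = 0"
    unfolding s1[symmetric] s2[symmetric] s3[symmetric] by (simp add: algebra_simps power2_eq_square power3_eq_cube)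
  finally consider "x = p" | "x = q" | "x = r" by auto
  then show ?thesis
  proof cases
    case 1
    then show ?thesis using idx by blast
  next
    case 2
    have yz: "y + z = r + p" using s1 2 by (simp add: algebra_simps)
    have "y * z + q * (y + z) = r * p + q * (r + p)" using s2 2 by (simp add: algebra_simps)
    then have yz': "y * z = r * p" unfolding yz by simp
    have "(y - r) * (y - p) = y * y - (r + p) * y + r * p" by (simp add: algebra_simps)
    also have "\<dots> = 0" unfolding yz[symmetric] yz'[symmetric] by (simp add: algebra_simps)
    finally consider "y = p" | "y = r" by auto
    then show ?thesis
    proof cases
      case 1
      then have "z = r" using yz by simp
      then show ?thesis using idx by blast
    next
      case y: 2
      then have z: "z = p" using yz by simp
      have c1: "A.coe a (\<sigma> l) = A.coe b l" "A.coe b (\<sigma> l) = A.coe c l" "A.coe c (\<sigma> l) = A.coe a l" if "l \<in> gen m" for l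
        by (rule co; simp add: xs mult.commute that 2 y z)+
      \<comment> \<open>This 3-cycle is inverse to the one built into \<open>twisted\<close>. The
        construction is applied to \<sigma>^2 and its result composed with itself, as \<sigma>^4 =
        \<sigma>.\<close>
      obtain \<rho> k where r: "rtriv \<rho>" "k \<in> gen m" "k \<noteq> 0" "\<And>l. l \<in> gen m \<Longrightarrow> \<rho> l = jp k (\<sigma> (\<sigma> l))"
        using cyclic_case[OF sf big, of "\<lambda>l. \<sigma> (\<sigma> l)"] by (auto simp: sg c1)
      have s3: "\<sigma> (\<sigma> (\<sigma> l)) = l" if "l \<in> gen m" for l
        by (rule A.coe_eqI) (simp_all add: sg c1 that)
      define k' where "k' = jp k (\<sigma> (\<sigma> k))"
      have s0: "\<sigma> l \<noteq> 0" if "l \<in> gen m" "l \<noteq> 0" for l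
      proof
        assume "\<sigma> l = 0"
        then have "Nm l = 0" using N[OF that(1)] by simp
        then show False using aniso that(2) by blast
      qed
      have k': "k' \<in> gen m" "k' \<noteq> 0"
        unfolding k'_def
        by (rule gen_jp[OF r(2) sg[OF sg[OF r(2)]]], rule jp_nonzero[OF m r(2,3) sg[OF sg[OF r(2)]] s0[OF sg[OF r(2)] s0[OF r(2,3)]]])
      show ?thesis
      proof (rule finish[OF rtriv_comp[OF r(1) r(1)] k'])
        fix l assume l: "l \<in> gen m"
        have "\<rho> (\<rho> l) = jp k (\<sigma> (\<sigma> (jp k (\<sigma> (\<sigma> l)))))"
          using r(4) l by (simp add: gen_jp sg r(2))
        also have "\<dots> = jp k (jp (\<sigma> (\<sigma> k)) (\<sigma> l))"
          using l r(2) by (simp add: sj gen_jp sg s3)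
        also have "\<dots> = jp k' (\<sigma> l)"
          unfolding k'_def by (rule gen_jp_assoc[OF m, symmetric]) (simp_all add: l r(2) sg)
        finally show "\<rho> (\<rho> l) = jp k' (\<sigma> l)" .
      qed
    qed
  next
    case 3
    have yz: "y + z = p + q" using s1 3 by (simp add: algebra_simps)
    have "y * z + r * (y + z) = p * q + r * (p + q)" using s2 3 by (simp add: algebra_simps)
    then have yz': "y * z = p * q" unfolding yz by simp
    have "(y - p) * (y - q) = y * y - (p + q) * y + p * q" by (simp add: algebra_simps)
    also have "\<dots> = 0" unfolding yz[symmetric] yz'[symmetric] by (simp add: algebra_simps)
    finally consider "y = q" | "y = p" by auto
    then show ?thesis
    proof cases
      case 1
      then show ?thesis using idx by blast
    next
      case y: 2
      then have z: "z = q" using yz by simp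
      have c1: "A.coe a (\<sigma> l) = A.coe c l" "A.coe b (\<sigma> l) = A.coe a l" "A.coe c (\<sigma> l) = A.coe b l" if "l \<in> gen m" for l
        by (rule co; simp add: xs mult.commute that 3 y z)+
      obtain \<rho> k where "rtriv \<rho>" "k \<in> gen m" "k \<noteq> 0" "\<And>l. l \<in> gen m \<Longrightarrow> \<rho> l = jp k (\<sigma> l)"
        using cyclic_case[OF sf big, of \<sigma>] by (auto simp: sg c1)
      then show ?thesis by (rule finish)
    qed
  qed
qed

end

section \<open>From the given norm structure to the polarised identities\<close>

text \<open>The diagonal is evaluated at x + k y for k = 1, - 1, 2 to get F x x x y = 0; two more
  polarisations reach all arguments. Only 2 and 3 are divided by.\<close>

lemma quartic_polarize:
  fixes F :: "'a::field ^ 'n \<Rightarrow> 'a ^ 'n \<Rightarrow> 'a ^ 'n \<Rightarrow> 'a ^ 'n \<Rightarrow> 'a"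
  assumes two: "(2::'a) \<noteq> 0" and three: "(3::'a) \<noteq> 0"
    and add: "\<And>x x' y z w. F (x + x') y z w = F x y z w + F x' y z w"
    and scale: "\<And>k x y z w. F (k *s x) y z w = k * F x y z w"
    and sym: "\<And>x y z w. F x y z w = F y x z w" "\<And>x y z w. F x y z w = F x z y w" "\<And>x y z w. F x y z w = F x y w z"
    and diag: "\<And>x. F x x x x = 0"
  shows "F x y z w = 0"
proof -
  have add2: "F x (y + y') z w = F x y z w + F x y' z w" for x y y' z w by (metis add sym(1))
  have add3: "F x y (z + z') w = F x y z w + F x y z' w" for x y z z' w by (metis add2 sym(2))
  have add4: "F x y z (w + w') = F x y z w + F x y z w'" for x y z w w' by (metis add3 sym(3))
  have sc2: "F x (k *s y) z w = k * F x y z w" for k x y z w by (metis scale sym(1))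
  have sc3: "F x y (k *s z) w = k * F x y z w" for k x y z w by (metis sc2 sym(2))
  have sc4: "F x y z (k *s w) = k * F x y z w" for k x y z w by (metis sc3 sym(3))
  have c1: "F x x y x = F x x x y" "F x y x x = F x x x y" "F y x x x = F x x x y" for x y by (metis sym)+
  have c2: "F x y x y = F x x y y" "F x y y x = F x x y y" "F y x x y = F x x y y" "F y x y x = F x x y y" "F y y x x = F x x y y"
    for x y by (metis sym)+
  have ex: "4 * k * F x x x y + 6 * k^2 * F x x y y + 4 * k^3 * F y y y x = 0" for k x y
    using diag[of "x + k *s y", unfolded add add2 add3 add4 scale sc2 sc3 sc4]
    unfolding c1[where x = x and y = y] c1[where x = y and y = x] c2[where x = x and y = y] diag
    by (simp add: algebra_simps power2_eq_square power3_eq_cube)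
  have six: "(6::'a) \<noteq> 0"
  proof -
    have "(6::'a) = 2 * 3" by simp
    then show ?thesis using two three by (metis mult_eq_0_iff)
  qed
  have h1: "F x x x y = 0" for x y
  proof -
    have a: "4 * F x x x y + 6 * F x x y y + 4 * F y y y x = 0" using ex[of 1 x y] by simp
    have b: "- (4 * F x x x y) + 6 * F x x y y - 4 * F y y y x = 0" using ex[of "-1" x y] by simp
    have c: "8 * F x x x y + 24 * F x x y y + 32 * F y y y x = 0" using ex[of 2 x y] by simp
    \<comment> \<open>The combination of the three values that eliminates the other two
      coefficients; the factor left is 24.\<close>
    have "(2 * 2) * 6 * F x x x y
        = (4 * F x x x y + 6 * F x x y y + 4 * F y y y x) * 6 - (- (4 * F x x x y) + 6 * F x x y y - 4 * F y y y x) * 2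
         - (8 * F x x x y + 24 * F x x y y + 32 * F y y y x)"
      by (simp add: algebra_simps)
    also have "\<dots> = 0" unfolding a b c by simp
    finally show ?thesis using two six by (metis mult_eq_0_iff)
  qed
  have h2: "F x z z y = 0" for x y z
  proof -
    have d: "F x z x y = F x x z y" "F z x x y = F x x z y" "F z x z y = F x z z y" "F z z x y = F x z z y" for x y z by (metis sym)+
    have e: "3 * F x x z y + 3 * k * F x z z y = 0" if "k \<noteq> 0" for k
    proof -
      have "k * (3 * F x x z y + 3 * k * F x z z y) = 0"
        using h1[of "x + k *s z" y, unfolded add add2 add3 scale sc2 sc3]
        unfolding d[where x = x and y = y and z = z] h1 by (simp add: algebra_simps)
      then show ?thesis using that by simp
    qed
    have "6 * F x z z y = (3 * F x x z y + 3 * 1 * F x z z y) - (3 * F x x z y + 3 * (-1) * F x z z y)" by simp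
    also have "\<dots> = 0 - 0" by (intro arg_cong2[of _ _ _ _ "(-)"] e) simp_all
    also have "\<dots> = 0" by simp
    finally show ?thesis using six by simp
  qed
  have "2 * F x y z w = F x (y + z) (y + z) w - F x y y w - F x z z w"
    unfolding add2 add3 sym(2)[of x z y w] by simp
  then show ?thesis using two by (simp add: h2)
qed

text \<open>Over an infinite field a polynomial function determines its coefficients, so the
  description in \<open>lin\<close> has a unique solution.\<close>

lemma lin_eqI:
  fixes f :: "'k::field ^ 27 \<Rightarrow> 'k"
  assumes inf: "infinite (UNIV :: 'k set)" and eq: "\<And>t. f (x + t *s y) = f x + t * b + t^2 * c + t^3 * d"
  shows "lin f x y = b"
  unfolding lin_def
proof (rule the_equality)
  show "\<exists>c d. \<forall>t. f (x + t *s y) = f x + t * b + t^2 * c + t^3 * d" using eq by blast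
  fix b' assume "\<exists>c d. \<forall>t. f (x + t *s y) = f x + t * b' + t^2 * c + t^3 * d"
  then obtain c' d' where eq': "\<And>t. f (x + t *s y) = f x + t * b' + t^2 * c' + t^3 * d'" by blast
  have "poly [:f x, b', c', d':] t = poly [:f x, b, c, d:] t" for t
    using eq[of t] eq'[of t] by (simp add: algebra_simps power2_eq_square power3_eq_cube)
  then have "[:f x, b', c', d':] = [:f x, b, c, d:]" by (rule poly_eqI_infinite[OF inf])
  then show "b' = b" by simp
qed

lemma cubic_of_division_albert:
  fixes N :: "'k::field ^ 27 \<Rightarrow> 'k"
  assumes inf: "infinite (UNIV :: 'k set)" and two: "(2::'k) \<noteq> 0" and three: "(3::'k) \<noteq> 0"
    and A: "division_albert N S e"
  shows "cubic_div (cross S) (trace2 N e) e" "cubic.Nm (cross S) (trace2 N e) = N"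
    "cubic.jp (cross S) (trace2 N e) e = jprod N S e"
proof -
  from A obtain c d where N: "\<And>x. N x = (\<Sum>i\<in>UNIV. \<Sum>j\<in>UNIV. \<Sum>k\<in>UNIV. c i j k * x$i * x$j * x$k)"
    and S: "\<And>x l. S x $ l = (\<Sum>i\<in>UNIV. \<Sum>j\<in>UNIV. d l i j * x$i * x$j)"
    by (auto simp: division_albert_def cubic_norm_structure_def cubic_form_def quadratic_map_def)
  from A have Ne: "N e = 1" and SS: "\<And>x. S (S x) = N x *s x"
    and TS: "\<And>x y. trace2 N e (S x) y = lin N x y" and eX: "\<And>x. cross S e x = trace1 N e x *s e - x"
    and an: "\<And>x. x \<noteq> 0 \<Longrightarrow> N x \<noteq> 0"
    by (auto simp: division_albert_def cubic_norm_structure_def)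
  define C where "C x y z = (\<Sum>i\<in>UNIV. \<Sum>j\<in>UNIV. \<Sum>k\<in>UNIV. c i j k * x$i * y$j * z$k)" for x y z :: "'k ^ 27"
  have NC: "N x = C x x x" for x by (simp add: N C_def)
  have Cl: "C (x + x') y z = C x y z + C x' y z" "C x (y + y') z = C x y z + C x y' z" "C x y (z + z') = C x y z + C x y z'"
    "C (k *s x) y z = k * C x y z" "C x (k *s y) z = k * C x y z" "C x y (k *s z) = k * C x y z" for x x' y y' z z' k
    by (simp_all add: C_def sum.distrib sum_distrib_left algebra_simps)
  define D where "D x y = C x x y + C x y x + C y x x" for x y
  define n3 where "n3 x y z = C x y z + C y x z + C x z y + C y z x + C z x y + C z y x" for x y z
  have linN: "lin N x y = D x y" for x y
    by (rule lin_eqI[OF inf, where c = "C x y y + C y x y + C y y x" and d = "C y y y"])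
      (simp add: NC Cl D_def algebra_simps power2_eq_square power3_eq_cube)
  have linD: "lin (\<lambda>x. lin N x y) x z = n3 x z y" for x y z
    unfolding linN
    by (rule lin_eqI[OF inf, where c = "D z y" and d = 0])
      (simp add: Cl D_def n3_def algebra_simps power2_eq_square)
  have T: "trace2 N e y z = D e y * D e z - n3 e z y" for y z
    by (simp add: trace2_def linN linD[unfolded linN])
  have Dl: "D x (y + y') = D x y + D x y'" "D x (k *s y) = k * D x y" for x y y' k
    by (simp_all add: D_def Cl algebra_simps)
  have nl: "n3 x y (z + z') = n3 x y z + n3 x y z'" "n3 x y (k *s z) = k * n3 x y z" for x y z z' k
    by (simp_all add: n3_def Cl algebra_simps)
  have ns: "n3 x y z = n3 y x z" "n3 x y z = n3 x z y" for x y z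
    by (simp_all add: n3_def)
  have X: "cross S x y $ l = (\<Sum>i\<in>UNIV. \<Sum>j\<in>UNIV. d l i j * (x$i * y$j + y$i * x$j))" for x y l
    by (simp add: cross_def S sum_subtractf[symmetric] sum.distrib[symmetric] algebra_simps)
  have Xa: "cross S (x + y) z = cross S x z + cross S y z" "cross S (k *s x) z = k *s cross S x z" "cross S x z = cross S z x"
    for x y z k
    by (simp_all add: vec_eq_iff X sum.distrib[symmetric] sum_distrib_left algebra_simps)
  have Ssc: "S (k *s x) = k^2 *s S x" for k x
    by (simp add: vec_eq_iff S sum_distrib_left power2_eq_square algebra_simps)
  have Sx: "cross S x x = 2 *s S x" for x
  proof -
    have "x + x = 2 *s x" by (simp add: vec_eq_iff)
    then have "cross S x x = S (2 *s x) - S x - S x" by (simp only: cross_def)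
    then show ?thesis unfolding Ssc by (simp add: vec_eq_iff)
  qed
  let ?T = "trace2 N e"
  have Tl: "?T (x + y) z = ?T x z + ?T y z" "?T (k *s x) y = k * ?T x y" for x y z k
    unfolding T by (simp_all add: Dl nl algebra_simps)
  have Ts: "?T x y = ?T y x" for x y
    unfolding T using ns(2)[of e x y] by (simp add: mult.commute)
  have Td: "?T (x - y) z = ?T x z - ?T y z" for x y z using Tl(1)[of "x - y" y z] by simp
  have TX: "?T (cross S x y) z = n3 x y z" for x y z
    unfolding cross_def Td TS linN by (simp add: D_def n3_def Cl)
  have TXX: "?T (cross S x y) z = ?T x (cross S y z)" for x y z
  proof -
    have "n3 x y z = n3 y z x" by (rule trans[OF ns(1)[of x y z] ns(2)[of y x z]])
    then show ?thesis unfolding Ts[of x "cross S y z"] TX .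
  qed
  have e0: "e \<noteq> 0" using Ne by (auto simp: NC C_def)
  have Te: "?T e e = 3"
  proof -
    have "S e = e" using A by (simp add: division_albert_def cubic_norm_structure_def)
    then have "2 *s e = ?T e e *s e - e" using eX[of e] by (simp add: Sx trace1_def)
    then have "(?T e e - 3) *s e = 0" by (simp add: vec_eq_iff algebra_simps)
    then show ?thesis using e0 by simp
  qed
  \<comment> \<open>Coordinate i of the difference of the two sides of \<open>X_four\<close>. It is
    symmetric and 4-linear, and on the diagonal it is 24 times the defect in S (S x) = N x
    x.\<close>
  define F where "F i w x y z = (cross S (cross S w x) (cross S y z) + cross S (cross S w y) (cross S x z) + cross S (cross S w z) (cross S x y)
       - (n3 x y z *s w + n3 w y z *s x + n3 w x z *s y + n3 w x y *s z)) $ i" for i w x y z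
  have n1: "n3 (x + x') y z = n3 x y z + n3 x' y z" "n3 (k *s x) y z = k * n3 x y z" for x x' y z k
    by (simp_all add: n3_def Cl algebra_simps)
  have Xr: "cross S z (x + y) = cross S z x + cross S z y" "cross S z (k *s x) = k *s cross S z x" for x y z k
    using Xa(1)[of x y z] Xa(2)[of k x z]
    by (simp_all only: Xa(3)[of z "x + y"] Xa(3)[of z x] Xa(3)[of z y] Xa(3)[of z "k *s x"])
  have "F i w x y z = 0" for i w x y z
  proof (rule quartic_polarize[where F = "F i", OF two three])
    show "F i (x + x') y z w = F i x y z w + F i x' y z w" for x x' y z w
      by (simp add: F_def Xa(1) Xr n1 algebra_simps)
    show "F i (k *s x) y z w = k * F i x y z w" for k x y z w
      by (simp add: F_def Xa(2) Xr n1 algebra_simps)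
    show "F i x y z w = F i y x z w" for x y z w
      unfolding F_def using Xa(3)[of y x] Xa(3)[of "cross S y z" "cross S x w"] Xa(3)[of "cross S y w" "cross S x z"] ns(1)[of y x]
      by (simp add: algebra_simps)
    show "F i x y z w = F i x z y w" for x y z w
      unfolding F_def using Xa(3)[of z y] ns(1)[of z y w] ns(2)[of x z y] by (simp add: algebra_simps)
    show "F i x y z w = F i x y w z" for x y z w
      unfolding F_def using Xa(3)[of w z] ns(2)[of y w z] ns(2)[of x w z] by (simp add: algebra_simps)
    show "F i x x x x = 0" for x
    proof -
      have n: "n3 x x x = 6 * N x" by (simp add: n3_def NC)
      have "cross S (cross S x x) (cross S x x) = 8 *s (N x *s x)"
        unfolding Sx[of "cross S x x"] unfolding Sx[of x] Ssc SS by (simp add: vec_eq_iff)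
      then show ?thesis by (simp add: F_def n)
    qed
  qed
  then have four: "cross S (cross S w x) (cross S y z) + cross S (cross S w y) (cross S x z) + cross S (cross S w z) (cross S x y)
       = n3 x y z *s w + n3 w y z *s x + n3 w x z *s y + n3 w x y *s z" for w x y z
    by (simp add: F_def vec_eq_iff)
  interpret cubic "cross S" ?T e
    by unfold_locales (fact two three Xa Tl Ts TXX eX[unfolded trace1_def] Te four[folded TX])+
  have sh: "sh x = S x" for x unfolding sh_def Sx using two by simp
  have Nm: "Nm x = N x" for x
  proof -
    have "?T x (S x) = 3 * N x" unfolding Ts[of x "S x"] TS linN by (simp add: D_def NC)
    then show ?thesis unfolding Nm_def sh using three by simp
  qed
  show "cubic_div (cross S) ?T e"
    by unfold_locales (use inf an Nm in auto)
  show "cubic.Nm (cross S) ?T = N" using Nm by blast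
  show "jp = jprod N S e" by (intro ext) (simp add: jp_def jprod_def trace1_def)
qed

section \<open>The subfield as K[m], and similarities as matrices\<close>

context cubic_div
begin

text \<open>Any m in L outside K e will do: m# is m^2 - T(m) m + T(m#) e, so K[m] lies in L, and
  both have dimension 3.\<close>

lemma subfield_gen:
  assumes L: "L = {a1 *s b1 + a2 *s b2 + a3 *s b3 | a1 a2 a3. True}"
    and indep: "\<And>a1 a2 a3. a1 *s b1 + a2 *s b2 + a3 *s b3 = 0 \<Longrightarrow> a1 = 0 \<and> a2 = 0 \<and> a3 = 0"
    and eL: "e \<in> L" and jpL: "\<And>x y. x \<in> L \<Longrightarrow> y \<in> L \<Longrightarrow> jp x y \<in> L"
  obtains m where "m \<notin> scal" "L = gen m"
proof -
  have span: "L = vec.span {b1, b2, b3}"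
  proof
    show "L \<subseteq> vec.span {b1, b2, b3}"
      unfolding L by (clarify, intro vec.span_add vec.span_scale vec.span_base) auto
    have LI: "a1 *s b1 + a2 *s b2 + a3 *s b3 \<in> L" for a1 a2 a3 unfolding L by blast
    have "vec.subspace L"
      unfolding vec.subspace_def
    proof (intro conjI ballI allI)
      show "0 \<in> L" using LI[of 0 0 0] by simp
      fix x y k assume "x \<in> L"
      then obtain a1 a2 a3 where x: "x = a1 *s b1 + a2 *s b2 + a3 *s b3" unfolding L by blast
      show "k *s x \<in> L" using LI[of "k*a1" "k*a2" "k*a3"] by (simp add: x vec.scale_right_distrib)
      assume "y \<in> L"
      then obtain c1 c2 c3 where y: "y = c1 *s b1 + c2 *s b2 + c3 *s b3" unfolding L by blast
      show "x + y \<in> L" using LI[of "a1+c1" "a2+c2" "a3+c3"] by (simp add: x y vec.scale_left_distrib add_ac)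
    qed
    moreover have "{b1, b2, b3} \<subseteq> L" using LI[of 1 0 0] LI[of 0 1 0] LI[of 0 0 1] by simp
    ultimately show "vec.span {b1, b2, b3} \<subseteq> L" by (intro vec.span_minimal)
  qed
  have sub: "vec.subspace L" unfolding span by (rule vec.subspace_span)
  have "\<exists>m\<in>L. m \<notin> scal"
  proof (rule ccontr)
    assume "\<not> ?thesis"
    moreover have "b1 \<in> L" "b2 \<in> L" unfolding span by (auto intro: vec.span_base)
    ultimately obtain k1 k2 where k: "b1 = k1 *s e" "b2 = k2 *s e" by (metis scal_def imageE)
    have "k2 *s b1 + (- k1) *s b2 + 0 *s b3 = 0" by (simp add: k mult.commute)
    from indep[OF this] have "k1 = 0" by simp
    then have "1 *s b1 + 0 *s b2 + 0 *s b3 = 0" by (simp add: k)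
    from indep[OF this] show False by simp
  qed
  then obtain m where m: "m \<in> L" "m \<notin> scal" by blast
  have s: "jp m m - T m e *s m + T (sh m) e *s e = sh m" by (simp add: jp_self)
  have "jp m m - T m e *s m + T (sh m) e *s e \<in> L"
    by (intro vec.subspace_add[OF sub] vec.subspace_diff[OF sub] vec.subspace_scale[OF sub] jpL m(1) eL)
  then have "sh m \<in> L" unfolding s .
  then have sL: "gen m \<subseteq> L" unfolding gen_span by (intro vec.span_minimal sub) (auto simp: m eL)
  have "vec.dim L \<le> card {b1, b2, b3}" unfolding span by (rule vec.dim_le_card) auto
  also have "\<dots> \<le> 3" using card_length[of "[b1, b2, b3]"] by simp
  finally have "gen m = L" using vec.subspace_dim_equal[OF subspace_gen sub sL] dim_gen[OF m(2)] by simp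
  then show thesis using that m(2) by blast
qed

end

locale albert = cubic_div cr T e
  for cr :: "'a::field ^ 27 \<Rightarrow> 'a ^ 27 \<Rightarrow> 'a ^ 27"  (infixl "\<bowtie>" 75)
    and T :: "'a ^ 27 \<Rightarrow> 'a ^ 27 \<Rightarrow> 'a" and e :: "'a ^ 27"
begin

lemma matrix_apply:
  fixes \<rho> :: "'a ^ 27 \<Rightarrow> 'a ^ 27"
  assumes "\<And>x y. \<rho> (x + y) = \<rho> x + \<rho> y" "\<And>k x. \<rho> (k *s x) = k *s \<rho> x"
  shows "matrix \<rho> *v x = \<rho> x"
  by (rule matrix_works) (unfold_locales, simp_all add: assms)

lemma sim_Str:
  assumes \<rho>: "\<And>x y. \<rho> (x + y) = \<rho> x + \<rho> y" "\<And>k x. \<rho> (k *s x) = k *s \<rho> x" "\<And>x. Nm (\<rho> x) = \<nu> * Nm x" "\<nu> \<noteq> 0"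
  shows "matrix \<rho> \<in> Str Nm"
proof -
  note ap = matrix_apply[OF \<rho>(1,2)]
  have "inj \<rho>" using sim_bij[OF \<rho>] by (simp add: bij_def)
  moreover have "(*v) (matrix \<rho>) = \<rho>" by (rule ext) (rule ap)
  ultimately obtain B where "B ** matrix \<rho> = mat 1" using matrix_left_invertible_injective[of "matrix \<rho>"] by auto
  then have "det B * det (matrix \<rho>) = 1" by (metis det_mul det_I)
  then have "det (matrix \<rho>) \<noteq> 0" by auto
  then show ?thesis unfolding Str_def using \<rho>(3) ap by auto
qed

text \<open>The path from 1 to \<rho>, followed by \<rho>', joins \<rho>' to its composition with
  \<rho>. The function f becomes the denominator Q, so the matrix curve is defined exactly where f
  is nonzero.\<close>

lemma R_link_step:
  assumes "rpath \<rho>"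
    and \<rho>': "\<And>x y. \<rho>' (x + y) = \<rho>' x + \<rho>' y" "\<And>k x. \<rho>' (k *s x) = k *s \<rho>' x" "\<And>x. Nm (\<rho>' x) = \<nu> * Nm x" "\<nu> \<noteq> 0"
  shows "R_link Nm (matrix \<rho>') (matrix (\<lambda>x. \<rho>' (\<rho> x)))"
proof -
  obtain R :: "'a \<Rightarrow> 'a ^ 27 \<Rightarrow> 'a ^ 27" and f \<mu> :: "'a \<Rightarrow> 'a" where
    R: "\<forall>t x y. R t (x + y) = R t x + R t y" "\<forall>t k x. R t (k *s x) = k *s R t x"
     "\<exists>d. polyf d f" "f 0 \<noteq> 0" "f 1 \<noteq> 0" "\<forall>x. \<exists>d. polyv d (\<lambda>t. f t *s R t x)"
     "\<forall>t x. Nm (R t x) = \<mu> t * Nm x" "\<forall>t. f t \<noteq> 0 \<longrightarrow> \<mu> t \<noteq> 0" "\<forall>x. R 0 x = x" "\<forall>x. R 1 x = \<rho> x"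
    using assms(1) unfolding rpath_def by (elim exE conjE) (rule that; (assumption | rule exI))
  obtain Q where Q: "\<And>t. f t = poly Q t" using R(3) by (auto simp: polyf_def)
  have ex: "\<exists>p. \<forall>t. f t * \<rho>' (R t (axis j 1)) $ i = poly p t" for i j
  proof -
    obtain d where d: "polyv d (\<lambda>t. f t *s R t (axis j 1))" using R(6) by blast
    have "f t * \<rho>' (R t (axis j 1)) $ i = (\<Sum>k\<in>UNIV. matrix \<rho>' $ i $ k * (f t *s R t (axis j 1)) $ k)" for t
    proof -
      have "f t * \<rho>' (R t (axis j 1)) $ i = \<rho>' (f t *s R t (axis j 1)) $ i" by (simp add: \<rho>'(2))
      also have "\<dots> = (matrix \<rho>' *v (f t *s R t (axis j 1))) $ i" by (simp only: matrix_apply[OF \<rho>'(1,2)])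
      finally show ?thesis by (simp add: matrix_vector_mult_def)
    qed
    moreover have "polyf d (\<lambda>t. \<Sum>k\<in>UNIV. matrix \<rho>' $ i $ k * (f t *s R t (axis j 1)) $ k)"
      by (intro polyf_sum polyf_cmult) (use d in \<open>simp add: polyv_def\<close>)
    ultimately show ?thesis by (auto simp: polyf_def)
  qed
  define P where "P i j = (SOME p. \<forall>t. f t * \<rho>' (R t (axis j 1)) $ i = poly p t)" for i j
  have P: "f t * \<rho>' (R t (axis j 1)) $ i = poly (P i j) t" for i j t
    using someI_ex[OF ex[where i = i and j = j]] unfolding P_def by blast
  have at: "curve_at P Q t = matrix (\<lambda>x. \<rho>' (R t x))" if "f t \<noteq> 0" for t
    using that by (simp add: curve_at_def matrix_def vec_eq_iff P[symmetric] Q[symmetric])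
  have St: "curve_at P Q t \<in> Str Nm" if t: "f t \<noteq> 0" for t
    unfolding at[OF t]
    by (rule sim_Str[where \<nu> = "\<nu> * \<mu> t"]) (use R t \<rho>' in auto)
  have df: "defined_at P Q t" if t: "f t \<noteq> 0" for t
    using St[OF t] t by (simp add: defined_at_def Str_def Q)
  have "curve_at P Q 0 = matrix \<rho>'" "curve_at P Q 1 = matrix (\<lambda>x. \<rho>' (\<rho> x))"
    using at[OF R(4)] at[OF R(5)] R(9,10) by simp_all
  moreover have "curve_at P Q t \<in> Str Nm" if "defined_at P Q t" for t
    using St that by (simp add: defined_at_def Q)
  ultimately show ?thesis unfolding R_link_def using df[OF R(4)] df[OF R(5)] by blast
qed

lemma rtriv_Str: "rtriv \<rho> \<Longrightarrow> matrix \<rho> \<in> Str Nm"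
  using rtriv_lin(3)[of \<rho>] sim_Str[of \<rho>, OF rtriv_lin(1,2)] by metis

lemma rtriv_R_equiv: "rtriv \<rho> \<Longrightarrow> R_equiv_one Nm (matrix \<rho>)"
proof (induction rule: rtriv.induct)
  case rtriv_id
  have "matrix (\<lambda>x :: 'a ^ 27. x) = mat 1" using matrix_id_mat_1 by (simp add: id_def)
  then show ?case by (simp add: R_equiv_one_def)
next
  case (rtriv_step \<rho> \<rho>')
  note l = rtriv_lin[OF rtriv_step(2)]
  obtain \<nu> where "\<nu> \<noteq> 0" "\<And>x. Nm (\<rho>' x) = \<nu> * Nm x" using l(3) by blast
  then have "R_link Nm (matrix \<rho>') (matrix (\<lambda>x. \<rho>' (\<rho> x)))" using R_link_step[OF rtriv_step(1) l(1,2)] by blast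
  then show ?case using rtriv_step.IH unfolding R_equiv_one_def by (rule rtranclp.rtrancl_into_rtrancl[rotated])
qed

end

text \<open>Supplies the middle factor 1: the R-trivial factor already induces on L all that g does,
  its automorphism included.\<close>

lemma mat_one_normalizer:
  fixes N :: "'k::field ^ 27 \<Rightarrow> 'k"
  shows "mat 1 \<in> normalizer_H N S e L"
proof -
  have "matrix_inv (mat 1 :: 'k ^ 27 ^ 27) = mat 1"
    unfolding matrix_inv_def by (rule some_equality) auto
  then show ?thesis by (simp add: normalizer_H_def Aut_def)
qed

theorem mainTheorem16:
  fixes N :: "'k::field ^ 27 \<Rightarrow> 'k"
    and S :: "'k ^ 27 \<Rightarrow> 'k ^ 27"
    and e :: "'k ^ 27"
    and L :: "('k ^ 27) set"
    and g :: "'k ^ 27 ^ 27"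
  assumes "infinite (UNIV :: 'k set)"
    and "(2::'k) \<noteq> 0" and "(3::'k) \<noteq> 0"
    and "division_albert N S e"
    and "cubic_subfield N S e L"
    and "g \<in> Str N"
    and "(\<lambda>x. g *v x) ` L = L"
  shows "\<exists>r g1 g2. r \<in> Str N \<and> R_equiv_one N r \<and>
           g1 \<in> normalizer_H N S e L \<and> g2 \<in> GL_fix N L \<and>
           (\<lambda>x. g1 *v x) ` L = L \<and> (\<lambda>x. g2 *v x) ` L = L \<and>
           g = r ** g1 ** g2"
proof -
  note cd = cubic_of_division_albert[OF assms(1-4)]
  interpret A: cubic_div "cross S" "trace2 N e" e by (rule cd(1))
  interpret A: albert "cross S" "trace2 N e" e ..
  note NN = cd(2) and jj = cd(3)
  have "\<exists>b1 b2 b3. L = {a1 *s b1 + a2 *s b2 + a3 *s b3 | a1 a2 a3. True} \<and>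
        (\<forall>a1 a2 a3. a1 *s b1 + a2 *s b2 + a3 *s b3 = 0 \<longrightarrow> a1 = 0 \<and> a2 = 0 \<and> a3 = 0)"
    and Le: "e \<in> L" and Lj: "\<And>x y. x \<in> L \<Longrightarrow> y \<in> L \<Longrightarrow> A.jp x y \<in> L"
    using assms(5) unfolding cubic_subfield_def jj by blast+
  then obtain b1 b2 b3 where b: "L = {a1 *s b1 + a2 *s b2 + a3 *s b3 | a1 a2 a3. True}"
    "\<And>a1 a2 a3. a1 *s b1 + a2 *s b2 + a3 *s b3 = 0 \<Longrightarrow> a1 = 0 \<and> a2 = 0 \<and> a3 = 0" by blast
  obtain m where m: "m \<notin> A.scal" "L = A.gen m" by (rule A.subfield_gen[OF b Le Lj])
  from assms(6) obtain \<nu> where dg: "det g \<noteq> 0" and \<nu>: "\<And>x. N (g *v x) = \<nu> * N x" by (auto simp: Str_def)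
  have Ne: "N e = 1" using A.Nm_unit by (simp add: NN)
  have "\<nu> \<noteq> 0"
  proof
    assume "\<nu> = 0"
    then have z: "g *v e = 0" using A.aniso[of "g *v e"] \<nu>[of e] by (simp add: NN)
    obtain B where "B ** g = mat 1" using dg invertible_det_nz[of g] by (auto simp: invertible_def)
    then have "e = B *v (g *v e)" by (simp add: matrix_vector_mul_assoc)
    then show False using z A.unit_nonzero by simp
  qed
  have "\<exists>\<rho>. A.rtriv \<rho> \<and> (\<forall>l\<in>A.gen m. \<rho> l = g *v l)"
    by (rule A.match_on_gen[OF m(1), where \<nu> = \<nu>])
      (use \<open>\<nu> \<noteq> 0\<close> assms(7) m(2) in \<open>simp_all add: NN \<nu> matrix_vector_right_distrib vector_scalar_commute\<close>)
  then obtain \<rho> where \<rho>: "A.rtriv \<rho>" "\<And>l. l \<in> L \<Longrightarrow> \<rho> l = g *v l" using m(2) by blast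
  define r where "r = matrix \<rho>"
  have rv: "r *v x = \<rho> x" for x unfolding r_def by (rule A.matrix_apply[OF A.rtriv_lin(1,2)[OF \<rho>(1)]])
  have rS: "r \<in> Str N" using A.rtriv_Str[OF \<rho>(1)] by (simp add: NN r_def)
  have rR: "R_equiv_one N r" using A.rtriv_R_equiv[OF \<rho>(1)] by (simp add: NN r_def)
  obtain \<nu>' where dr: "det r \<noteq> 0" and \<nu>': "\<And>x. N (r *v x) = \<nu>' * N x" using rS by (auto simp: Str_def)
  obtain B where B: "B ** r = mat 1" "r ** B = mat 1" using dr invertible_det_nz[of r] by (auto simp: invertible_def)
  define h where "h = B ** g"
  have g: "g = r ** h" unfolding h_def matrix_mul_assoc B(2) by simp
  have hl: "h *v l = l" if "l \<in> L" for l
  proof -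
    have "h *v l = B *v (r *v l)" unfolding h_def by (simp add: matrix_vector_mul_assoc[symmetric] rv \<rho>(2)[OF that])
    then show ?thesis by (simp add: matrix_vector_mul_assoc B(1))
  qed
  have Nh: "\<nu>' * N (h *v x) = \<nu> * N x" for x
    using \<nu>[of x] \<nu>'[of "h *v x"] by (simp add: g matrix_vector_mul_assoc)
  \<comment> \<open>The multipliers are compared at e, which h fixes and which has norm 1; hence h
    is an isometry.\<close>
  have "\<nu>' = \<nu>" using Nh[of e] by (simp add: hl[OF Le] Ne)
  then have "N (h *v x) = N x" for x using Nh[of x] \<open>\<nu> \<noteq> 0\<close> by simp
  moreover have "det h \<noteq> 0" using dg unfolding g by (simp add: det_mul)
  ultimately have "h \<in> GL_fix N L" by (simp add: GL_fix_def Gpts_def hl)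
  moreover have "(\<lambda>x. h *v x) ` L = L" using hl by force
  moreover have "g = r ** mat 1 ** h" by (simp add: g)
  ultimately show ?thesis
    using rS rR mat_one_normalizer[of N S e L] by (intro exI[of _ r] exI[of _ "mat 1"] exI[of _ h]) simp
qed

end
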